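(* Let $0<p,q<\infty$, $0<s\le q$, $\beta_i>-1$ and $0<t_i\le s$ for $i=1,\ldots,m$, and let $\mu$ be a positive Borel measure on $\mathbb H$. Then the following conditions are equivalent. (1) There is a constant $C>0$ such that for all $f_i\in B^{s,t_i}_{(\beta_i+1)/s}$, $i=1,\ldots,m$, $$\|(f_1,\ldots,f_m)\|_{A(p,q,m,d\mu)}\le C\prod_{i=1}^m\|f_i\|_{B^{s,t_i}_{(\beta_i+1)/s}}.$$ (2) There is a constant $C>0$ such that for all $f_i\in F^{s,t_i}_{(\beta_i+1)/s}$, $i=1,\ldots,m$, $$\|(f_1,\ldots,f_m)\|_{A(p,q,m,d\mu)}\le C\prod_{i=1}^m\|f_i\|_{F^{s,t_i}_{(\beta_i+1)/s}}.$$ (3) There is a constant $C>0$ such that $$\mu(\Delta_k)\le C\,\eta_k^{\sum_{i=1}^m\frac{p(n+1+\beta_i)}{s}},\qquad k\ge1.$$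
   Context: $\mathbb H=\{(x,t):x\in\mathbb R^n,\ t>0\}\subset\mathbb R^{n+1}$; points are written $z=(x,t)$. $h(\mathbb H)$ is the space of harmonic functions on $\mathbb H$. $A\asymp B$ means $cA\le B\le CA$ for some constants $c,C>0$. For $f\in h(\mathbb H)$, $t>0$, put $M_p(f,t)=\|f(\cdot,t)\|_{L^p(\mathbb R^n)}$. For $0<p,q<\infty$ and real $\alpha$, the harmonic mixed norm space $B^{p,q}_\alpha$ consists of all $f\in h(\mathbb H)$ with $$\|f\|_{B^{p,q}_\alpha}^q=\int_0^\infty M_p(f,t)^q\,t^{\alpha q-1}\,dt<\infty,$$ and the harmonic Triebel-Lizorkin space $F^{p,q}_\alpha$ consists of all $f\in h(\mathbb H)$ with $$\|f\|_{F^{p,q}_\alpha}^p=\int_{\mathbb R^n}\left(\int_0^\infty|f(x,t)|^q\,t^{\alpha q-1}\,dt\right)^{p/q}dx<\infty.$$ $\{\Delta_k\}_{k\ge1}$ is a fixed Whitney decomposition of $\mathbb H$: closed cubes in $\mathbb H$ with sides parallel to the coordinate axes, with pairwise disjoint interiors, $\bigcup_k\Delta_k=\mathbb H$, and $\operatorname{diam}\Delta_k\asymp\operatorname{dist}(\Delta_k,\partial\mathbb H)$ uniformly in $k$. $\zeta_k=(\xi_k,\eta_k)$ is the center of $\Delta_k$. $\Delta_k^\ast$ is the cube with the same center as $\Delta_k$ enlarged $5/4$ times; these satisfy $\Delta_k^\ast\subset\mathbb H$, $\sum_k\chi_{\Delta_k^\ast}\le C_n$, and $t\asymp\eta_k$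 for $(x,t)\in\Delta_k^\ast$, uniformly in $k$. For $0<p,q<\infty$, a positive Borel measure $\mu$ on $\mathbb H$ and $f_1,\ldots,f_m\in h(\mathbb H)$, $$\|(f_1,\ldots,f_m)\|_{A(p,q,m,d\mu)}^q=\sum_{k=1}^\infty\left(\int_{\Delta_k}\prod_{i=1}^m|f_i(z)|^p\,d\mu(z)\right)^{q/p}.$$ *)

theory Defs
  imports "HOL-Analysis.Analysis"
begin

definition upper_half :: "((real^'n::finite) \<times> real) set" where
  "upper_half = {z. snd z > 0}"

text \<open>Twice continuously differentiable on \<open>S\<close> (an open set in all uses below) with vanishing
  Laplacian: \<open>g\<close> is the gradient of \<open>f\<close>, \<open>h\<close> its Hessian, and the Laplacian is the trace of \<open>h\<close>.
  The values of \<open>f\<close> outside \<open>S\<close> play no role.\<close>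

definition harmonic_on :: "('a::euclidean_space \<Rightarrow> real) \<Rightarrow> 'a set \<Rightarrow> bool" where
  "harmonic_on f S \<longleftrightarrow>
    (\<exists>(g :: 'a \<Rightarrow> 'a) (h :: 'a \<Rightarrow> 'a \<Rightarrow>\<^sub>L 'a).
      (\<forall>z\<in>S. (f has_derivative (\<lambda>v. g z \<bullet> v)) (at z)) \<and>
      (\<forall>z\<in>S. (g has_derivative blinfun_apply (h z)) (at z)) \<and>
      continuous_on S h \<and>
      (\<forall>z\<in>S. (\<Sum>b\<in>Basis. blinfun_apply (h z) b \<bullet> b) = 0))"

text \<open>Real powers on \<open>[0,\<infinity>]\<close>; only used with a positive exponent, so that \<open>\<infinity>\<close> is sent to \<open>\<infinity>\<close>.\<close>

definition epow :: "ennreal \<Rightarrow> real \<Rightarrow> ennreal" where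
  "epow x r = (if x = top then top else ennreal (enn2real x powr r))"

definition M_mean :: "real \<Rightarrow> ((real^'n::finite) \<times> real \<Rightarrow> real) \<Rightarrow> real \<Rightarrow> ennreal" where
  "M_mean p f t = epow (\<integral>\<^sup>+x. ennreal (\<bar>f (x, t)\<bar> powr p) \<partial>lborel) (1 / p)"

text \<open>The (quasi-)norms take the value \<open>\<infinity>\<close> outside the corresponding spaces.\<close>

definition B_norm :: "real \<Rightarrow> real \<Rightarrow> real \<Rightarrow> ((real^'n::finite) \<times> real \<Rightarrow> real) \<Rightarrow> ennreal" where
  "B_norm p q \<alpha> f =
    epow (\<integral>\<^sup>+t\<in>{0<..}. epow (M_mean p f t) q * ennreal (t powr (\<alpha> * q - 1)) \<partial>lborel) (1 / q)"

definition B_space :: "real \<Rightarrow> real \<Rightarrow> real \<Rightarrow> ((real^'n::finite) \<times> real \<Rightarrow> real) set" where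
  "B_space p q \<alpha> = {f. harmonic_on f upper_half \<and> B_norm p q \<alpha> f < \<infinity>}"

definition F_norm :: "real \<Rightarrow> real \<Rightarrow> real \<Rightarrow> ((real^'n::finite) \<times> real \<Rightarrow> real) \<Rightarrow> ennreal" where
  "F_norm p q \<alpha> f =
    epow (\<integral>\<^sup>+x. epow (\<integral>\<^sup>+t\<in>{0<..}. ennreal (\<bar>f (x, t)\<bar> powr q * t powr (\<alpha> * q - 1)) \<partial>lborel) (p / q)
      \<partial>lborel) (1 / p)"

definition F_space :: "real \<Rightarrow> real \<Rightarrow> real \<Rightarrow> ((real^'n::finite) \<times> real \<Rightarrow> real) set" where
  "F_space p q \<alpha> = {f. harmonic_on f upper_half \<and> F_norm p q \<alpha> f < \<infinity>}"

text \<open>Closed axis-parallel cube with centre \<open>c\<close> and side length \<open>l\<close>.\<close>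

definition cube :: "'a::euclidean_space \<Rightarrow> real \<Rightarrow> 'a set" where
  "cube c l = {z. \<forall>b\<in>Basis. \<bar>(z - c) \<bullet> b\<bar> \<le> l / 2}"

text \<open>A Whitney decomposition is given by the centres \<open>\<zeta> k\<close> and the side lengths \<open>l k\<close> of its cubes,
  enumerated from \<open>0\<close>. The last three conditions are the standing properties of the enlarged cubes:
  when the Whitney constants are arbitrary they do not all follow from the other conditions.\<close>

definition whitney_decomposition ::
  "(nat \<Rightarrow> (real^'n::finite) \<times> real) \<Rightarrow> (nat \<Rightarrow> real) \<Rightarrow> bool" where
  "whitney_decomposition \<zeta> l \<longleftrightarrow>
    (\<forall>k. l k > 0) \<and>
    (\<forall>j k. j \<noteq> k \<longrightarrow> interior (cube (\<zeta> j) (l j)) \<inter> interior (cube (\<zeta> k) (l k)) = {}) \<and>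
    (\<Union>k. cube (\<zeta> k) (l k)) = upper_half \<and>
    (\<exists>c>0. \<exists>C>0. \<forall>k.
      c * setdist (cube (\<zeta> k) (l k)) (frontier upper_half) \<le> diameter (cube (\<zeta> k) (l k)) \<and>
      diameter (cube (\<zeta> k) (l k)) \<le> C * setdist (cube (\<zeta> k) (l k)) (frontier upper_half)) \<and>
    (\<forall>k. cube (\<zeta> k) (5/4 * l k) \<subseteq> upper_half) \<and>
    (\<exists>N. \<forall>z. finite {k. z \<in> cube (\<zeta> k) (5/4 * l k)} \<and>
      card {k. z \<in> cube (\<zeta> k) (5/4 * l k)} \<le> N) \<and>
    (\<exists>c>0. \<exists>C>0. \<forall>k. \<forall>z\<in>cube (\<zeta> k) (5/4 * l k).
      c * snd (\<zeta> k) \<le> snd z \<and> snd z \<le> C * snd (\<zeta> k))"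

definition A_norm :: "(nat \<Rightarrow> ((real^'n::finite) \<times> real) set) \<Rightarrow> real \<Rightarrow> real \<Rightarrow> nat \<Rightarrow>
    ((real^'n) \<times> real) measure \<Rightarrow> (nat \<Rightarrow> (real^'n) \<times> real \<Rightarrow> real) \<Rightarrow> ennreal" where
  "A_norm \<Delta> p q m \<mu> f =
    epow (\<Sum>k. epow (\<integral>\<^sup>+z\<in>\<Delta> k. ennreal (\<Prod>i=1..m. \<bar>f i z\<bar> powr p) \<partial>\<mu>) (q / p)) (1 / q)"

end

theory Submission
  imports Defs
begin

text \<open>Condition (3) implies (1) and (2): for every \<open>a > 0\<close>, \<open>\<bar>f\<bar> powr a\<close> at a point of a Whitney cube
  is bounded by a constant times its average over the enlarged cube. Apply this with \<open>a = t i\<close> and put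
  \<open>r = s / t i \<ge> 1\<close>. Jensen's inequality (for \<open>F\<close>) or Minkowski's inequality in \<open>l\<^sup>r\<close> (for \<open>B\<close>), together
  with the bounded overlap, bounds the sum over \<open>k\<close> of \<open>\<eta> k powr (n + 1 + \<beta> i)\<close> times the supremum of
  \<open>\<bar>f\<bar> powr s\<close> on the \<open>k\<close>-th cube by the \<open>s\<close>-th power of the norm. As \<open>s \<le> q\<close>, the sum over \<open>k\<close> of the
  products is at most the product of such sums.

  Conversely, (3) follows by testing with translated Kelvin transforms of \<open>Re ((t + \<i> * x\<^sub>1) ^ M)\<close>: they decay fast
  when \<open>M\<close> is large, are bounded by a function of \<open>x\<close> times a function of \<open>t\<close> (so that both norms are
  easily estimated), and do not vanish on the cube if the pole is placed sufficiently deep below it.\<close>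

section \<open>Powers of extended nonnegative reals and integral inequalities\<close>

text \<open>Constants need not be sharp, so the Hoelder-type inequalities are proved only up to a
  factor \<open>2 powr r\<close>: an elementary pointwise bound with a free parameter is integrated,
  and the parameter is chosen last. The two scales differ in the order of integration. For F the
  inner integral is over t: after Jensen in x on each cube, the sum over k meets r-th powers of
  integrals over t, and superadditivity of that power suffices. For B the inner integral is over x:
  the power r stands outside the integral over t, and the sum over k has to be carried through it by
  Minkowski. In both cases Jensen on a cube of volume about \<eta>^n costs \<eta>^(n (r - 1)), which
  is exactly the gap between the exponent given by the mean value estimate and n + 1 + \<beta>. The
  mean value property is proved for a weight on a ball instead of a sphere. The weight times the
  position vector is a gradient, so integration by parts over a box, which follows from translation
  invariance, is enough.\<close>

lemma epow_ennreal: "0 \<le> x \<Longrightarrow> epow (ennreal x) r = ennreal (x powr r)"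
  by (simp add: epow_def)

lemma epow_top [simp]: "epow top r = top"
  by (simp add: epow_def)

lemma epow_0 [simp]: "epow 0 r = 0"
  by (simp add: epow_def)

lemma epow_1 [simp]: "epow 1 r = 1"
  by (simp add: epow_def)

lemma epow_one [simp]: "epow x 1 = x"
  by (cases x) (auto simp: epow_def)

lemma epow_mono: "x \<le> y \<Longrightarrow> 0 \<le> r \<Longrightarrow> epow x r \<le> epow y r"
  by (cases x; cases y)
    (auto simp: epow_def top_unique ennreal_le_iff2 intro!: ennreal_leI powr_mono2)

lemma epow_epow: "epow (epow x a) b = epow x (a * b)"
  by (cases x) (auto simp: epow_def powr_powr)

lemma epow_mult: "epow (x * y) r = epow x r * epow y r"
proof (cases "x = 0 \<or> y = 0")
  case False
  then show ?thesis
    by (cases x; cases y)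
      (auto simp: epow_def ennreal_mult_top ennreal_top_mult powr_mult ennreal_mult[symmetric] ennreal_mult_eq_top_iff)
qed auto

lemma epow_eq_0_iff: "epow x r = 0 \<longleftrightarrow> x = 0"
  by (cases x) (auto simp: epow_def)

lemma epow_prod: "finite I \<Longrightarrow> epow (\<Prod>i\<in>I. f i) r = (\<Prod>i\<in>I. epow (f i) r)"
  by (induction I rule: finite_induct) (auto simp: epow_mult)

lemma measurable_epow [measurable]:
  "f \<in> borel_measurable M \<Longrightarrow> (\<lambda>x. epow (f x) r) \<in> borel_measurable M"
proof -
  assume [measurable]: "f \<in> borel_measurable M"
  have "f -` {top} \<inter> space M \<in> sets M" by (rule measurable_sets[of f M borel]) auto
  then have [measurable]: "Measurable.pred M (\<lambda>x. f x = top)"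
    by (simp add: pred_def vimage_def Int_def conj_commute)
  show ?thesis unfolding epow_def by simp
qed

lemma epow_add_superadditive:
  assumes "1 \<le> r"
  shows "epow x r + epow y r \<le> epow (x + y) r"
proof (cases "x + y = top")
  case True
  then show ?thesis by (auto simp: ennreal_add_eq_top)
next
  case False
  then obtain a b where ab: "x = ennreal a" "y = ennreal b" "0 \<le> a" "0 \<le> b"
    by (cases x; cases y) auto
  have "a powr r + b powr r \<le> (a + b) powr r"
  proof (cases "a + b = 0")
    case True
    then have "a = 0" "b = 0" using ab by linarith+
    then show ?thesis by simp
  next
    case False
    then have p: "a + b > 0" using ab by auto
    \<comment> \<open>Used for both summands: adding the two bounds produces the factor
      \<open>a + b\<close> that is missing from the power.\<close>
    have *: "c powr r \<le> (a + b) powr (r - 1) * c" if "0 \<le> c" "c \<le> a + b" for c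
    proof (cases "c = 0")
      case False
      then have "c powr r = c powr (r - 1) * c"
        using that by (simp add: powr_diff)
      also have "\<dots> \<le> (a + b) powr (r - 1) * c"
        using that assms by (intro mult_right_mono powr_mono2) auto
      finally show ?thesis .
    qed auto
    have "a powr r + b powr r \<le> (a + b) powr (r - 1) * (a + b)"
      using *[of a] *[of b] ab by (simp add: distrib_left)
    also have "\<dots> = (a + b) powr r" using p by (simp add: powr_diff)
    finally show ?thesis .
  qed
  then show ?thesis
    using ab by (simp add: epow_ennreal flip: ennreal_plus)
qed

lemma sum_epow_le:
  assumes "1 \<le> r" "finite K"
  shows "(\<Sum>k\<in>K. epow (a k) r) \<le> epow (\<Sum>k\<in>K. a k) r"
  using assms(2)
proof (induction K rule: finite_induct)
  case (insert k K)
  have "(\<Sum>k\<in>insert k K. epow (a k) r) \<le> epow (a k) r + epow (\<Sum>k\<in>K. a k) r"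
    using insert by (simp add: add_left_mono)
  also have "\<dots> \<le> epow (\<Sum>k\<in>insert k K. a k) r"
    using insert epow_add_superadditive[OF assms(1)] by simp
  finally show ?case .
qed simp

lemma suminf_ennreal_le:
  fixes f :: "nat \<Rightarrow> ennreal"
  assumes "\<And>n. (\<Sum>k<n. f k) \<le> x"
  shows "(\<Sum>k. f k) \<le> x"
  using assms by (simp add: suminf_eq_SUP SUP_least)

lemma sum_le_suminf_ennreal: "(\<Sum>k<n. f k) \<le> (\<Sum>k. f k)" for f :: "nat \<Rightarrow> ennreal"
  by (rule sum_le_suminf) auto

lemma le_suminf_ennreal: "f k \<le> (\<Sum>k. f k)" for f :: "nat \<Rightarrow> ennreal"
  using sum_le_suminf[of f "{k}"] by auto

lemma suminf_epow_le:
  assumes "1 \<le> r"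
  shows "(\<Sum>k. epow (a k) r) \<le> epow (\<Sum>k. a k) r"
proof (rule suminf_ennreal_le)
  fix n
  have "(\<Sum>k<n. epow (a k) r) \<le> epow (\<Sum>k<n. a k) r"
    by (rule sum_epow_le[OF assms]) auto
  also have "\<dots> \<le> epow (\<Sum>k. a k) r"
    using assms by (intro epow_mono sum_le_suminf_ennreal) auto
  finally show "(\<Sum>k<n. epow (a k) r) \<le> epow (\<Sum>k. a k) r" .
qed

text \<open>Multiplying out the product of the sums gives every diagonal term and further
  nonnegative ones. The index set must be nonempty, as the left side would otherwise be an infinite
  sum of ones.\<close>

lemma suminf_prod_le:
  fixes b :: "'i \<Rightarrow> nat \<Rightarrow> ennreal"
  assumes "finite I" "I \<noteq> {}"
  shows "(\<Sum>k. \<Prod>i\<in>I. b i k) \<le> (\<Prod>i\<in>I. \<Sum>k. b i k)"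
  using assms
proof (induction I rule: finite_ne_induct)
  case (insert j I)
  have "(\<Sum>k. \<Prod>i\<in>insert j I. b i k) = (\<Sum>k. b j k * (\<Prod>i\<in>I. b i k))"
    using insert by simp
  also have "\<dots> \<le> (\<Sum>k. (\<Sum>k. b j k) * (\<Prod>i\<in>I. b i k))"
    by (intro suminf_le mult_right_mono le_suminf_ennreal) auto
  also have "\<dots> = (\<Sum>k. b j k) * (\<Sum>k. \<Prod>i\<in>I. b i k)" by simp
  also have "\<dots> \<le> (\<Sum>k. b j k) * (\<Prod>i\<in>I. \<Sum>k. b i k)"
    using insert by (intro mult_left_mono) auto
  finally show ?case using insert by simp
qed auto

section \<open>Jensen's and Minkowski's inequalities up to a constant\<close>

lemma tangent_powr:
  fixes g d r :: real
  assumes "0 \<le> g" "0 < d" "1 \<le> r"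
  shows "g \<le> d + d powr (1 - r) * g powr r"
proof (cases "g \<le> d")
  case True
  then show ?thesis using assms by (simp add: add_increasing2)
next
  case False
  then have g: "d < g" "0 < g" using assms by auto
  \<comment> \<open>As \<open>1 - r <= 0\<close>, replacing the base \<open>g\<close> of the first
    factor by the smaller \<open>d\<close> increases it.\<close>
  have "g = g powr (1 - r) * g powr r" using g by (simp flip: powr_add)
  also have "\<dots> \<le> d powr (1 - r) * g powr r"
    using g assms by (intro mult_right_mono powr_mono2') auto
  finally show ?thesis using assms by linarith
qed

text \<open>Minimising over \<open>d\<close> costs a factor \<open>2 powr r\<close> but turns the linear bounds supplied by
  the tangent inequality into a Hoelder bound.\<close>

lemma le_powr_of_tangent:
  fixes a b r :: real
  assumes *: "\<And>d. 0 < d \<Longrightarrow> x \<le> ennreal (d * a + d powr (1 - r) * b)"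
    and a: "0 < a" and b: "0 \<le> b" and r: "1 \<le> r"
  shows "epow x r \<le> ennreal (2 powr r * a powr (r - 1) * b)"
proof -
  have "x \<noteq> top"
    using *[of 1] by (auto simp: top_unique)
  then obtain y where y: "x = ennreal y" "0 \<le> y" by (cases x) auto
  have le: "y \<le> d * a + d powr (1 - r) * b" if "0 < d" for d
  proof -
    have "0 \<le> d * a + d powr (1 - r) * b" using that a b by simp
    then show ?thesis using *[OF that] y by simp
  qed
  have "y powr r \<le> 2 powr r * a powr (r - 1) * b"
  proof (cases "b = 0")
    case True
    have "y = 0"
    proof (rule ccontr)
      assume "y \<noteq> 0"
      \<comment> \<open>With \<open>b = 0\<close> only the linear term is left, and this value of
        the parameter turns it into \<open>y / 2\<close>.\<close>
      then have "0 < y / (2 * a)" using y a by simp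
      from le[OF this] show False using True \<open>y \<noteq> 0\<close> y a by (simp add: field_simps)
    qed
    then show ?thesis using True by simp
  next
    case False
    then have b: "0 < b" using b by simp
    \<comment> \<open>At this parameter both terms have the same value \<open>u\<close>, hence the
      factor 2.\<close>
    define d where "d = (b / a) powr (1 / r)"
    have lam: "0 < d" using a b by (simp add: d_def)
    define u where "u = b powr (1 / r) * a powr (1 - 1 / r)"
    have e: "1 + (1 - r) / r = 1 / r" using r by (simp add: field_simps)
    have "d * a = u"
      using a b by (simp add: d_def u_def powr_divide powr_diff)
    moreover have "d powr (1 - r) * b = u"
    proof -
      have "d powr (1 - r) = (b / a) powr ((1 - r) / r)"
        by (simp add: d_def powr_powr)
      also have "\<dots> * b = b powr ((1 - r) / r + 1) * a powr (- ((1 - r) / r))"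
        using a b by (simp add: powr_divide powr_add powr_minus field_simps)
      also have "\<dots> = u"
        using r by (simp add: u_def diff_divide_distrib)
      finally show ?thesis .
    qed
    ultimately have "y \<le> 2 * u" using le[OF lam] by simp
    then have "y powr r \<le> (2 * u) powr r"
      using y r by (intro powr_mono2) auto
    also have "\<dots> = 2 powr r * (b powr (1 / r * r) * a powr ((1 - 1 / r) * r))"
      using a b by (simp add: u_def powr_mult powr_powr)
    also have "(1 - 1 / r) * r = r - 1" using r by (simp add: field_simps)
    also have "1 / r * r = 1" using r by simp
    finally show ?thesis using b by (simp add: mult_ac)
  qed
  then show ?thesis using y by (simp add: epow_ennreal ennreal_leI)
qed

text \<open>The weight \<open>w powr (1 - r)\<close> on the dual side of Hoelder's inequality. It
  vanishes where \<open>w\<close> is \<open>top\<close>, by decree, and where \<open>w\<close> is 0,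
  because \<open>0 powr x = 0\<close>; at such points \<open>weighted_tangent\<close> holds without
  help from this term.\<close>

definition dual_weight :: "real \<Rightarrow> ennreal \<Rightarrow> ennreal" where
  "dual_weight r w = (if w = top then 0 else ennreal (enn2real w powr (1 - r)))"

lemma measurable_dual_weight [measurable]:
  "f \<in> borel_measurable M \<Longrightarrow> (\<lambda>x. dual_weight r (f x)) \<in> borel_measurable M"
proof -
  assume [measurable]: "f \<in> borel_measurable M"
  have "f -` {top} \<inter> space M \<in> sets M" by (rule measurable_sets[of f M borel]) auto
  then have [measurable]: "Measurable.pred M (\<lambda>x. f x = top)"
    by (simp add: pred_def vimage_def Int_def conj_commute)
  show ?thesis unfolding dual_weight_def by simp
qed

text \<open>\<open>tangent_powr\<close> with \<open>d * w\<close> in place of \<open>d\<close>: a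
  parameter proportional to the weight makes the first term integrate to a multiple of the total
  mass of \<open>w\<close>.\<close>

lemma weighted_tangent:
  assumes "w = 0 \<Longrightarrow> h = 0" "0 < d" "1 \<le> r"
  shows "h \<le> ennreal d * w + ennreal (d powr (1 - r)) * (dual_weight r w * epow h r)"
proof (cases "w = top \<or> w = 0")
  case True
  then show ?thesis using assms by (auto simp: ennreal_mult_top)
next
  case False
  then obtain v where v: "w = ennreal v" "0 < v" by (cases w) (auto simp: less_le)
  show ?thesis
  proof (cases "h = top")
    case True
    then show ?thesis using v assms by (simp add: dual_weight_def ennreal_mult_top)
  next
    case False
    then obtain g where g: "h = ennreal g" "0 \<le> g" by (cases h) auto
    have "g \<le> d * v + (d * v) powr (1 - r) * g powr r"
      using assms v g by (intro tangent_powr) auto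
    then have "ennreal g \<le> ennreal (d * v + d powr (1 - r) * (v powr (1 - r) * g powr r))"
      using assms v by (intro ennreal_leI) (simp add: powr_mult mult_ac)
    also have "\<dots> = ennreal d * w + ennreal (d powr (1 - r)) * (dual_weight r w * epow h r)"
      using assms v g by (simp add: dual_weight_def epow_ennreal ennreal_mult)
    finally show ?thesis using g by simp
  qed
qed

text \<open>Integrating \<open>weighted_tangent\<close> leaves a bound to which
  \<open>le_powr_of_tangent\<close> applies. With \<open>w\<close> an indicator this becomes
  Jensen's inequality on a set; with \<open>w\<close> the pointwise l^r norm of a sequence of
  functions it yields Minkowski's.\<close>

lemma weighted_jensen:
  fixes h w :: "'a \<Rightarrow> ennreal"
  assumes [measurable]: "h \<in> borel_measurable M" "w \<in> borel_measurable M"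
    and 0: "\<And>x. w x = 0 \<Longrightarrow> h x = 0" and fin: "(\<integral>\<^sup>+x. w x \<partial>M) < top" and r: "1 \<le> r"
  shows "epow (\<integral>\<^sup>+x. h x \<partial>M) r
    \<le> ennreal (2 powr r) * epow (\<integral>\<^sup>+x. w x \<partial>M) (r - 1) * (\<integral>\<^sup>+x. dual_weight r (w x) * epow (h x) r \<partial>M)"
    (is "_ \<le> _ * epow ?W _ * ?B")
proof (cases "?W = 0")
  case True
  then have "AE x in M. w x = 0" by (simp add: nn_integral_0_iff_AE)
  then have "AE x in M. h x = 0" using 0 by auto
  then have "(\<integral>\<^sup>+x. h x \<partial>M) = 0" by (simp add: nn_integral_0_iff_AE)
  then show ?thesis by simp
next
  case False
  then obtain a where a: "?W = ennreal a" "0 < a" using fin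
    by (cases ?W) (auto simp: less_le)
  show ?thesis
  proof (cases "?B = top")
    case True
    then show ?thesis using a by (simp add: epow_ennreal ennreal_mult_top flip: ennreal_mult)
  next
    case False
    then obtain b where b: "?B = ennreal b" "0 \<le> b" by (cases ?B) auto
    have "epow (\<integral>\<^sup>+x. h x \<partial>M) r \<le> ennreal (2 powr r * a powr (r - 1) * b)"
    proof (rule le_powr_of_tangent)
      fix d :: real assume l: "0 < d"
      have "(\<integral>\<^sup>+x. h x \<partial>M) \<le> (\<integral>\<^sup>+x. ennreal d * w x + ennreal (d powr (1 - r)) * (dual_weight r (w x) * epow (h x) r) \<partial>M)"
        using weighted_tangent 0 l r by (intro nn_integral_mono) blast
      also have "\<dots> = ennreal d * ?W + ennreal (d powr (1 - r)) * ?B"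
        by (simp add: nn_integral_add nn_integral_cmult)
      also have "\<dots> = ennreal (d * a + d powr (1 - r) * b)"
        using a b l by (simp add: ennreal_mult)
      finally show "(\<integral>\<^sup>+x. h x \<partial>M) \<le> ennreal (d * a + d powr (1 - r) * b)" .
    qed (use a b r in auto)
    also have "\<dots> = ennreal (2 powr r) * epow ?W (r - 1) * ?B"
      using a b by (simp add: epow_ennreal ennreal_mult)
    finally show ?thesis .
  qed
qed

lemma jensen_set:
  fixes h :: "'a \<Rightarrow> ennreal"
  assumes [measurable]: "h \<in> borel_measurable M" "A \<in> sets M"
    and A: "emeasure M A \<le> ennreal a" and r: "1 \<le> r"
  shows "epow (\<integral>\<^sup>+x\<in>A. h x \<partial>M) r \<le> ennreal (2 powr r) * ennreal (a powr (r - 1)) * (\<integral>\<^sup>+x\<in>A. epow (h x) r \<partial>M)"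
proof -
  have e: "dual_weight r (indicator A x) * epow (h x * indicator A x) r = epow (h x) r * indicator A x" for x
    by (auto simp: dual_weight_def indicator_def)
  have I: "(\<integral>\<^sup>+x. indicator A x \<partial>M) = emeasure M A" by simp
  have "epow (\<integral>\<^sup>+x\<in>A. h x \<partial>M) r \<le> ennreal (2 powr r) * epow (emeasure M A) (r - 1) * (\<integral>\<^sup>+x\<in>A. epow (h x) r \<partial>M)"
    using weighted_jensen[of "\<lambda>x. h x * indicator A x" M "indicator A" r] A r
    unfolding e I by (auto simp: indicator_eq_0_iff le_less_trans[OF A])
  also have "\<dots> \<le> ennreal (2 powr r) * ennreal (a powr (r - 1)) * (\<integral>\<^sup>+x\<in>A. epow (h x) r \<partial>M)"
  proof (intro mult_right_mono mult_left_mono)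
    \<comment> \<open>A negative \<open>a\<close> forces a null set, since then
      \<open>ennreal a = 0\<close>.\<close>
    have "epow (emeasure M A) (r - 1) \<le> epow (ennreal (max 0 a)) (r - 1)"
      using A r by (intro epow_mono) (auto simp: max_def ennreal_neg)
    also have "\<dots> \<le> ennreal (a powr (r - 1))"
      by (cases "0 \<le> a") (auto simp: epow_ennreal)
    finally show "epow (emeasure M A) (r - 1) \<le> ennreal (a powr (r - 1))" .
  qed auto
  finally show ?thesis .
qed

text \<open>One weight, the pointwise l^r norm \<open>w\<close> of the sequence, is used in
  \<open>weighted_jensen\<close> for every k. The dual integrals then add up to at most the integral
  of \<open>w\<close>, because \<open>w powr (1 - r) * w powr r = w\<close>.\<close>

lemma minkowski_suminf:
  fixes h :: "nat \<Rightarrow> 'a \<Rightarrow> ennreal"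
  assumes [measurable]: "\<And>k. h k \<in> borel_measurable M" and r: "1 \<le> r"
  shows "(\<Sum>k. epow (\<integral>\<^sup>+x. h k x \<partial>M) r)
    \<le> ennreal (2 powr r) * epow (\<integral>\<^sup>+x. epow (\<Sum>k. epow (h k x) r) (1 / r) \<partial>M) r"
proof -
  define w where "w x = epow (\<Sum>k. epow (h k x) r) (1 / r)" for x
  have [measurable]: "w \<in> borel_measurable M" unfolding w_def by measurable
  have wr: "epow (w x) r = (\<Sum>k. epow (h k x) r)" for x
    using r by (simp add: w_def epow_epow)
  have 0: "h k x = 0" if "w x = 0" for k x
    using that by (simp add: w_def epow_eq_0_iff suminf_eq_zero_iff)
  show ?thesis
  proof (cases "(\<integral>\<^sup>+x. w x \<partial>M) = top")
    case True
    then show ?thesis by (simp add: w_def[symmetric] ennreal_mult_top)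
  next
    case False
    let ?W = "\<integral>\<^sup>+x. w x \<partial>M"
    have "(\<Sum>k. epow (\<integral>\<^sup>+x. h k x \<partial>M) r)
      \<le> (\<Sum>k. ennreal (2 powr r) * epow ?W (r - 1) * (\<integral>\<^sup>+x. dual_weight r (w x) * epow (h k x) r \<partial>M))"
      using False r 0 by (intro suminf_le weighted_jensen) (auto simp: less_top)
    also have "\<dots> = ennreal (2 powr r) * epow ?W (r - 1) * (\<Sum>k. \<integral>\<^sup>+x. dual_weight r (w x) * epow (h k x) r \<partial>M)"
      by simp
    also have "\<dots> \<le> ennreal (2 powr r) * epow ?W (r - 1) * ?W"
    proof (rule mult_left_mono)
      have "(\<Sum>k. \<integral>\<^sup>+x. dual_weight r (w x) * epow (h k x) r \<partial>M)
        = (\<integral>\<^sup>+x. (\<Sum>k. dual_weight r (w x) * epow (h k x) r) \<partial>M)"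
      by (subst nn_integral_suminf) auto
      also have "\<dots> = (\<integral>\<^sup>+x. dual_weight r (w x) * epow (w x) r \<partial>M)"
        by (simp add: wr)
      \<comment> \<open>Only an inequality, because the dual weight is 0 where
        \<open>w x = top\<close>.\<close>
      also have "\<dots> \<le> ?W"
      proof (rule nn_integral_mono)
        fix x
        show "dual_weight r (w x) * epow (w x) r \<le> w x"
          by (cases "w x") (auto simp: dual_weight_def epow_ennreal simp flip: ennreal_mult powr_add)
      qed
      finally show "(\<Sum>k. \<integral>\<^sup>+x. dual_weight r (w x) * epow (h k x) r \<partial>M) \<le> ?W" .
    qed simp
    finally have "(\<Sum>k. epow (\<integral>\<^sup>+x. h k x \<partial>M) r) \<le> ennreal (2 powr r) * (epow ?W (r - 1) * ?W)"
      by (simp add: mult.assoc)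
    also have "epow ?W (r - 1) * ?W = epow ?W r"
    proof -
      obtain a where "?W = ennreal a" "0 \<le> a" using False by (cases ?W) auto
      then show ?thesis
        by (cases "a = 0") (auto simp: epow_ennreal powr_diff simp flip: ennreal_mult)
    qed
    finally show ?thesis by (simp add: w_def)
  qed
qed

section \<open>The mean value property and subharmonicity of powers\<close>

lemma mem_cbox_One_iff:
  "y \<in> cbox (z - c *\<^sub>R One) (z + c *\<^sub>R One) \<longleftrightarrow> (\<forall>b\<in>Basis. \<bar>(y - z) \<bullet> b\<bar> \<le> c)"
  by (auto simp: mem_box inner_diff_left inner_add_left abs_le_iff algebra_simps)

lemmas mem_cbox_One_0_iff = mem_cbox_One_iff[where z=0, simplified]

lemma integral_shift_vanishing:
  fixes u :: "'a::euclidean_space \<Rightarrow> real"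
  assumes u: "continuous_on UNIV u" and 0: "\<And>y. y \<notin> cbox a b \<Longrightarrow> u y = 0"
    and sub: "cbox a b \<subseteq> cbox c d" "cbox a b \<subseteq> cbox (c + v) (d + v)"
  shows "integral (cbox c d) (\<lambda>y. u (y + v)) = integral (cbox c d) u"
proof -
  have I: "integral B u = integral (cbox a b) u" if "cbox a b \<subseteq> B" for B
  proof (rule integral_unique)
    have "(u has_integral integral (cbox a b) u) (cbox a b)"
      by (intro integrable_integral integrable_continuous continuous_on_subset[OF u]) auto
    then show "(u has_integral integral (cbox a b) u) B"
      by (rule has_integral_on_superset) (use 0 that in auto)
  qed
  have "integral (cbox c d) (\<lambda>y. u (y + v)) = integral (cbox (c + v) (d + v)) u"
    using integral_shift_cbox[of "c + v" v "d + v" u] by simp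
  then show ?thesis using I[OF sub(1)] I[OF sub(2)] by simp
qed

text \<open>Integration by parts without boundary terms: the integral of
  \<open>u (y + x *\<^sub>R v)\<close> over y in the box does not depend on x for |x| <= 1, and it
  is differentiated under the integral sign at x = 0. The half-width 2 keeps a support in the unit
  ball inside the box after such a shift.\<close>

lemma integral_directional_derivative_eq_0:
  fixes u :: "'a::euclidean_space \<Rightarrow> real"
  assumes der: "\<And>y. (u has_derivative u' y) (at y)"
    and cont: "continuous_on UNIV (\<lambda>y. u' y v)"
    and 0: "\<And>y. y \<notin> cball 0 1 \<Longrightarrow> u y = 0" and v: "v \<in> Basis"
  shows "integral (cbox (- (2 *\<^sub>R One)) (2 *\<^sub>R One)) (\<lambda>y. u' y v) = 0"
proof -
  let ?B = "cbox (- (2 *\<^sub>R One)) (2 *\<^sub>R One) :: 'a set"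
  have cu: "continuous_on UNIV u"
    using der by (meson continuous_at_imp_continuous_on has_derivative_continuous)
  have "((\<lambda>x. integral ?B (\<lambda>y. u (y + x *\<^sub>R v))) has_field_derivative integral ?B (\<lambda>y. u' (y + 0 *\<^sub>R v) v))
      (at 0 within {-1..1})"
  proof (rule leibniz_rule_field_derivative)
    fix x :: real and y :: 'a
    have "((\<lambda>x. u (y + x *\<^sub>R v)) has_derivative (\<lambda>k. u' (y + x *\<^sub>R v) (k *\<^sub>R v))) (at x within {-1..1})"
      by (rule has_derivative_compose[OF _ der]) (auto intro!: derivative_eq_intros)
    moreover have "u' z (k *\<^sub>R v) = u' z v * k" for z k
      using has_derivative_linear[OF der] by (simp add: linear_cmul)
    ultimately show "((\<lambda>x. u (y + x *\<^sub>R v)) has_field_derivative u' (y + x *\<^sub>R v) v) (at x within {-1..1})"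
      by (simp add: has_field_derivative_def)
  next
    show "(\<lambda>y. u (y + x *\<^sub>R v)) integrable_on ?B" for x
      by (intro integrable_continuous continuous_on_compose2[OF cu] continuous_intros) auto
    show "continuous_on ({- 1..1} \<times> ?B) (\<lambda>(x, y). u' (y + x *\<^sub>R v) v)"
      unfolding split_beta by (intro continuous_on_compose2[OF cont] continuous_intros) auto
  qed auto
  moreover have "integral ?B (\<lambda>y. u (y + x *\<^sub>R v)) = integral ?B u" if "x \<in> {-1..1}" for x
  proof (rule integral_shift_vanishing[OF cu, of "- (1 *\<^sub>R One)" "1 *\<^sub>R One"])
    have sv: "\<bar>(x *\<^sub>R v) \<bullet> b\<bar> \<le> 1" if "b \<in> Basis" for b
      using that \<open>x \<in> _\<close> v by (auto simp: inner_Basis)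
    show "u y = 0" if "y \<notin> cbox (- (1 *\<^sub>R One)) (1 *\<^sub>R One)" for y
    proof (rule 0)
      obtain b where b: "b \<in> Basis" "1 < \<bar>y \<bullet> b\<bar>"
        using \<open>y \<notin> _\<close> unfolding mem_cbox_One_0_iff by (auto simp: not_le)
      show "y \<notin> cball 0 1"
        using b Basis_le_norm[of b y] by simp
    qed
    show "cbox (- (1 *\<^sub>R One)) (1 *\<^sub>R One) \<subseteq> ?B"
      unfolding subset_iff mem_cbox_One_0_iff by force
    have e: "cbox (- (2 *\<^sub>R One) + x *\<^sub>R v) (2 *\<^sub>R One + x *\<^sub>R v) = cbox (x *\<^sub>R v - 2 *\<^sub>R One) (x *\<^sub>R v + 2 *\<^sub>R One)"
      by (simp add: add.commute)
    show "cbox (- (1 *\<^sub>R One)) (1 *\<^sub>R One) \<subseteq> cbox (- (2 *\<^sub>R One) + x *\<^sub>R v) (2 *\<^sub>R One + x *\<^sub>R v)"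
      unfolding e subset_iff mem_cbox_One_iff mem_cbox_One_0_iff
    proof (intro allI impI ballI)
      fix y b :: 'a assume "\<forall>b\<in>Basis. \<bar>y \<bullet> b\<bar> \<le> 1" and b: "b \<in> (Basis :: 'a set)"
      then have "\<bar>y \<bullet> b\<bar> \<le> 1" by blast
      then show "\<bar>(y - x *\<^sub>R v) \<bullet> b\<bar> \<le> 2"
        using sv[OF b] unfolding inner_diff_left by linarith
    qed
  qed
  ultimately have "((\<lambda>x. integral ?B u) has_field_derivative integral ?B (\<lambda>y. u' y v)) (at 0 within {-1..1})"
    by (subst (asm) has_field_derivative_cong_eventually[where g = "\<lambda>x. integral ?B u"])
      (auto simp: eventually_at_filter)
  moreover have "((\<lambda>x. integral ?B u) has_field_derivative 0) (at 0 within {-1..1})" by simp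
  moreover have "at (0::real) within {-1..1} \<noteq> bot"
    by (subst at_within_Icc_at) auto
  ultimately show ?thesis
    by (metis has_field_derivative_unique)
qed

text \<open>The weight of the mean value property. Its form is dictated by the requirement that
  \<open>bump y *\<^sub>R y\<close> be the gradient of a C^1 function vanishing off the unit
  ball.\<close>

definition bump :: "'a::euclidean_space \<Rightarrow> real" where
  "bump y = max 0 (1 - y \<bullet> y)"

text \<open>Chosen such that its gradient is \<open>bump y *\<^sub>R y\<close>.\<close>

definition bump_potential :: "'a::euclidean_space \<Rightarrow> real" where
  "bump_potential y = - ((bump y)\<^sup>2 / 4)"

lemma continuous_on_bump [continuous_intros]: "continuous_on A bump"
  unfolding bump_def by (intro continuous_intros)

lemma bump_eq_0: "y \<notin> ball 0 1 \<Longrightarrow> bump y = 0"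
  by (auto simp: bump_def dot_square_norm)

lemma has_real_derivative_max_power2: "((\<lambda>x. (max 0 x)\<^sup>2) has_real_derivative 2 * max 0 x) (at (x::real))"
proof (cases "x = 0")
  case True
  have "((\<lambda>h. (max 0 h)\<^sup>2 / h) \<longlongrightarrow> 0) (at (0::real))"
  proof (rule Lim_null_comparison)
    show "\<forall>\<^sub>F h in at 0. norm ((max 0 h)\<^sup>2 / h) \<le> \<bar>h\<bar>"
      by (auto simp: eventually_at_filter max_def power2_eq_square)
    show "((\<lambda>h::real. \<bar>h\<bar>) \<longlongrightarrow> 0) (at 0)" by (intro tendsto_eq_intros) auto
  qed
  then show ?thesis using True by (simp add: DERIV_def)
next
  case False
  show ?thesis
  proof (cases "0 < x")
    case True
    have "((\<lambda>x. x\<^sup>2) has_real_derivative 2 * x) (at x)" by (auto intro!: derivative_eq_intros)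
    then have "((\<lambda>x. (max 0 x)\<^sup>2) has_real_derivative 2 * x) (at x)"
      by (rule has_field_derivative_transform_within_open[where S="{0<..}"]) (use True in auto)
    then show ?thesis using True by simp
  next
    case f: False
    have "((\<lambda>x. 0) has_real_derivative 0) (at x)" by simp
    then have "((\<lambda>x. (max 0 x)\<^sup>2) has_real_derivative 0) (at x)"
      by (rule has_field_derivative_transform_within_open[where S="{..<0}"]) (use f False in auto)
    moreover have "max 0 x = 0" using f by simp
    ultimately show ?thesis by simp
  qed
qed

lemma has_derivative_bump_potential:
  "(bump_potential has_derivative (\<lambda>v. bump y * (y \<bullet> v))) (at (y::'a::euclidean_space))"
proof -
  have "((\<lambda>y. 1 - y \<bullet> y) has_derivative (\<lambda>v. - (y \<bullet> v + v \<bullet> y))) (at y)"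
    by (auto intro!: derivative_eq_intros)
  from has_derivative_compose[OF this has_real_derivative_max_power2[THEN has_field_derivative_imp_has_derivative]]
  have "((\<lambda>y. (max 0 (1 - y \<bullet> y))\<^sup>2) has_derivative (\<lambda>v. 2 * max 0 (1 - y \<bullet> y) * - (y \<bullet> v + v \<bullet> y))) (at y)"
    by (simp add: mult_ac)
  from has_derivative_mult_right[OF this, of "- 1 / 4"]
  have "((\<lambda>y. - 1 / 4 * (max 0 (1 - y \<bullet> y))\<^sup>2) has_derivative (\<lambda>v. max 0 (1 - y \<bullet> y) * (y \<bullet> v))) (at y)"
    by (rule has_derivative_eq_rhs) (auto simp: inner_commute field_simps)
  then show ?thesis
    by (simp add: bump_potential_def[abs_def] bump_def[abs_def])
qed

definition bump_mass :: "'a::euclidean_space itself \<Rightarrow> real" where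
  "bump_mass _ = integral (cbox (- (2 *\<^sub>R One)) (2 *\<^sub>R One) :: 'a set) bump"

lemma bump_mass_pos: "0 < bump_mass TYPE('a::euclidean_space)"
proof -
  let ?B = "cbox (- (2 *\<^sub>R One)) (2 *\<^sub>R One) :: 'a set"
  have nn: "0 \<le> bump y" for y :: 'a by (simp add: bump_def)
  have "integral ?B bump \<noteq> 0"
  proof
    assume "integral ?B bump = 0"
    then have "(bump has_integral 0) ?B"
      by (metis continuous_on_bump integrable_continuous integrable_integral)
    moreover have "box (- (2 *\<^sub>R One)) (2 *\<^sub>R One) \<noteq> ({} :: 'a set)"
      by (auto simp: box_ne_empty)
    moreover have "0 \<in> ?B" unfolding mem_cbox_One_0_iff by simp
    ultimately have "bump (0::'a) = 0"
      by (intro has_integral_0_cbox_imp_0[OF continuous_on_bump nn])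
    then show False by (simp add: bump_def)
  qed
  moreover have "0 \<le> integral ?B bump" by (intro integral_nonneg integrable_continuous continuous_on_bump nn)
  ultimately show ?thesis by (simp add: bump_mass_def)
qed

text \<open>Let A(x) be the weighted average of f at scale x in [0, R]. Its derivative is the
  integral of \<open>bump y\<close> times the radial derivative of f, that is, of the gradient of f
  against the gradient of \<open>bump_potential\<close>. By parts this is -x times the integral of
  the potential against the Laplacian, hence 0, and A(R) = A(0).\<close>

lemma bump_average_harmonic:
  fixes f :: "'a::euclidean_space \<Rightarrow> real"
  assumes harm: "harmonic_on f S" and S: "open S" and R: "0 < R" and sub: "cbox (z - (2 * R) *\<^sub>R One) (z + (2 * R) *\<^sub>R One) \<subseteq> S"
  shows "integral (cbox (- (2 *\<^sub>R One)) (2 *\<^sub>R One)) (\<lambda>y. bump y * f (z + R *\<^sub>R y)) = f z * bump_mass TYPE('a)"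
proof -
  let ?B = "cbox (- (2 *\<^sub>R One)) (2 *\<^sub>R One) :: 'a set"
  obtain g h where g: "\<And>z. z \<in> S \<Longrightarrow> (f has_derivative (\<lambda>v. g z \<bullet> v)) (at z)"
    and h: "\<And>z. z \<in> S \<Longrightarrow> (g has_derivative blinfun_apply (h z)) (at z)"
    and hc: "continuous_on S h" and tr: "\<And>z. z \<in> S \<Longrightarrow> (\<Sum>b\<in>Basis. blinfun_apply (h z) b \<bullet> b) = 0"
    using harm unfolding harmonic_on_def by blast
  have gc: "continuous_on S g"
    using h by (meson continuous_at_imp_continuous_on has_derivative_continuous)
  have fc: "continuous_on S f"
    using g by (meson continuous_at_imp_continuous_on has_derivative_continuous)
  have inS: "z + x *\<^sub>R y \<in> S" if "x \<in> {0..R}" "y \<in> ?B" for x y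
  proof -
    have "\<bar>(z + x *\<^sub>R y - z) \<bullet> b\<bar> \<le> 2 * R" if b: "b \<in> Basis" for b
    proof -
      have "\<bar>x\<bar> * \<bar>y \<bullet> b\<bar> \<le> R * 2"
        using \<open>x \<in> _\<close> \<open>y \<in> _\<close> b unfolding mem_cbox_One_0_iff by (intro mult_mono) auto
      then show ?thesis by (simp add: abs_mult)
    qed
    then have "z + x *\<^sub>R y \<in> cbox (z - (2 * R) *\<^sub>R One) (z + (2 * R) *\<^sub>R One)"
      unfolding mem_cbox_One_iff by blast
    then show ?thesis using sub by auto
  qed
  have ball_B: "y \<in> ?B" if "y \<in> cball 0 1" for y :: 'a
    unfolding mem_cbox_One_0_iff
  proof
    fix b :: 'a assume "b \<in> Basis"
    then show "\<bar>y \<bullet> b\<bar> \<le> 2" using that Basis_le_norm[of b y] by simp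
  qed
  have flux: "integral ?B (\<lambda>y. bump y * (g (z + x *\<^sub>R y) \<bullet> y)) = 0" if x: "x \<in> {0..R}" for x
  proof -
    \<comment> \<open>The field to be integrated by parts: the gradient of f times the potential, by
      components. It is cut off explicitly, because \<open>g\<close> is controlled only on
      \<open>S\<close>.\<close>
    define u where "u b y = (if y \<in> cball 0 1 then (g (z + x *\<^sub>R y) \<bullet> b) * bump_potential y else 0)" for b y
    define u' where "u' b y v = (if y \<in> cball 0 1 then
        (g (z + x *\<^sub>R y) \<bullet> b) * (bump y * (y \<bullet> v)) + (blinfun_apply (h (z + x *\<^sub>R y)) (x *\<^sub>R v) \<bullet> b) * bump_potential y else 0)" for b y v
    define T where "T = (\<lambda>y. z + x *\<^sub>R y) -` S"
    have T: "open T"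
      unfolding T_def by (intro open_vimage S continuous_intros)
    have ballT: "cball 0 1 \<subseteq> T" using ball_B inS[OF x] by (auto simp: T_def)
    have bp0: "bump_potential y = 0" "bump y = 0" if "y \<notin> ball 0 1" for y :: 'a
      using bump_eq_0[OF that] by (auto simp: bump_potential_def)
    have der: "(u b has_derivative u' b y) (at y)" if b: "b \<in> Basis" for b y
    proof (cases "y \<in> cball 0 1")
      case True
      then have y: "y \<in> T" using ballT by auto
      then have "z + x *\<^sub>R y \<in> S" by (simp add: T_def)
      have "((\<lambda>y. g (z + x *\<^sub>R y)) has_derivative (\<lambda>v. blinfun_apply (h (z + x *\<^sub>R y)) (x *\<^sub>R v))) (at y)"
        by (rule has_derivative_compose[OF _ h]) (auto intro!: derivative_eq_intros \<open>z + x *\<^sub>R y \<in> S\<close>)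
      then have "((\<lambda>y. (g (z + x *\<^sub>R y) \<bullet> b) * bump_potential y) has_derivative
          (\<lambda>v. (g (z + x *\<^sub>R y) \<bullet> b) * (bump y * (y \<bullet> v)) + (blinfun_apply (h (z + x *\<^sub>R y)) (x *\<^sub>R v) \<bullet> b) * bump_potential y)) (at y)"
        by (intro has_derivative_mult has_derivative_inner_left has_derivative_bump_potential)
      then have "(u b has_derivative (\<lambda>v. (g (z + x *\<^sub>R y) \<bullet> b) * (bump y * (y \<bullet> v)) + (blinfun_apply (h (z + x *\<^sub>R y)) (x *\<^sub>R v) \<bullet> b) * bump_potential y)) (at y)"
        by (rule has_derivative_transform_within_open[OF _ T y]) (auto simp: u_def bp0)
      then show ?thesis using True by (simp add: u'_def[abs_def])
    next
      case False
      have "((\<lambda>y. 0) has_derivative (\<lambda>v. 0)) (at y)" by simp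
      then have "(u b has_derivative (\<lambda>v. 0)) (at y)"
        by (rule has_derivative_transform_within_open[of _ _ _ _ "- cball 0 1"]) (use False in \<open>auto simp: u_def\<close>)
      then show ?thesis using False by (simp add: u'_def[abs_def])
    qed
    \<comment> \<open>\<open>T\<close> and the complement of the closed ball form an open cover. On
      the part of \<open>T\<close> beyond the ball the formula agrees with the value 0, as
      \<open>bump\<close> and its potential vanish there.\<close>
    have cont: "continuous_on UNIV (\<lambda>y. u' b y b)" for b
    proof -
      have "continuous_on (T \<union> - cball 0 1) (\<lambda>y. u' b y b)"
      proof (rule continuous_on_open_Un)
        have "continuous_on T (\<lambda>y. (g (z + x *\<^sub>R y) \<bullet> b) * (bump y * (y \<bullet> b)) + (blinfun_apply (h (z + x *\<^sub>R y)) (x *\<^sub>R b) \<bullet> b) * bump_potential y)"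
          unfolding bump_potential_def
          by (intro continuous_intros continuous_on_compose2[OF gc] continuous_on_compose2[OF hc]) (auto simp: T_def)
        then show "continuous_on T (\<lambda>y. u' b y b)"
          by (rule continuous_on_eq) (auto simp: u'_def bp0)
        have "continuous_on (- cball 0 1) (\<lambda>y. 0::real)" by simp
        then show "continuous_on (- cball 0 1) (\<lambda>y. u' b y b)"
          by (rule continuous_on_eq) (auto simp: u'_def)
      qed (use T in auto)
      moreover have "T \<union> - cball 0 1 = UNIV" using ballT by auto
      ultimately show ?thesis by simp
    qed
    have I: "integral ?B (\<lambda>y. u' b y b) = 0" if "b \<in> Basis" for b
      by (rule integral_directional_derivative_eq_0[OF der cont]) (use that in \<open>auto simp: u_def\<close>)
    \<comment> \<open>This is the divergence of the field: its Hessian terms add up to x times the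
      potential times the trace, which is 0.\<close>
    have "bump y * (g (z + x *\<^sub>R y) \<bullet> y) = (\<Sum>b\<in>Basis. u' b y b)" for y
    proof (cases "y \<in> cball 0 1")
      case True
      then have "z + x *\<^sub>R y \<in> S" using ballT by (auto simp: T_def)
      have "(\<Sum>b\<in>Basis. u' b y b) = (\<Sum>b\<in>Basis. bump y * ((g (z + x *\<^sub>R y) \<bullet> b) * (y \<bullet> b))
          + x * bump_potential y * (blinfun_apply (h (z + x *\<^sub>R y)) b \<bullet> b))"
        using True by (simp add: u'_def blinfun.scaleR_right mult_ac)
      also have "\<dots> = bump y * (\<Sum>b\<in>Basis. (g (z + x *\<^sub>R y) \<bullet> b) * (y \<bullet> b))
          + x * bump_potential y * (\<Sum>b\<in>Basis. blinfun_apply (h (z + x *\<^sub>R y)) b \<bullet> b)"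
        by (simp only: sum.distrib sum_distrib_left)
      also have "\<dots> = bump y * (g (z + x *\<^sub>R y) \<bullet> y)"
        using tr[OF \<open>z + x *\<^sub>R y \<in> S\<close>] by (simp add: euclidean_inner[of "g _" y])
      finally show ?thesis by simp
    next
      case False
      then have "y \<notin> ball 0 1" by auto
      then show ?thesis using False by (simp add: u'_def bp0)
    qed
    then have "integral ?B (\<lambda>y. bump y * (g (z + x *\<^sub>R y) \<bullet> y)) = (\<Sum>b\<in>Basis. integral ?B (\<lambda>y. u' b y b))"
      by (simp add: integral_sum integrable_continuous continuous_on_subset[OF cont])
    then show ?thesis using I by simp
  qed
  have "\<exists>c. \<forall>x\<in>{0..R}. integral ?B (\<lambda>y. bump y * f (z + x *\<^sub>R y)) = c"
  proof (rule has_field_derivative_zero_constant)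
    fix x assume x: "x \<in> {0..R}"
    have "((\<lambda>x. integral ?B (\<lambda>y. bump y * f (z + x *\<^sub>R y))) has_field_derivative integral ?B (\<lambda>y. bump y * (g (z + x *\<^sub>R y) \<bullet> y))) (at x within {0..R})"
    proof (rule leibniz_rule_field_derivative)
      fix x' y assume *: "x' \<in> {0..R}" "y \<in> ?B"
      have "((\<lambda>x. f (z + x *\<^sub>R y)) has_derivative (\<lambda>k. g (z + x' *\<^sub>R y) \<bullet> (k *\<^sub>R y))) (at x' within {0..R})"
        by (rule has_derivative_compose[OF _ g]) (auto intro!: derivative_eq_intros inS *)
      then have "((\<lambda>x. f (z + x *\<^sub>R y)) has_field_derivative g (z + x' *\<^sub>R y) \<bullet> y) (at x' within {0..R})"
        by (simp add: has_field_derivative_def mult.commute[of _ "g _ \<bullet> _"])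
      then show "((\<lambda>x. bump y * f (z + x *\<^sub>R y)) has_field_derivative bump y * (g (z + x' *\<^sub>R y) \<bullet> y)) (at x' within {0..R})"
        by (rule DERIV_cmult)
    next
      fix x' assume *: "x' \<in> {0..R}"
      show "(\<lambda>y. bump y * f (z + x' *\<^sub>R y)) integrable_on ?B"
        by (intro integrable_continuous continuous_intros continuous_on_compose2[OF fc]) (use inS * in auto)
    next
      have "continuous_on ({0..R} \<times> ?B) (\<lambda>p. bump (snd p) * (g (z + fst p *\<^sub>R snd p) \<bullet> snd p))"
        by (intro continuous_intros continuous_on_compose2[OF continuous_on_bump[of UNIV]] continuous_on_compose2[OF gc])
          (use inS in auto)
      then show "continuous_on ({0..R} \<times> ?B) (\<lambda>(x, y). bump y * (g (z + x *\<^sub>R y) \<bullet> y))"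
        by (simp add: split_beta)
    qed (use x in auto)
    then show "((\<lambda>x. integral ?B (\<lambda>y. bump y * f (z + x *\<^sub>R y))) has_field_derivative 0) (at x within {0..R})"
      using flux[OF x] by simp
  qed auto
  then obtain c where c: "\<And>x. x \<in> {0..R} \<Longrightarrow> integral ?B (\<lambda>y. bump y * f (z + x *\<^sub>R y)) = c" by blast
  have "integral ?B (\<lambda>y. bump y * f (z + R *\<^sub>R y)) = integral ?B (\<lambda>y. bump y * f (z + 0 *\<^sub>R y))"
    using R c[of R] c[of 0] by simp
  also have "\<dots> = f z * bump_mass TYPE('a)"
    by (simp add: bump_mass_def mult.commute)
  finally show ?thesis .
qed

section \<open>Mean value estimates for powers of harmonic functions\<close>

lemma nn_integral_affine:
  fixes F :: "'a::euclidean_space \<Rightarrow> ennreal"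
  assumes [measurable]: "F \<in> borel_measurable borel" and "0 < c"
  shows "(\<integral>\<^sup>+x. F x \<partial>lborel) = ennreal (c ^ DIM('a)) * (\<integral>\<^sup>+x. F (t + c *\<^sub>R x) \<partial>lborel)"
  using \<open>0 < c\<close>
  by (subst lborel_affine[of c t]) (auto simp: nn_integral_density nn_integral_distr nn_integral_cmult)

lemma norm_le_of_components:
  fixes x :: "'a::euclidean_space"
  assumes "\<And>b. b \<in> Basis \<Longrightarrow> \<bar>x \<bullet> b\<bar> \<le> c"
  shows "norm x \<le> real DIM('a) * c"
  using norm_le_l1[of x] sum_bounded_above[of Basis "\<lambda>b. \<bar>x \<bullet> b\<bar>" c] assms by fastforce

lemma cbox_One_subset_cball:
  fixes z :: "'a::euclidean_space"
  assumes "real DIM('a) * c \<le> R"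
  shows "cbox (z - c *\<^sub>R One) (z + c *\<^sub>R One) \<subseteq> cball z R"
proof
  fix y assume "y \<in> cbox (z - c *\<^sub>R One) (z + c *\<^sub>R One)"
  then have "\<bar>(y - z) \<bullet> b\<bar> \<le> c" if "b \<in> Basis" for b
    using that unfolding mem_cbox_One_iff by blast
  then have "norm (y - z) \<le> real DIM('a) * c"
    by (rule norm_le_of_components)
  then show "y \<in> cball z R" using assms by (simp add: dist_norm norm_minus_commute)
qed

lemma harmonic_on_continuous: "harmonic_on f S \<Longrightarrow> continuous_on S f"
  unfolding harmonic_on_def
  by (meson continuous_at_imp_continuous_on has_derivative_continuous)

lemma harmonic_le_average:
  obtains K where "0 < K"
    "\<And>(f :: 'a::euclidean_space \<Rightarrow> real) S z R. \<lbrakk>harmonic_on f S; open S; f \<in> borel_measurable borel; 0 < R; cball z R \<subseteq> S\<rbrakk>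
      \<Longrightarrow> ennreal \<bar>f z\<bar> \<le> ennreal (K / R ^ DIM('a)) * (\<integral>\<^sup>+y\<in>cball z R. ennreal \<bar>f y\<bar> \<partial>lborel)"
proof
  define m where "m = bump_mass TYPE('a)"
  define N where "N = DIM('a)"
  have m: "0 < m" using bump_mass_pos by (simp add: m_def)
  have N: "0 < N" by (simp add: N_def)
  show "0 < (2 * N) ^ N / m" using m N by simp
  fix f :: "'a \<Rightarrow> real" and S z R
  assume f: "harmonic_on f S" and S: "open S" and [measurable]: "f \<in> borel_measurable borel"
    and R: "0 < R" and sub: "cball z R \<subseteq> S"
  \<comment> \<open>The weighted mean value property needs a box of half-width \<open>2 * r\<close>
    inside the domain; for this \<open>r\<close> the box fits into the ball of radius
    \<open>R\<close>. This is the source of the factor \<open>(2 * N) ^ N\<close>.\<close>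
  define r where "r = R / (2 * N)"
  have r: "0 < r" "r \<le> R" using R N by (auto simp: r_def field_simps)
  have [measurable]: "cball z R \<in> sets borel" by simp
  have meas: "(\<lambda>y. ennreal \<bar>f y\<bar> * indicator (cball z R) y) \<in> borel_measurable borel"
    by measurable
  let ?B = "cbox (- (2 *\<^sub>R One)) (2 *\<^sub>R One) :: 'a set"
  define F where "F y = bump y * f (z + r *\<^sub>R y)" for y
  have "cbox (z - (2 * r) *\<^sub>R One) (z + (2 * r) *\<^sub>R One) \<subseteq> cball z R"
    by (rule cbox_One_subset_cball) (use N in \<open>simp add: r_def N_def\<close>)
  then have box: "cbox (z - (2 * r) *\<^sub>R One) (z + (2 * r) *\<^sub>R One) \<subseteq> S" using sub by auto
  have inS: "z + r *\<^sub>R y \<in> S" if "y \<in> ?B" for y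
  proof -
    have "z + r *\<^sub>R y \<in> cbox (z - (2 * r) *\<^sub>R One) (z + (2 * r) *\<^sub>R One)"
      using that r unfolding mem_cbox_One_iff mem_cbox_One_0_iff by (auto simp: abs_mult)
    then show ?thesis using box by auto
  qed
  have Fc: "continuous_on ?B F" unfolding F_def
    by (intro continuous_intros continuous_on_compose2[OF harmonic_on_continuous[OF f]]) (use inS in auto)
  have "integral ?B F = f z * m"
    using bump_average_harmonic[OF f S r(1) box] by (simp add: F_def[abs_def] m_def)
  moreover have "\<bar>integral ?B F\<bar> \<le> integral ?B (\<lambda>y. \<bar>F y\<bar>)"
    using Henstock_Kurzweil_Integration.integral_norm_bound_integral[of F ?B "\<lambda>y. \<bar>F y\<bar>"]
    by (simp add: integrable_continuous continuous_intros Fc)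
  ultimately have "\<bar>f z\<bar> * m \<le> integral ?B (\<lambda>y. \<bar>F y\<bar>)" using m by (simp add: abs_mult)
  then have "ennreal (\<bar>f z\<bar> * m) \<le> ennreal (integral ?B (\<lambda>y. \<bar>F y\<bar>))" by (rule ennreal_leI)
  also have "\<dots> = (\<integral>\<^sup>+y. ennreal (indicator ?B y * \<bar>F y\<bar>) \<partial>lborel)"
    by (intro nn_integral_has_integral_lebesgue[symmetric] integrable_integral integrable_continuous continuous_intros Fc) auto
  also have "\<dots> \<le> (\<integral>\<^sup>+y. ennreal \<bar>f (z + r *\<^sub>R y)\<bar> * indicator (cball z R) (z + r *\<^sub>R y) \<partial>lborel)"
  proof (intro nn_integral_mono)
    fix y
    show "ennreal (indicator ?B y * \<bar>F y\<bar>) \<le> ennreal \<bar>f (z + r *\<^sub>R y)\<bar> * indicator (cball z R) (z + r *\<^sub>R y)"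
    proof (cases "y \<in> ball 0 1")
      case True
      then have "r * norm y \<le> r * 1" using r by (intro mult_left_mono) auto
      with r have "r * norm y \<le> R" by linarith
      then have "z + r *\<^sub>R y \<in> cball z R" using r by (simp add: dist_norm)
      moreover have "indicator ?B y * \<bar>F y\<bar> \<le> 1 * (1 * \<bar>f (z + r *\<^sub>R y)\<bar>)"
        unfolding F_def abs_mult by (intro mult_mono) (auto simp: bump_def indicator_def)
      ultimately show ?thesis by (simp add: ennreal_leI)
    next
      case False
      then show ?thesis by (simp add: F_def bump_eq_0)
    qed
  qed
  also have "\<dots> = ennreal (1 / r ^ N) * (\<integral>\<^sup>+y. ennreal \<bar>f y\<bar> * indicator (cball z R) y \<partial>lborel)"
    using r meas by (subst (2) nn_integral_affine[of _ r z]) (auto simp: N_def mult.assoc[symmetric] simp flip: ennreal_mult)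
  finally have *: "ennreal (\<bar>f z\<bar> * m) \<le> ennreal (1 / r ^ N) * (\<integral>\<^sup>+y\<in>cball z R. ennreal \<bar>f y\<bar> \<partial>lborel)" .
  have "ennreal \<bar>f z\<bar> = ennreal (1 / m) * ennreal (\<bar>f z\<bar> * m)"
    using m by (simp flip: ennreal_mult)
  also have "\<dots> \<le> ennreal (1 / m) * (ennreal (1 / r ^ N) * (\<integral>\<^sup>+y\<in>cball z R. ennreal \<bar>f y\<bar> \<partial>lborel))"
    by (intro mult_left_mono *) auto
  also have "\<dots> = ennreal ((2 * N) ^ N / m / R ^ DIM('a)) * (\<integral>\<^sup>+y\<in>cball z R. ennreal \<bar>f y\<bar> \<partial>lborel)"
  proof -
    have "1 / m * (1 / r ^ N) = (2 * N) ^ N / m / R ^ DIM('a)"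
      by (simp add: r_def power_divide N_def)
    moreover have "ennreal (1 / m) * ennreal (1 / r ^ N) = ennreal (1 / m * (1 / r ^ N))"
      by (rule ennreal_mult[symmetric]) (use m r in auto)
    ultimately show ?thesis by (simp only: mult.assoc[symmetric])
  qed
  finally show "ennreal \<bar>f z\<bar> \<le> ennreal ((2 * N) ^ N / m / R ^ DIM('a)) * (\<integral>\<^sup>+y\<in>cball z R. ennreal \<bar>f y\<bar> \<partial>lborel)" .
qed

text \<open>For \<open>r < 1\<close> this is the Hardy--Littlewood argument: apply the mean value estimate at a maximum point
  of \<open>\<bar>f w\<bar> * (R - dist z w) powr (N / r)\<close>.\<close>

lemma harmonic_powr_le_average:
  assumes r: "0 < r"
  obtains K where "0 < K"
    "\<And>(f :: 'a::euclidean_space \<Rightarrow> real) S z R. \<lbrakk>harmonic_on f S; open S; f \<in> borel_measurable borel; 0 < R; cball z R \<subseteq> S\<rbrakk>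
      \<Longrightarrow> ennreal (\<bar>f z\<bar> powr r) \<le> ennreal (K / R ^ DIM('a)) * (\<integral>\<^sup>+y\<in>cball z R. ennreal (\<bar>f y\<bar> powr r) \<partial>lborel)"
proof -
  define N where "N = DIM('a)"
  obtain K where K: "0 < K" and av: "\<And>(f :: 'a \<Rightarrow> real) S z R. \<lbrakk>harmonic_on f S; open S; f \<in> borel_measurable borel; 0 < R; cball z R \<subseteq> S\<rbrakk>
      \<Longrightarrow> ennreal \<bar>f z\<bar> \<le> ennreal (K / R ^ N) * (\<integral>\<^sup>+y\<in>cball z R. ennreal \<bar>f y\<bar> \<partial>lborel)"
    unfolding N_def by (rule harmonic_le_average) blast
  show thesis
  proof (cases "1 \<le> r")
    case True
    define v where "v = unit_ball_vol (real N)"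
    have v: "0 < v" by (simp add: v_def)
    show thesis
    proof (rule that)
      show "0 < K powr r * 2 powr r * v powr (r - 1)" using K v by simp
      fix f :: "'a \<Rightarrow> real" and S z R
      assume f: "harmonic_on f S" "open S" and fm[measurable]: "f \<in> borel_measurable borel"
        and R: "0 < R" and sub: "cball z R \<subseteq> S"
      let ?I = "\<integral>\<^sup>+y\<in>cball z R. ennreal (\<bar>f y\<bar> powr r) \<partial>lborel"
      have "ennreal (\<bar>f z\<bar> powr r) = epow (ennreal \<bar>f z\<bar>) r" by (simp add: epow_ennreal)
      also have "\<dots> \<le> epow (ennreal (K / R ^ N) * (\<integral>\<^sup>+y\<in>cball z R. ennreal \<bar>f y\<bar> \<partial>lborel)) r"
        using r by (intro epow_mono av[OF f fm R sub]) auto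
      also have "\<dots> = ennreal ((K / R ^ N) powr r) * epow (\<integral>\<^sup>+y\<in>cball z R. ennreal \<bar>f y\<bar> \<partial>lborel) r"
        using K R by (simp add: epow_mult epow_ennreal)
      also have "\<dots> \<le> ennreal ((K / R ^ N) powr r) * (ennreal (2 powr r) * ennreal ((v * R ^ N) powr (r - 1)) *
          (\<integral>\<^sup>+y\<in>cball z R. epow (ennreal \<bar>f y\<bar>) r \<partial>lborel))"
        using True R by (intro mult_left_mono jensen_set) (auto simp: emeasure_cball v_def N_def)
      also have "\<dots> = ennreal ((K / R ^ N) powr r * (2 powr r * (v * R ^ N) powr (r - 1))) * ?I"
        by (simp add: epow_ennreal ennreal_mult mult.assoc)
      also have "(K / R ^ N) powr r * (2 powr r * (v * R ^ N) powr (r - 1)) = K powr r * 2 powr r * v powr (r - 1) / R ^ N"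
        using K R v by (simp add: powr_divide powr_mult powr_diff)
      finally show "ennreal (\<bar>f z\<bar> powr r) \<le> ennreal (K powr r * 2 powr r * v powr (r - 1) / R ^ DIM('a)) * ?I"
        by (simp add: N_def)
    qed
  next
    case False
    \<comment> \<open>Chosen so that \<open>e * r = N\<close>: the r-th power of the weight scales
      like a volume, and the radius \<open>\<rho>\<close> below cancels.\<close>
    define e where "e = real N / r"
    have e: "0 < e" using r by (simp add: e_def N_def)
    show thesis
    proof (rule that)
      show "0 < 2 powr e * K" using K by simp
      fix f :: "'a \<Rightarrow> real" and S z R
      assume f: "harmonic_on f S" "open S" and fm[measurable]: "f \<in> borel_measurable borel"
        and R: "0 < R" and sub: "cball z R \<subseteq> S"
      let ?I = "\<integral>\<^sup>+y\<in>cball z R. ennreal (\<bar>f y\<bar> powr r) \<partial>lborel"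
      show "ennreal (\<bar>f z\<bar> powr r) \<le> ennreal (2 powr e * K / R ^ DIM('a)) * ?I"
      \<comment> \<open>Excluding \<open>f z = 0\<close> makes the maximum \<open>M\<close>
        positive, so that it is attained where the weight is nonzero and \<open>\<rho>\<close> is
        positive.\<close>
      proof (cases "?I = top \<or> f z = 0")
        case True
        then show ?thesis using K R by (auto simp: ennreal_mult_top)
      next
        case nt: False
        then obtain I where I: "?I = ennreal I" "0 \<le> I" by (cases ?I) auto
        define \<phi> where "\<phi> w = \<bar>f w\<bar> * (R - dist z w) powr e" for w
        have "continuous_on (cball z R) \<phi>"
          unfolding \<phi>_def using e
          by (intro continuous_intros continuous_on_powr' continuous_on_subset[OF harmonic_on_continuous[OF f(1)] sub]) auto
        then obtain w where w: "w \<in> cball z R" and max: "\<And>y. y \<in> cball z R \<Longrightarrow> \<phi> y \<le> \<phi> w"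
          using continuous_attains_sup[of "cball z R" \<phi>] R by auto
        define M where "M = \<phi> w"
        have zM: "\<bar>f z\<bar> * R powr e \<le> M" using max[of z] R by (simp add: M_def \<phi>_def)
        moreover have "0 < \<bar>f z\<bar> * R powr e" using nt R by simp
        ultimately have M: "0 < M" by linarith
        then have "R - dist z w \<noteq> 0" by (auto simp: M_def \<phi>_def)
        define \<rho> where "\<rho> = (R - dist z w) / 2"
        have \<rho>: "0 < \<rho>" using w \<open>R - dist z w \<noteq> 0\<close> by (simp add: \<rho>_def)
        have inner: "\<rho> \<le> R - dist z y" "y \<in> cball z R" if "y \<in> cball w \<rho>" for y
          using that dist_triangle[of z y w] \<rho> by (auto simp: \<rho>_def field_simps)
        \<comment> \<open>On the ball of radius \<open>\<rho>\<close> about \<open>w\<close> the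
          weight is at least \<open>\<rho> powr e\<close>, so maximality bounds |f| there by
          \<open>Q\<close>. At \<open>w\<close> itself the weight is
          \<open>(2 * \<rho>) powr e\<close>, so |f w| equals \<open>Q\<close> up to the factor
          \<open>2 powr - e\<close>.\<close>
        define Q where "Q = M * \<rho> powr - e"
        have Q: "0 < Q" using M \<rho> by (simp add: Q_def)
        have fQ: "\<bar>f y\<bar> \<le> Q" if y: "y \<in> cball w \<rho>" for y
        proof -
          have "\<bar>f y\<bar> * \<rho> powr e \<le> \<phi> y"
            unfolding \<phi>_def using inner[OF y] \<rho> e by (intro mult_left_mono powr_mono2) auto
          also have "\<dots> \<le> M" using max inner[OF y] by (simp add: M_def)
          finally show ?thesis using \<rho> by (simp add: Q_def powr_minus field_simps)
        qed
        have "ennreal \<bar>f w\<bar> \<le> ennreal (K / \<rho> ^ N) * (\<integral>\<^sup>+y\<in>cball w \<rho>. ennreal \<bar>f y\<bar> \<partial>lborel)"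
          using inner sub by (intro av[OF f fm \<rho>]) auto
        also have "\<dots> \<le> ennreal (K / \<rho> ^ N) * (\<integral>\<^sup>+y. ennreal (Q powr (1 - r)) * (ennreal (\<bar>f y\<bar> powr r) * indicator (cball z R) y) \<partial>lborel)"
        proof (intro mult_left_mono nn_integral_mono)
          fix y
          show "ennreal \<bar>f y\<bar> * indicator (cball w \<rho>) y \<le> ennreal (Q powr (1 - r)) * (ennreal (\<bar>f y\<bar> powr r) * indicator (cball z R) y)"
          proof (cases "y \<in> cball w \<rho> \<and> f y \<noteq> 0")
            case True
            have "\<bar>f y\<bar> = \<bar>f y\<bar> powr (1 - r) * \<bar>f y\<bar> powr r" using True by (simp flip: powr_add)
            also have "\<dots> \<le> Q powr (1 - r) * \<bar>f y\<bar> powr r"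
              using fQ True False by (intro mult_right_mono powr_mono2) auto
            finally show ?thesis using True inner by (simp add: ennreal_leI flip: ennreal_mult)
          qed auto
        qed auto
        also have "\<dots> = ennreal (K / \<rho> ^ N * (Q powr (1 - r) * I))"
        proof -
          have [measurable]: "cball z R \<in> sets borel" by simp
          have "(\<integral>\<^sup>+y. ennreal (Q powr (1 - r)) * (ennreal (\<bar>f y\<bar> powr r) * indicator (cball z R) y) \<partial>lborel)
              = ennreal (Q powr (1 - r)) * ?I"
            by (rule nn_integral_cmult) measurable
          then show ?thesis using I K \<rho> by (simp add: mult.assoc flip: ennreal_mult)
        qed
        finally have "\<bar>f w\<bar> \<le> K / \<rho> ^ N * (Q powr (1 - r) * I)"
          using I K \<rho> by (subst (asm) ennreal_le_iff) auto
        moreover have "\<bar>f w\<bar> = Q * 2 powr - e"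
        proof -
          have "R - dist z w = 2 * \<rho>" by (simp add: \<rho>_def)
          then have "M = \<bar>f w\<bar> * (2 * \<rho>) powr e" by (simp add: M_def \<phi>_def)
          then show ?thesis using \<rho> by (simp add: Q_def powr_mult powr_minus field_simps)
        qed
        ultimately have le: "Q * 2 powr - e \<le> K / \<rho> ^ N * (Q powr (1 - r) * I)" by simp
        \<comment> \<open>Cancelling the positive factor \<open>Q powr (1 - r)\<close> turns the
          estimate for \<open>Q\<close> into one for \<open>Q powr r\<close>.\<close>
        define a b where "a = Q powr r" and "b = Q powr (1 - r)"
        have "Q = a * b" using Q by (simp add: a_def b_def flip: powr_add)
        then have "a * 2 powr - e * b \<le> K / \<rho> ^ N * I * b"
          using le unfolding b_def[symmetric] by (simp add: algebra_simps)
        then have *: "Q powr r * 2 powr - e \<le> K / \<rho> ^ N * I"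
          unfolding a_def[symmetric]
          by (rule mult_right_le_imp_le) (use Q in \<open>simp add: b_def\<close>)
        have "Q powr r = M powr r * \<rho> powr (- e * r)"
          using M \<rho> by (simp add: Q_def powr_mult powr_powr)
        also have "- e * r = - real N" using r by (simp add: e_def)
        also have "\<rho> powr (- real N) = 1 / \<rho> ^ N"
          using \<rho> by (simp add: powr_minus powr_realpow divide_inverse)
        finally have Qr: "Q powr r = M powr r / \<rho> ^ N" by simp
        have "M powr r * 2 powr - e \<le> K * I"
          using * \<rho> unfolding Qr times_divide_eq_left by (subst (asm) divide_le_cancel) auto
        then have "M powr r * 2 powr - e * 2 powr e \<le> K * I * 2 powr e"
          by (rule mult_right_mono) simp
        then have "M powr r \<le> 2 powr e * K * I"
          by (simp add: powr_minus field_simps)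

        moreover have "\<bar>f z\<bar> powr r * R ^ N \<le> M powr r"
        proof -
          have "e * r = real N" using r by (simp add: e_def)
          then have "(R powr e) powr r = R ^ N" using R by (simp add: powr_powr powr_realpow)
          then have "\<bar>f z\<bar> powr r * R ^ N = (\<bar>f z\<bar> * R powr e) powr r"
            using powr_mult[of "\<bar>f z\<bar>" "R powr e" r] by simp
          also have "\<dots> \<le> M powr r" using zM r by (intro powr_mono2) auto
          finally show ?thesis .
        qed
        ultimately have "\<bar>f z\<bar> powr r * R ^ N \<le> 2 powr e * K * I" by (rule order_trans[rotated])
        then have "\<bar>f z\<bar> powr r \<le> 2 powr e * K * I / R ^ N"
          using R by (subst pos_le_divide_eq) auto
        then have "\<bar>f z\<bar> powr r \<le> 2 powr e * K / R ^ N * I" by simp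
        then have "ennreal (\<bar>f z\<bar> powr r) \<le> ennreal (2 powr e * K / R ^ N * I)" by (rule ennreal_leI)
        also have "\<dots> = ennreal (2 powr e * K / R ^ N) * ennreal I"
          by (rule ennreal_mult) (use K R I in simp_all)
        finally show ?thesis using I(1) by (simp only: N_def)
      qed
    qed
  qed
qed

section \<open>Test functions\<close>

definition plane_coord :: "'a \<Rightarrow> 'a \<Rightarrow> 'a::euclidean_space \<Rightarrow> complex" where
  "plane_coord e e' z = of_real (z \<bullet> e) + \<i> * of_real (z \<bullet> e')"

text \<open>The Kelvin transform of the harmonic polynomial \<open>Re ((z \<bullet> e + \<i> * (z \<bullet> e')) ^ M)\<close>; it decays
  like \<open>norm z powr - (M + DIM - 2)\<close>.\<close>

definition kelvin_power :: "'a \<Rightarrow> 'a \<Rightarrow> nat \<Rightarrow> 'a::euclidean_space \<Rightarrow> real" where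
  "kelvin_power e e' M z = Re (plane_coord e e' z ^ M) * (z \<bullet> z) powr (- (2 * real M + real DIM('a) - 2) / 2)"

lemma Re_plane_coord [simp]: "Re (plane_coord e e' z) = z \<bullet> e"
  and Im_plane_coord [simp]: "Im (plane_coord e e' z) = z \<bullet> e'"
  by (simp_all add: plane_coord_def)

lemma has_derivative_inner_self_powr:
  fixes z :: "'a::euclidean_space"
  assumes "z \<noteq> 0"
  shows "((\<lambda>z. (z \<bullet> z) powr c) has_derivative (\<lambda>v. 2 * c * (z \<bullet> z) powr (c - 1) * (z \<bullet> v))) (at z)"
proof -
  have p: "0 < z \<bullet> z" using assms by simp
  have "((\<lambda>z. z \<bullet> z) has_derivative (\<lambda>v. z \<bullet> v + v \<bullet> z)) (at z)"
    by (auto intro!: derivative_eq_intros)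
  moreover have "((\<lambda>x. x powr c) has_derivative (*) (c * (z \<bullet> z) powr (c - 1))) (at (z \<bullet> z))"
    using has_real_derivative_powr[OF p, of c] by (rule has_field_derivative_imp_has_derivative)
  ultimately have "((\<lambda>z. (z \<bullet> z) powr c) has_derivative (\<lambda>v. c * (z \<bullet> z) powr (c - 1) * (z \<bullet> v + v \<bullet> z))) (at z)"
    by (rule has_derivative_compose)
  then show ?thesis
    by (rule has_derivative_eq_rhs) (auto simp: inner_commute)
qed

lemma sum_inner_Basis_delta:
  assumes "e \<in> Basis"
  shows "(\<Sum>b\<in>Basis. \<phi> b * (e \<bullet> b)) = (\<phi> (e::'a::euclidean_space) :: real)"
proof -
  have "(\<Sum>b\<in>Basis. \<phi> b * (e \<bullet> b)) = (\<Sum>b\<in>Basis. if b = e then \<phi> b else 0)"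
    using assms by (intro sum.cong) (auto simp: inner_Basis)
  then show ?thesis using assms by simp
qed

lemma has_derivative_plane_coord_power:
  "((\<lambda>z. plane_coord e e' z ^ k) has_derivative (\<lambda>v. of_nat k * plane_coord e e' v * plane_coord e e' z ^ (k - 1))) (at z)"
proof -
  have "(plane_coord e e' has_derivative plane_coord e e') (at z)"
    unfolding plane_coord_def[abs_def] by (auto intro!: derivative_eq_intros)
  from has_derivative_power[OF this, of k] show ?thesis by simp
qed

text \<open>Write the function as H times |z|^(-a), with H harmonic and homogeneous of degree M.
  Euler's identity turns the mixed term of the Laplacian of the product into a multiple of H, and
  everything collects to -a (2 M + DIM - 2 - a) H |z|^(-a - 2). The chosen exponent a makes the
  bracket vanish.\<close>

lemma harmonic_on_kelvin_power:
  fixes e e' :: "'a::euclidean_space"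
  assumes e: "e \<in> Basis" "e' \<in> Basis" "e \<noteq> e'" and M: "2 \<le> M"
  shows "harmonic_on (kelvin_power e e' M) (- {0})"
proof -
  let ?W = "plane_coord e e'"
  define a where "a = 2 * real M + real DIM('a) - 2"
  \<comment> \<open>A family closed under differentiation: the derivative of \<open>P c\<close> at z
    in direction v is a multiple of \<open>P (c + 1) z * (z \<bullet> v)\<close>.\<close>
  define P where "P c z = (z \<bullet> z) powr (- a / 2 - c)" for c and z :: 'a
  define H where "H z = Re (?W z ^ M)" for z
  define gH where "gH z = real M *\<^sub>R (Re (?W z ^ (M - 1)) *\<^sub>R e - Im (?W z ^ (M - 1)) *\<^sub>R e')" for z
  define hH where "hH z v = real M *\<^sub>R (Re (of_nat (M - 1) * ?W v * ?W z ^ (M - 2)) *\<^sub>R e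
      - Im (of_nat (M - 1) * ?W v * ?W z ^ (M - 2)) *\<^sub>R e')" for z v
  define g where "g z = P 0 z *\<^sub>R gH z + (- a * (H z * P 1 z)) *\<^sub>R z" for z
  define h where "h z v = (P 0 z *\<^sub>R hH z v + (- a * P 1 z * (z \<bullet> v)) *\<^sub>R gH z)
      + ((- a * (H z * P 1 z)) *\<^sub>R v + (- a * (H z * (- (a + 2) * P 2 z * (z \<bullet> v)) + (gH z \<bullet> v) * P 1 z)) *\<^sub>R z)" for z v
  have dP: "(P c has_derivative (\<lambda>v. - (a + 2 * c) * P (c + 1) z * (z \<bullet> v))) (at z)" if "z \<noteq> 0" for c z
    unfolding P_def[abs_def]
    by (rule has_derivative_eq_rhs[OF has_derivative_inner_self_powr[OF that]]) (auto simp: field_simps)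
  have dH: "(H has_derivative (\<lambda>v. gH z \<bullet> v)) (at z)" for z
  proof -
    have "(H has_derivative (\<lambda>v. Re (of_nat M * ?W v * ?W z ^ (M - 1)))) (at z)"
      unfolding H_def[abs_def] by (intro has_derivative_Re has_derivative_plane_coord_power)
    then show ?thesis
      by (rule has_derivative_eq_rhs)
        (simp add: gH_def inner_diff_left inner_commute fun_eq_iff algebra_simps)
  qed
  have dgH: "(gH has_derivative hH z) (at z)" for z
  proof -
    have "((\<lambda>z. ?W z ^ (M - 1)) has_derivative (\<lambda>v. of_nat (M - 1) * ?W v * ?W z ^ (M - 2))) (at z)"
      using has_derivative_plane_coord_power[of e e' "M - 1" z] by (simp add: diff_diff_left numeral_2_eq_2)
    then show ?thesis
      unfolding gH_def[abs_def] hH_def[abs_def]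
      by (intro has_derivative_scaleR_right has_derivative_diff has_derivative_scaleR_left has_derivative_Re has_derivative_Im)
  qed
  have Euler: "gH z \<bullet> z = real M * H z" for z
  proof -
    have "?W z ^ M = ?W z ^ (M - 1) * ?W z" using M by (simp flip: power_Suc2)
    then show ?thesis
      by (simp add: gH_def H_def inner_diff_left inner_commute algebra_simps)
  qed
  have df: "(kelvin_power e e' M has_derivative (\<lambda>v. g z \<bullet> v)) (at z)" if z: "z \<noteq> 0" for z
  proof -
    have "((\<lambda>z. H z * P 0 z) has_derivative (\<lambda>v. H z * (- (a + 2 * 0) * P (0 + 1) z * (z \<bullet> v)) + (gH z \<bullet> v) * P 0 z)) (at z)"
      by (intro has_derivative_mult dH dP z)
    moreover have "(\<lambda>z. H z * P 0 z) = kelvin_power e e' M"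
      by (simp add: fun_eq_iff H_def P_def kelvin_power_def a_def)
    ultimately show ?thesis
      by (auto elim!: has_derivative_eq_rhs simp: g_def inner_add_left algebra_simps)
  qed
  have dg: "(g has_derivative h z) (at z)" if z: "z \<noteq> 0" for z
  proof -
    have 1: "((\<lambda>z. P 0 z *\<^sub>R gH z) has_derivative (\<lambda>v. P 0 z *\<^sub>R hH z v + (- (a + 2 * 0) * P (0 + 1) z * (z \<bullet> v)) *\<^sub>R gH z)) (at z)"
      by (intro has_derivative_scaleR dP dgH z)
    have 2: "((\<lambda>z. - a * (H z * P 1 z)) has_derivative
        (\<lambda>v. - a * (H z * (- (a + 2 * 1) * P (1 + 1) z * (z \<bullet> v)) + (gH z \<bullet> v) * P 1 z))) (at z)"
      by (intro has_derivative_mult_right has_derivative_mult dH dP z)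
    have 3: "((\<lambda>z. (- a * (H z * P 1 z)) *\<^sub>R z) has_derivative
        (\<lambda>v. (- a * (H z * P 1 z)) *\<^sub>R v + (- a * (H z * (- (a + 2 * 1) * P (1 + 1) z * (z \<bullet> v)) + (gH z \<bullet> v) * P 1 z)) *\<^sub>R z)) (at z)"
      by (intro has_derivative_scaleR 2 has_derivative_ident)
    show ?thesis
      using has_derivative_add[OF 1 3] unfolding g_def[abs_def] h_def[abs_def] by simp
  qed
  have blin: "bounded_linear (h z)" if "z \<noteq> 0" for z
    using dg[OF that] by (rule has_derivative_bounded_linear)
  have app: "blinfun_apply (Blinfun (h z)) = h z" if "z \<noteq> 0" for z
    using blin[OF that] by (rule bounded_linear_Blinfun_apply)
  have cont: "continuous_on (- {0}) (\<lambda>z. Blinfun (h z))"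
  proof (rule continuous_on_blinfun_componentwise)
    fix i :: 'a
    have "continuous_on (- {0}) (\<lambda>z. h z i)"
      unfolding h_def hH_def gH_def P_def H_def plane_coord_def by (intro continuous_intros) auto
    then show "continuous_on (- {0}) (\<lambda>z. blinfun_apply (Blinfun (h z)) i)"
      by (rule continuous_on_eq) (simp add: app)
  qed
  have tr: "(\<Sum>b\<in>Basis. h z b \<bullet> b) = 0" if z: "z \<noteq> 0" for z
  proof -
    have "(\<Sum>b\<in>Basis. h z b \<bullet> b) = (\<Sum>b\<in>Basis. P 0 z * (hH z b \<bullet> b) + - a * P 1 z * ((gH z \<bullet> b) * (z \<bullet> b))
        + (- a * (H z * P 1 z)) + (a * (a + 2) * H z * P 2 z * ((z \<bullet> b) * (z \<bullet> b)) + - a * P 1 z * ((gH z \<bullet> b) * (z \<bullet> b))))"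
      by (intro sum.cong) (auto simp: h_def inner_add_left algebra_simps)
    also have "\<dots> = P 0 z * (\<Sum>b\<in>Basis. hH z b \<bullet> b) + - a * P 1 z * (gH z \<bullet> z)
        + real DIM('a) * (- a * (H z * P 1 z)) + (a * (a + 2) * H z * P 2 z * (z \<bullet> z) + - a * P 1 z * (gH z \<bullet> z))"
      unfolding euclidean_inner[of "gH z" z] euclidean_inner[of z z]
      by (simp only: sum.distrib sum_distrib_left sum_constant)
    \<comment> \<open>The contributions of \<open>e\<close> and \<open>e'\<close> cancel, because
      \<open>?W e = 1\<close>, \<open>?W e' = \<i>\<close> and
      \<open>Im (\<i> * w) = Re w\<close>.\<close>
    also have "(\<Sum>b\<in>Basis. hH z b \<bullet> b) = 0"
    proof -
      have "(\<Sum>b\<in>Basis. hH z b \<bullet> b) = real M * ((\<Sum>b\<in>Basis. Re (of_nat (M - 1) * ?W b * ?W z ^ (M - 2)) * (e \<bullet> b))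
          - (\<Sum>b\<in>Basis. Im (of_nat (M - 1) * ?W b * ?W z ^ (M - 2)) * (e' \<bullet> b)))"
        by (simp only: hH_def inner_scaleR_left inner_diff_left sum_subtractf sum_distrib_left right_diff_distrib)
      also have "\<dots> = 0"
      proof -
        have "?W e = 1" "?W e' = \<i>"
          using e by (auto simp: complex_eq_iff inner_Basis)
        then show ?thesis
          unfolding sum_inner_Basis_delta[OF e(1)] sum_inner_Basis_delta[OF e(2)] by simp
      qed
      finally show ?thesis .
    qed
    also have "P 2 z * (z \<bullet> z) = P 1 z"
    proof -
      have "- a / 2 - 2 + 1 = - a / 2 - 1" by simp
      then have "P 2 z * (z \<bullet> z) powr 1 = P 1 z" unfolding P_def powr_add[symmetric] by (simp only:)
      then show ?thesis using z by simp
    qed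
    then have "a * (a + 2) * H z * P 2 z * (z \<bullet> z) = a * (a + 2) * H z * P 1 z" by (simp add: mult.assoc)
    then have "P 0 z * 0 + - a * P 1 z * (gH z \<bullet> z)
        + real DIM('a) * (- a * (H z * P 1 z)) + (a * (a + 2) * H z * P 2 z * (z \<bullet> z) + - a * P 1 z * (gH z \<bullet> z))
        = - a * H z * P 1 z * (2 * real M + real DIM('a) - 2 - a)"
      unfolding Euler by (simp add: algebra_simps)
    also have "\<dots> = 0" by (simp add: a_def)
    finally show ?thesis .
  qed
  show ?thesis
    unfolding harmonic_on_def
  proof (intro exI conjI ballI)
    show "(kelvin_power e e' M has_derivative (\<lambda>v. g z \<bullet> v)) (at z)" if "z \<in> - {0}" for z
      using that by (intro df) auto
    show "(g has_derivative blinfun_apply (Blinfun (h z))) (at z)" if "z \<in> - {0}" for z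
      using that by (simp add: app dg)
    show "(\<Sum>b\<in>Basis. blinfun_apply (Blinfun (h z)) b \<bullet> b) = 0" if "z \<in> - {0}" for z
      using that by (simp add: app tr)
  qed (rule cont)
qed

lemma harmonic_on_shift:
  assumes "harmonic_on f T" and sub: "\<And>z. z \<in> S \<Longrightarrow> z - p \<in> T"
  shows "harmonic_on (\<lambda>z. f (z - p)) S"
proof -
  obtain g h where g: "\<And>z. z \<in> T \<Longrightarrow> (f has_derivative (\<lambda>v. g z \<bullet> v)) (at z)"
    and h: "\<And>z. z \<in> T \<Longrightarrow> (g has_derivative blinfun_apply (h z)) (at z)"
    and hc: "continuous_on T h" and tr: "\<And>z. z \<in> T \<Longrightarrow> (\<Sum>b\<in>Basis. blinfun_apply (h z) b \<bullet> b) = 0"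
    using assms(1) unfolding harmonic_on_def by blast
  have d: "((\<lambda>z. z - p) has_derivative (\<lambda>v. v)) (at z)" for z
    by (auto intro!: derivative_eq_intros)
  show ?thesis
    unfolding harmonic_on_def
  proof (intro exI conjI ballI)
    show "((\<lambda>z. f (z - p)) has_derivative (\<lambda>v. g (z - p) \<bullet> v)) (at z)" if "z \<in> S" for z
      using has_derivative_compose[OF d g[OF sub[OF that]]] .
    show "((\<lambda>z. g (z - p)) has_derivative blinfun_apply (h (z - p))) (at z)" if "z \<in> S" for z
      using has_derivative_compose[OF d h[OF sub[OF that]]] .
    show "continuous_on S (\<lambda>z. h (z - p))"
      by (intro continuous_on_compose2[OF hc] continuous_intros) (use sub in auto)
    show "(\<Sum>b\<in>Basis. blinfun_apply (h (z - p)) b \<bullet> b) = 0" if "z \<in> S" for z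
      using tr[OF sub[OF that]] .
  qed
qed

section \<open>Upper and lower bounds for Kelvin transforms\<close>

lemma norm_plane_coord_le:
  assumes "e \<in> Basis" "e' \<in> Basis" "e \<noteq> (e'::'a::euclidean_space)"
  shows "norm (plane_coord e e' z) \<le> norm z"
proof -
  have "(norm (plane_coord e e' z))\<^sup>2 = (\<Sum>b\<in>{e, e'}. (z \<bullet> b) * (z \<bullet> b))"
    using assms by (simp add: cmod_power2) (simp add: power2_eq_square)
  also have "\<dots> \<le> (\<Sum>b\<in>Basis. (z \<bullet> b) * (z \<bullet> b))"
    using assms by (intro sum_mono2) auto
  also have "\<dots> = (norm z)\<^sup>2" by (simp add: power2_norm_eq_inner euclidean_inner[of z z])
  finally show ?thesis by (simp add: power2_le_iff_abs_le)
qed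

lemma inner_self_powr: "(z \<bullet> z) powr c = norm z powr (2 * c)"
proof (cases "z = 0")
  case False
  have "z \<bullet> z = norm z powr 2"
    using False by (simp add: dot_square_norm)
  then show ?thesis by (simp only: powr_powr)
qed auto

lemma abs_kelvin_power:
  "\<bar>kelvin_power e e' M (z::'a::euclidean_space)\<bar>
    = \<bar>Re (plane_coord e e' z ^ M)\<bar> * norm z powr (- (2 * real M + real DIM('a) - 2))"
proof -
  have "2 * (- (2 * real M + real DIM('a) - 2) / 2) = - (2 * real M + real DIM('a) - 2)" by simp
  then show ?thesis unfolding kelvin_power_def abs_mult inner_self_powr by (simp only: abs_of_nonneg[OF powr_ge_zero])
qed

lemma kelvin_power_le:
  assumes "e \<in> Basis" "e' \<in> Basis" "e \<noteq> (e'::'a::euclidean_space)"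
  shows "\<bar>kelvin_power e e' M z\<bar> \<le> norm z powr (2 - real M - real DIM('a))"
proof (cases "z = 0")
  case False
  have "\<bar>kelvin_power e e' M z\<bar> = \<bar>Re (plane_coord e e' z ^ M)\<bar> * norm z powr (- (2 * real M + real DIM('a) - 2))"
    by (rule abs_kelvin_power)
  also have "\<dots> \<le> norm z ^ M * norm z powr (- (2 * real M + real DIM('a) - 2))"
  proof (intro mult_right_mono)
    have "\<bar>Re (plane_coord e e' z ^ M)\<bar> \<le> norm (plane_coord e e' z) ^ M"
      using abs_Re_le_cmod[of "plane_coord e e' z ^ M"] by (simp add: norm_power)
    also have "\<dots> \<le> norm z ^ M" by (intro power_mono norm_plane_coord_le assms) auto
    finally show "\<bar>Re (plane_coord e e' z ^ M)\<bar> \<le> norm z ^ M" .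
  qed auto
  also have "\<dots> = norm z powr real M * norm z powr (- (2 * real M + real DIM('a) - 2))"
    using False by (simp add: powr_realpow)
  also have "\<dots> = norm z powr (2 - real M - real DIM('a))"
    unfolding powr_add[symmetric] by (rule arg_cong2[where f="(powr)"]) auto
  finally show ?thesis .
qed (simp add: kelvin_power_def)

text \<open>Induction with \<open>w ^ Suc k - 1 = w * (w ^ k - 1) + (w - 1)\<close>; equality holds
  for \<open>w = 1 + d\<close>.\<close>

lemma norm_power_minus_one_le:
  fixes w :: complex
  assumes "norm (w - 1) \<le> d"
  shows "norm (w ^ k - 1) \<le> (1 + d) ^ k - 1"
proof (induction k)
  case (Suc k)
  have d: "0 \<le> d" using assms norm_ge_zero[of "w - 1"] by linarith
  have "norm w \<le> 1 + d" using assms norm_triangle_sub[of w 1] by simp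
  have "w ^ Suc k - 1 = w * (w ^ k - 1) + (w - 1)" by (simp add: algebra_simps)
  then have "norm (w ^ Suc k - 1) \<le> norm w * norm (w ^ k - 1) + norm (w - 1)"
    by (metis norm_mult norm_triangle_ineq)
  also have "\<dots> \<le> (1 + d) * ((1 + d) ^ k - 1) + d"
    using assms \<open>norm w \<le> 1 + d\<close> d Suc by (intro add_mono mult_mono) auto
  finally show ?case by (simp add: algebra_simps)
qed simp

text \<open>Divided by its real part, the plane coordinate becomes some \<open>w\<close> with
  \<open>norm (w - 1)\<close> at most 1 / (3 M). Then \<open>w ^ M\<close> stays within exp (1/3) -
  1 <= 4/9 of 1, so that its real part is at least 1/2.\<close>

lemma kelvin_power_ge:
  fixes e e' z :: "'a::euclidean_space"
  assumes M: "0 < M" and T: "0 < T" "T \<le> z \<bullet> e" and near: "3 * real M * \<bar>z \<bullet> e'\<bar> \<le> z \<bullet> e" and R: "norm z \<le> R" and "z \<noteq> 0"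
  shows "T ^ M / 2 * R powr (- (2 * real M + real DIM('a) - 2)) \<le> \<bar>kelvin_power e e' M z\<bar>"
proof -
  let ?x = "z \<bullet> e" and ?y = "z \<bullet> e'"
  have x: "0 < ?x" using T by linarith
  define w where "w = plane_coord e e' z / of_real ?x"
  have w: "plane_coord e e' z = of_real ?x * w" using x by (simp add: w_def)
  have w1: "w - 1 = \<i> * of_real (?y / ?x)"
    using x by (simp add: w_def plane_coord_def add_divide_distrib)
  have "norm (w - 1) \<le> 1 / (3 * real M)"
    unfolding w1 using near x M by (simp add: norm_mult norm_divide field_simps)
  then have "norm (w ^ M - 1) \<le> (1 + 1 / (3 * real M)) ^ M - 1"
    by (rule norm_power_minus_one_le)
  also have "(1 + 1 / (3 * real M)) ^ M \<le> exp (1 / (3 * real M)) ^ M"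
    using M by (intro power_mono) (auto simp: exp_ge_add_one_self)
  also have "exp (1 / (3 * real M)) ^ M = exp (1 / 3 :: real)"
    using M by (simp flip: exp_of_nat_mult)
  also have "exp (1 / 3 :: real) \<le> 1 + 1 / 3 + (1 / 3)\<^sup>2" by (rule exp_bound) auto
  finally have "norm (w ^ M - 1) \<le> 1 / 2" by (simp add: power2_eq_square)
  then have "1 / 2 \<le> Re (w ^ M)"
    using abs_Re_le_cmod[of "w ^ M - 1"] by (simp add: abs_le_iff)
  moreover have "Re (plane_coord e e' z ^ M) = ?x ^ M * Re (w ^ M)"
    unfolding w power_mult_distrib by (simp flip: of_real_power)
  moreover have "T ^ M * (1 / 2) \<le> ?x ^ M * Re (w ^ M)"
    using T \<open>1 / 2 \<le> Re (w ^ M)\<close> by (intro mult_mono power_mono) auto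
  ultimately have "T ^ M / 2 \<le> \<bar>Re (plane_coord e e' z ^ M)\<bar>" by simp
  moreover have "R powr (- (2 * real M + real DIM('a) - 2)) \<le> norm z powr (- (2 * real M + real DIM('a) - 2))"
  proof -
    have "1 \<le> real M" "1 \<le> real DIM('a)" using M by (auto simp: Suc_le_eq)
    then show ?thesis using R \<open>z \<noteq> 0\<close> by (intro powr_mono2') auto
  qed
  ultimately show ?thesis
    unfolding abs_kelvin_power using T by (intro mult_mono) auto
qed

section \<open>Integrals of the majorants of the test functions\<close>

lemma nn_integral_max_norm_powr_finite:
  assumes "real DIM('a) < b"
  shows "(\<integral>\<^sup>+y. ennreal (max (norm (y::'a::euclidean_space)) 1 powr - b) \<partial>lborel) < top"
proof -
  define N where "N = DIM('a)"
  define v where "v = unit_ball_vol (real N) * 2 ^ N"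
  have v: "0 \<le> v" by (simp add: v_def)
  have b: "real N < b" using assms by (simp add: N_def)
  have "(\<integral>\<^sup>+y. ennreal (max (norm (y::'a)) 1 powr - b) \<partial>lborel)
      \<le> (\<integral>\<^sup>+y. (\<Sum>j. ennreal ((2 ^ j) powr - b) * indicator (cball (0::'a) (2 ^ Suc j)) y) \<partial>lborel)"
  proof (rule nn_integral_mono)
    fix y :: 'a
    define m where "m = max (norm y) 1"
    have m: "1 \<le> m" by (simp add: m_def)
    \<comment> \<open>The dyadic shell containing y. It lies in a ball of volume about 2^(j N),
      while the integrand is at most 2^(- j b), so \<open>N < b\<close> yields a convergent
      geometric series.\<close>
    define j where "j = nat \<lfloor>log 2 m\<rfloor>"
    have j: "real j \<le> log 2 m" "log 2 m < real j + 1"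
      using m by (auto simp: j_def zero_le_log_cancel_iff)
    have "2 ^ j \<le> m" using j(1) m by (simp add: le_log_iff powr_realpow)
    have "m < 2 powr (real j + 1)" using j(2) m by (simp add: log_less_iff)
    also have "2 powr (real j + 1) = (2::real) ^ Suc j" by (simp add: powr_add powr_realpow)
    finally have "norm y \<le> 2 ^ Suc j" by (simp add: m_def)
    have "ennreal (max (norm y) 1 powr - b) \<le> ennreal ((2 ^ j) powr - b) * indicator (cball 0 (2 ^ Suc j)) y"
      using \<open>norm y \<le> 2 ^ Suc j\<close> \<open>2 ^ j \<le> m\<close> b unfolding m_def[symmetric]
      by (auto simp: indicator_def intro!: ennreal_leI powr_mono2')
    also have "\<dots> \<le> (\<Sum>j. ennreal ((2 ^ j) powr - b) * indicator (cball 0 (2 ^ Suc j)) y)"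
      by (rule le_suminf_ennreal)
    finally show "ennreal (max (norm y) 1 powr - b) \<le> (\<Sum>j. ennreal ((2 ^ j) powr - b) * indicator (cball 0 (2 ^ Suc j)) y)" .
  qed
  also have "\<dots> = (\<Sum>j. \<integral>\<^sup>+y. ennreal ((2 ^ j) powr - b) * indicator (cball (0::'a) (2 ^ Suc j)) y \<partial>lborel)"
    by (intro nn_integral_suminf borel_measurable_times_ennreal borel_measurable_const borel_measurable_indicator) auto
  also have "\<dots> = (\<Sum>j. ennreal (v * (2 powr (real N - b)) ^ j))"
  proof (rule arg_cong[where f=suminf], rule ext)
    fix j :: nat
    have "(\<integral>\<^sup>+y. ennreal ((2 ^ j) powr - b) * indicator (cball (0::'a) (2 ^ Suc j)) y \<partial>lborel)
        = ennreal ((2 ^ j) powr - b) * ennreal (unit_ball_vol (real N) * (2 ^ Suc j) ^ N)"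
      by (subst nn_integral_cmult_indicator) (auto simp: emeasure_cball N_def)
    also have "\<dots> = ennreal ((2 ^ j) powr - b * (unit_ball_vol (real N) * (2 ^ Suc j) ^ N))"
      by (simp add: ennreal_mult)
    also have "(2 ^ j) powr - b * (unit_ball_vol (real N) * (2 ^ Suc j) ^ N) = v * (2 powr (real N - b)) ^ j"
    proof -
      have j: "(2::real) ^ j = 2 powr real j" by (rule powr_realpow[symmetric]) simp
      have "(2 ^ j) powr - b = 2 powr (real j * - b)"
        unfolding j by (rule powr_powr)
      moreover have "(2 ^ Suc j :: real) ^ N = 2 ^ N * 2 powr (real j * real N)"
      proof -
        have "(2 powr real j) ^ N = (2 powr real j) powr real N" by (rule powr_realpow[symmetric]) simp
        then show ?thesis unfolding power_Suc power_mult_distrib j powr_powr by simp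
      qed
      moreover have "(2 powr (real N - b)) ^ j = 2 powr (real j * real N) * 2 powr (real j * - b)"
      proof -
        have "(2 powr (real N - b)) ^ j = (2 powr (real N - b)) powr real j" by (rule powr_realpow[symmetric]) simp
        also have "\<dots> = 2 powr (real j * real N + real j * - b)" by (simp add: powr_powr algebra_simps)
        finally show ?thesis unfolding powr_add .
      qed
      ultimately show ?thesis by (simp add: v_def)
    qed
    finally show "(\<integral>\<^sup>+y. ennreal ((2 ^ j) powr - b) * indicator (cball (0::'a) (2 ^ Suc j)) y \<partial>lborel) = ennreal (v * (2 powr (real N - b)) ^ j)" .
  qed
  also have "\<dots> < top"
  proof -
    have "2 powr (real N - b) < 2 powr (0::real)" using b by (intro powr_less_mono) auto
    then have "summable (\<lambda>j. v * (2 powr (real N - b)) ^ j)"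
      by (intro summable_mult summable_geometric) auto
    then show ?thesis using v by (subst suminf_ennreal2) auto
  qed
  finally show ?thesis .
qed

text \<open>Substituting x = \<xi> + \<eta> y reduces the claim to \<eta> = 1 and produces the power
  of \<eta>.\<close>

lemma nn_integral_max_norm_powr_le:
  assumes "real DIM('a) < b"
  obtains C where "0 \<le> C" "\<And>(\<xi> :: 'a::euclidean_space) \<eta>. 0 < \<eta> \<Longrightarrow>
    (\<integral>\<^sup>+x. ennreal (max (norm (x - \<xi>)) \<eta> powr - b) \<partial>lborel) \<le> ennreal (C * \<eta> powr (real DIM('a) - b))"
proof -
  let ?I = "\<integral>\<^sup>+y. ennreal (max (norm (y::'a)) 1 powr - b) \<partial>lborel"
  obtain C where C: "?I = ennreal C" "0 \<le> C"
    using nn_integral_max_norm_powr_finite[OF assms] by (cases ?I) auto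
  show thesis
  proof (rule that[OF C(2)])
    fix \<xi> :: 'a and \<eta> :: real assume \<eta>: "0 < \<eta>"
    have "(\<integral>\<^sup>+x. ennreal (max (norm (x - \<xi>)) \<eta> powr - b) \<partial>lborel)
        = ennreal (\<eta> ^ DIM('a)) * (\<integral>\<^sup>+y. ennreal (max (norm (\<xi> + \<eta> *\<^sub>R y - \<xi>)) \<eta> powr - b) \<partial>lborel)"
      by (rule nn_integral_affine) (use \<eta> in auto)
    also have "(\<integral>\<^sup>+y. ennreal (max (norm (\<xi> + \<eta> *\<^sub>R y - \<xi>)) \<eta> powr - b) \<partial>lborel)
        = (\<integral>\<^sup>+y. ennreal (\<eta> powr - b) * ennreal (max (norm (y::'a)) 1 powr - b) \<partial>lborel)"
    proof (rule nn_integral_cong)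
      fix y :: 'a
      have "max (norm (\<xi> + \<eta> *\<^sub>R y - \<xi>)) \<eta> = \<eta> * max (norm y) 1"
        using \<eta> by (simp add: max_def)
      then show "ennreal (max (norm (\<xi> + \<eta> *\<^sub>R y - \<xi>)) \<eta> powr - b) = ennreal (\<eta> powr - b) * ennreal (max (norm y) 1 powr - b)"
        using \<eta> by (simp add: powr_mult ennreal_mult)
    qed
    also have "\<dots> = ennreal (\<eta> powr - b) * ennreal C"
      unfolding C(1)[symmetric] by (rule nn_integral_cmult) auto
    also have "ennreal (\<eta> ^ DIM('a)) * (ennreal (\<eta> powr - b) * ennreal C) = ennreal (C * \<eta> powr (real DIM('a) - b))"
    proof -
      have "\<eta> ^ DIM('a) * (\<eta> powr - b * C) = C * \<eta> powr (real DIM('a) - b)"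
        using \<eta> by (simp add: powr_diff powr_minus powr_realpow divide_inverse)
      then show ?thesis using C \<eta> by (simp flip: ennreal_mult)
    qed
    finally show "(\<integral>\<^sup>+x. ennreal (max (norm (x - \<xi>)) \<eta> powr - b) \<partial>lborel) \<le> ennreal (C * \<eta> powr (real DIM('a) - b))" by simp
  qed
qed

text \<open>For \<eta> = 1 this is Euler's Beta integral; the integrand is at most t^(A - 1) up to t
  = 1 and t^(A - 1 - B) beyond, which gives the constant 1 / A + 1 / (B - A). Scaling in t brings in
  \<eta>.\<close>

lemma nn_integral_beta_le:
  fixes A B :: real
  assumes A: "0 < A" "A < B"
  obtains C where "0 \<le> C" "\<And>\<eta>. 0 < \<eta> \<Longrightarrow>
    (\<integral>\<^sup>+t\<in>{0<..}. ennreal ((t + \<eta>) powr - B * t powr (A - 1)) \<partial>lborel) \<le> ennreal (C * \<eta> powr (A - B))"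
proof -
  have h0: "((\<lambda>x. x powr (A - 1)) has_integral (1 powr (A - 1 + 1) / (A - 1 + 1))) {0..1}"
    by (rule has_integral_powr_from_0) (use A in auto)
  have h1: "((\<lambda>x. x powr (A - 1 - B)) has_integral -(1 powr (A - 1 - B + 1)) / (A - 1 - B + 1)) {1..}"
    by (rule has_integral_powr_to_inf) (use A in auto)
  define C where "C = 1 / A + 1 / (B - A)"
  have e: "- 1 / (A - B) = 1 / (B - A)" using A by (simp add: field_simps)
  have F: "(\<integral>\<^sup>+t\<in>{0<..}. ennreal ((t + 1) powr - B * t powr (A - 1)) \<partial>lborel) \<le> ennreal C"
  proof -
    have "(\<integral>\<^sup>+t\<in>{0<..}. ennreal ((t + 1) powr - B * t powr (A - 1)) \<partial>lborel)
        \<le> (\<integral>\<^sup>+t. ennreal (t powr (A - 1)) * indicator {0..1} t + ennreal (t powr (A - 1 - B)) * indicator {1..} t \<partial>lborel)"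
    proof (rule nn_integral_mono)
      fix t :: real
      have 1: "(t + 1) powr - B * t powr (A - 1) \<le> t powr (A - 1)" if "0 < t"
      proof -
        have "(t + 1) powr - B \<le> 1 powr - B" using A that by (intro powr_mono2') auto
        then show ?thesis by (simp add: mult_left_le_one_le)
      qed
      have 2: "(t + 1) powr - B * t powr (A - 1) \<le> t powr (A - 1 - B)" if "0 < t"
      proof -
        have "(t + 1) powr - B \<le> t powr - B" using A that by (intro powr_mono2') auto
        then have "(t + 1) powr - B * t powr (A - 1) \<le> t powr - B * t powr (A - 1)"
          by (rule mult_right_mono) auto
        also have "\<dots> = t powr (A - 1 - B)" unfolding powr_add[symmetric] by (simp add: algebra_simps)
        finally show ?thesis .
      qed
      show "ennreal ((t + 1) powr - B * t powr (A - 1)) * indicator {0<..} t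
          \<le> ennreal (t powr (A - 1)) * indicator {0..1} t + ennreal (t powr (A - 1 - B)) * indicator {1..} t"
      proof (cases "0 < t")
        case t: True
        show ?thesis
        proof (cases "t \<le> 1")
          case True
          then have "ennreal ((t + 1) powr - B * t powr (A - 1)) * indicator {0<..} t \<le> ennreal (t powr (A - 1)) * indicator {0..1} t"
            using 1 t by (simp add: ennreal_leI)
          then show ?thesis by (intro add_increasing2) auto
        next
          case False
          then have "ennreal ((t + 1) powr - B * t powr (A - 1)) * indicator {0<..} t \<le> ennreal (t powr (A - 1 - B)) * indicator {1..} t"
            using 2 t by (simp add: ennreal_leI)
          then show ?thesis by (intro add_increasing) auto
        qed
      qed simp
    qed
    also have "\<dots> = (\<integral>\<^sup>+t. ennreal (t powr (A - 1)) * indicator {0..1} t \<partial>lborel) + (\<integral>\<^sup>+t. ennreal (t powr (A - 1 - B)) * indicator {1..} t \<partial>lborel)"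
      by (rule nn_integral_add) auto
    also have "\<dots> = ennreal (1 / A) + ennreal (1 / (B - A))"
      using nn_integral_has_integral_lebesgue'[OF _ h0] nn_integral_has_integral_lebesgue'[OF _ h1] e by simp
    also have "\<dots> = ennreal C" using A by (simp add: C_def ennreal_plus)
    finally show ?thesis .
  qed
  show thesis
  proof (rule that)
    show C0: "0 \<le> C" using A by (simp add: C_def)
    fix \<eta> :: real assume \<eta>: "0 < \<eta>"
    have "(\<integral>\<^sup>+t\<in>{0<..}. ennreal ((t + \<eta>) powr - B * t powr (A - 1)) \<partial>lborel)
        = ennreal (\<eta> ^ DIM(real)) * (\<integral>\<^sup>+t. ennreal ((0 + \<eta> *\<^sub>R t + \<eta>) powr - B * (0 + \<eta> *\<^sub>R t) powr (A - 1)) * indicator {0<..} (0 + \<eta> *\<^sub>R t) \<partial>lborel)"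
      by (rule nn_integral_affine) (use \<eta> in auto)
    also have "\<dots> = ennreal \<eta> * (\<integral>\<^sup>+t. ennreal (\<eta> powr (A - 1 - B)) * (ennreal ((t + 1) powr - B * t powr (A - 1)) * indicator {0<..} t) \<partial>lborel)"
    proof -
      have "ennreal ((0 + \<eta> *\<^sub>R t + \<eta>) powr - B * (0 + \<eta> *\<^sub>R t) powr (A - 1)) * indicator {0<..} (0 + \<eta> *\<^sub>R t)
          = ennreal (\<eta> powr (A - 1 - B)) * (ennreal ((t + 1) powr - B * t powr (A - 1)) * indicator {0<..} t)" for t :: real
      proof (cases "0 < t")
        case True
        have "0 + \<eta> *\<^sub>R t + \<eta> = \<eta> * (t + 1)" by (simp add: algebra_simps)
        then have "(0 + \<eta> *\<^sub>R t + \<eta>) powr - B * (0 + \<eta> *\<^sub>R t) powr (A - 1)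
            = (\<eta> powr - B * \<eta> powr (A - 1)) * ((t + 1) powr - B * t powr (A - 1))"
          using True \<eta> by (simp add: powr_mult)
        also have "\<eta> powr - B * \<eta> powr (A - 1) = \<eta> powr (A - 1 - B)" unfolding powr_add[symmetric] by simp
        finally show ?thesis using True \<eta> by (simp add: ennreal_mult)
      qed (use \<eta> in \<open>auto simp: zero_less_mult_iff\<close>)
      then show ?thesis by simp
    qed
    also have "\<dots> = ennreal \<eta> * (ennreal (\<eta> powr (A - 1 - B)) * (\<integral>\<^sup>+t\<in>{0<..}. ennreal ((t + 1) powr - B * t powr (A - 1)) \<partial>lborel))"
      by (subst nn_integral_cmult) auto
    also have "\<dots> \<le> ennreal \<eta> * (ennreal (\<eta> powr (A - 1 - B)) * ennreal C)"
      by (intro mult_left_mono F) auto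
    also have "\<dots> = ennreal (C * \<eta> powr (A - B))"
    proof -
      have "\<eta> * \<eta> powr (A - 1 - B) = \<eta> powr (A - B)"
        using \<eta> by (simp add: powr_diff)
      then have "\<eta> * (\<eta> powr (A - 1 - B) * C) = C * \<eta> powr (A - B)"
        by (metis mult.assoc mult.commute)
      moreover have "ennreal \<eta> * (ennreal (\<eta> powr (A - 1 - B)) * ennreal C) = ennreal (\<eta> * (\<eta> powr (A - 1 - B) * C))"
        using C0 \<eta> by (simp add: ennreal_mult)
      ultimately show ?thesis by (simp only:)
    qed
    finally show "(\<integral>\<^sup>+t\<in>{0<..}. ennreal ((t + \<eta>) powr - B * t powr (A - 1)) \<partial>lborel) \<le> ennreal (C * \<eta> powr (A - B))" .
  qed
qed

text \<open>For a product of a function of x and a function of t the integrations separate whichever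
  comes first, so one computation serves both scales of spaces.\<close>

lemma norm_le_product:
  fixes f :: "(real^'n::finite) \<times> real \<Rightarrow> real" and s q \<alpha> :: real
  assumes s: "0 < s" and q: "0 < q" and [measurable]: "U \<in> borel_measurable borel" "V \<in> borel_measurable borel"
    and nn: "\<And>x. 0 \<le> U x" "\<And>t. 0 \<le> V t" and le: "\<And>x t. 0 < t \<Longrightarrow> \<bar>f (x, t)\<bar> \<le> U x * V t"
  defines "N \<equiv> epow (\<integral>\<^sup>+x. ennreal (U x powr s) \<partial>lborel) (1 / s)
      * epow (\<integral>\<^sup>+t\<in>{0<..}. ennreal (V t powr q * t powr (\<alpha> * q - 1)) \<partial>lborel) (1 / q)"
  shows "B_norm s q \<alpha> f \<le> N" "F_norm s q \<alpha> f \<le> N"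
proof -
  let ?U = "\<integral>\<^sup>+x. ennreal (U x powr s) \<partial>lborel"
  let ?V = "\<integral>\<^sup>+t\<in>{0<..}. ennreal (V t powr q * t powr (\<alpha> * q - 1)) \<partial>lborel"
  have le_r: "\<bar>f (x, t)\<bar> powr r \<le> U x powr r * V t powr r" if "0 < t" "0 \<le> r" for x t r
    using powr_mono2[OF that(2) _ le[OF that(1)], of x] by (simp add: powr_mult nn)
  have M: "epow (M_mean s f t) q \<le> epow ?U (q / s) * ennreal (V t powr q)" if t: "0 < t" for t
  proof -
    have "M_mean s f t \<le> epow (\<integral>\<^sup>+x. ennreal (U x powr s) * ennreal (V t powr s) \<partial>lborel) (1 / s)"
      unfolding M_mean_def using s le_r[OF t]
      by (intro epow_mono nn_integral_mono) (auto intro!: ennreal_leI simp flip: ennreal_mult)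
    also have "\<dots> = epow ?U (1 / s) * epow (ennreal (V t powr s)) (1 / s)"
      by (subst nn_integral_multc) (auto simp: epow_mult)
    also have "epow (ennreal (V t powr s)) (1 / s) = ennreal (V t)"
      using s nn by (simp add: epow_ennreal powr_powr)
    finally have "epow (M_mean s f t) q \<le> epow (epow ?U (1 / s) * ennreal (V t)) q"
      using q by (intro epow_mono) auto
    then show ?thesis using nn by (simp add: epow_mult epow_epow epow_ennreal)
  qed
  have "(\<integral>\<^sup>+t\<in>{0<..}. epow (M_mean s f t) q * ennreal (t powr (\<alpha> * q - 1)) \<partial>lborel)
      \<le> (\<integral>\<^sup>+t. epow ?U (q / s) * (ennreal (V t powr q * t powr (\<alpha> * q - 1)) * indicator {0<..} t) \<partial>lborel)"
  proof (rule nn_integral_mono)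
    fix t :: real
    show "epow (M_mean s f t) q * ennreal (t powr (\<alpha> * q - 1)) * indicator {0<..} t
      \<le> epow ?U (q / s) * (ennreal (V t powr q * t powr (\<alpha> * q - 1)) * indicator {0<..} t)"
    proof (cases "0 < t")
      case True
      have "epow (M_mean s f t) q * ennreal (t powr (\<alpha> * q - 1))
          \<le> epow ?U (q / s) * ennreal (V t powr q) * ennreal (t powr (\<alpha> * q - 1))"
        by (rule mult_right_mono[OF M[OF True]]) simp
      then show ?thesis using True by (simp add: ennreal_mult mult.assoc)
    qed simp
  qed
  also have "\<dots> = epow ?U (q / s) * ?V"
    by (rule nn_integral_cmult) measurable
  finally have "B_norm s q \<alpha> f \<le> epow (epow ?U (q / s) * ?V) (1 / q)"
    unfolding B_norm_def using q by (intro epow_mono) auto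
  then show "B_norm s q \<alpha> f \<le> N"
    using q by (simp add: N_def epow_mult epow_epow)
  have "(\<integral>\<^sup>+x. epow (\<integral>\<^sup>+t\<in>{0<..}. ennreal (\<bar>f (x, t)\<bar> powr q * t powr (\<alpha> * q - 1)) \<partial>lborel) (s / q) \<partial>lborel)
      \<le> (\<integral>\<^sup>+x. ennreal (U x powr s) * epow ?V (s / q) \<partial>lborel)"
  proof (rule nn_integral_mono)
    fix x
    have "(\<integral>\<^sup>+t\<in>{0<..}. ennreal (\<bar>f (x, t)\<bar> powr q * t powr (\<alpha> * q - 1)) \<partial>lborel)
        \<le> (\<integral>\<^sup>+t. ennreal (U x powr q) * (ennreal (V t powr q * t powr (\<alpha> * q - 1)) * indicator {0<..} t) \<partial>lborel)"
    proof (rule nn_integral_mono)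
      fix t :: real
      show "ennreal (\<bar>f (x, t)\<bar> powr q * t powr (\<alpha> * q - 1)) * indicator {0<..} t
          \<le> ennreal (U x powr q) * (ennreal (V t powr q * t powr (\<alpha> * q - 1)) * indicator {0<..} t)"
      proof (cases "0 < t")
        case True
        have "\<bar>f (x, t)\<bar> powr q * t powr (\<alpha> * q - 1) \<le> U x powr q * V t powr q * t powr (\<alpha> * q - 1)"
          using q by (intro mult_right_mono le_r True) auto
        then show ?thesis using True by (simp add: ennreal_leI mult.assoc flip: ennreal_mult)
      qed simp
    qed
    also have "\<dots> = ennreal (U x powr q) * ?V"
      by (rule nn_integral_cmult) measurable
    finally have "epow (\<integral>\<^sup>+t\<in>{0<..}. ennreal (\<bar>f (x, t)\<bar> powr q * t powr (\<alpha> * q - 1)) \<partial>lborel) (s / q)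
        \<le> epow (ennreal (U x powr q) * ?V) (s / q)"
      using s q by (intro epow_mono) auto
    also have "\<dots> = ennreal (U x powr s) * epow ?V (s / q)"
      using q nn by (simp add: epow_mult epow_ennreal powr_powr)
    finally show "epow (\<integral>\<^sup>+t\<in>{0<..}. ennreal (\<bar>f (x, t)\<bar> powr q * t powr (\<alpha> * q - 1)) \<partial>lborel) (s / q)
        \<le> ennreal (U x powr s) * epow ?V (s / q)" .
  qed
  also have "\<dots> = ?U * epow ?V (s / q)"
    by (rule nn_integral_multc) measurable
  finally have "F_norm s q \<alpha> f \<le> epow (?U * epow ?V (s / q)) (1 / s)"
    unfolding F_norm_def using s by (intro epow_mono) auto
  then show "F_norm s q \<alpha> f \<le> N"
    using s by (simp add: N_def epow_mult epow_epow)
qed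

section \<open>The test functions attached to Whitney cubes\<close>

lemma Basis_vec_prod:
  "(0, 1) \<in> (Basis :: ((real^'n::finite) \<times> real) set)" "(axis i 1, 0) \<in> (Basis :: ((real^'n::finite) \<times> real) set)"
  by (auto simp: Basis_prod_def Basis_vec_def)

text \<open>The pole lies at depth \<open>3 * M * \<eta>\<close> below the boundary, so that the cube around \<open>(\<xi>, \<eta>)\<close> is seen
  from it under an angle too small for \<open>Re (w ^ M)\<close> to vanish.\<close>

definition test_fun :: "nat \<Rightarrow> (real^'n::finite) \<Rightarrow> real \<Rightarrow> (real^'n) \<times> real \<Rightarrow> real" where
  "test_fun M \<xi> \<eta> z = kelvin_power (0, 1) (axis undefined 1, 0) M (z - (\<xi>, - (3 * real M * \<eta>)))"

lemma test_fun_harmonic: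
  assumes "2 \<le> M" "0 < \<eta>"
  shows "harmonic_on (test_fun M \<xi> \<eta>) (upper_half :: ((real^'n::finite) \<times> real) set)"
proof -
  have "harmonic_on (\<lambda>z::(real^'n) \<times> real. kelvin_power (0, 1) (axis undefined 1, 0) M (z - (\<xi>, - (3 * real M * \<eta>)))) upper_half"
  proof (rule harmonic_on_shift)
    show "harmonic_on (kelvin_power (0, 1) ((axis undefined 1, 0) :: (real^'n) \<times> real) M) (- {0})"
      using assms by (intro harmonic_on_kelvin_power Basis_vec_prod) auto
    fix z :: "(real^'n) \<times> real" assume "z \<in> upper_half"
    moreover have "0 \<le> 3 * real M * \<eta>" using assms by simp
    ultimately have "0 < snd (z - (\<xi>, - (3 * real M * \<eta>)))"
      unfolding upper_half_def snd_diff mem_Collect_eq snd_conv by linarith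
    then show "z - (\<xi>, - (3 * real M * \<eta>)) \<in> - {0}" by auto
  qed
  then show ?thesis by (simp add: test_fun_def[abs_def])
qed

text \<open>The distance to the pole dominates both \<open>max (norm (x - \<xi>)) \<eta>\<close> and
  \<open>t + \<eta>\<close>. In dimension n + 1 the decay exponent is M + n - 1, and it can be
  shared between x and t in any proportion.\<close>

lemma test_fun_le:
  fixes \<xi> :: "real^'n::finite"
  assumes M: "0 < M" and \<eta>: "0 < \<eta>" and t: "0 < t" and L: "0 \<le> L1" "0 \<le> L2" "L1 + L2 = real M + real CARD('n) - 1"
  shows "\<bar>test_fun M \<xi> \<eta> (x, t)\<bar> \<le> max (norm (x - \<xi>)) \<eta> powr - L1 * (t + \<eta>) powr - L2"
proof -
  let ?z = "(x, t) - (\<xi>, - (3 * real M * \<eta>))"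
  have K: "\<eta> \<le> 3 * real M * \<eta>" using M \<eta> by simp
  have 1: "norm (x - \<xi>) \<le> norm ?z" using norm_fst_le[where x = "x - \<xi>" and y = "t + 3 * real M * \<eta>"] by simp
  have 2: "t + \<eta> \<le> norm ?z" using norm_snd_le[where x = "x - \<xi>" and y = "t + 3 * real M * \<eta>"] K by simp
  have "\<bar>test_fun M \<xi> \<eta> (x, t)\<bar> \<le> norm ?z powr (2 - real M - real DIM((real^'n) \<times> real))"
    unfolding test_fun_def by (rule kelvin_power_le) (auto simp: Basis_vec_prod)
  also have "2 - real M - real DIM((real^'n) \<times> real) = - L1 + - L2" using L by simp
  also have "norm ?z powr (- L1 + - L2) = norm ?z powr - L1 * norm ?z powr - L2" by (rule powr_add)
  also have "\<dots> \<le> max (norm (x - \<xi>)) \<eta> powr - L1 * (t + \<eta>) powr - L2"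
    using 1 2 \<eta> t L by (intro mult_mono powr_mono2') auto
  finally show ?thesis .
qed

text \<open>Relative to the pole, each horizontal coordinate of a point of the cube is at most
  \<eta> and its height is at least 3 M \<eta>; this is the nearness condition of
  \<open>kelvin_power_ge\<close>. The power of \<eta> comes from homogeneity.\<close>

lemma test_fun_ge:
  assumes M: "0 < M"
  obtains c where "0 < c" "\<And>(\<xi> :: real^'n::finite) \<eta> l z. \<lbrakk>0 < \<eta>; l \<le> 2 * \<eta>; z \<in> cube (\<xi>, \<eta>) l\<rbrakk>
    \<Longrightarrow> c * \<eta> powr - (real M + real CARD('n) - 1) \<le> \<bar>test_fun M \<xi> \<eta> z\<bar>"
proof -
  \<comment> \<open>\<open>D * \<eta>\<close> bounds the distance from the pole to points of the
    cube: (n + 1) \<eta> from the point to the centre plus (1 + 3 M) \<eta> from the centre to the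
    pole.\<close>
  define D where "D = real CARD('n) + 2 + 3 * real M"
  define a where "a = 2 * real M + real CARD('n) - 1"
  have D: "0 < D" by (simp add: D_def)
  show thesis
  proof (rule that)
    show "0 < (3 * real M) ^ M / 2 * D powr - a" using M D by simp
    fix \<xi> :: "real^'n" and \<eta> l :: real and z assume \<eta>: "0 < \<eta>" and l: "l \<le> 2 * \<eta>" and z: "z \<in> cube (\<xi>, \<eta>) l"
    define w where "w = z - (\<xi>, - (3 * real M * \<eta>))"
    have b: "\<bar>(z - (\<xi>, \<eta>)) \<bullet> b\<bar> \<le> \<eta>" if "b \<in> Basis" for b
      using z l that unfolding cube_def by force
    have t: "\<bar>snd z - \<eta>\<bar> \<le> \<eta>" using b[OF Basis_vec_prod(1)] by (simp add: inner_prod_def)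
    \<comment> \<open>Valid for every horizontal direction, hence for the unspecified one that
      \<open>test_fun\<close> picks by \<open>undefined\<close>.\<close>
    have x: "\<bar>w \<bullet> (axis i 1, 0)\<bar> \<le> \<eta>" for i
      using b[OF Basis_vec_prod(2), of i] by (simp add: inner_prod_def w_def)
    have we: "w \<bullet> (0, 1) = snd z + 3 * real M * \<eta>" by (simp add: w_def inner_prod_def)
    have T: "3 * real M * \<eta> \<le> w \<bullet> (0, 1)" using t unfolding we by simp
    have T0: "0 < 3 * real M * \<eta>" using M \<eta> by simp
    have "norm w \<le> norm (z - (\<xi>, \<eta>)) + norm ((0::real^'n, (1 + 3 * real M) * \<eta>))"
    proof -
      have "w = (z - (\<xi>, \<eta>)) + (0, (1 + 3 * real M) * \<eta>)"
        by (cases z) (simp add: w_def algebra_simps)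
      then show ?thesis by (metis norm_triangle_ineq)
    qed
    also have "\<dots> \<le> D * \<eta>"
    proof -
      have "norm (z - (\<xi>, \<eta>)) \<le> real DIM((real^'n) \<times> real) * \<eta>"
        using b by (rule norm_le_of_components)
      moreover have "norm ((0::real^'n, (1 + 3 * real M) * \<eta>)) = (1 + 3 * real M) * \<eta>"
        using \<eta> by (simp add: norm_Pair)
      ultimately show ?thesis by (simp add: D_def algebra_simps)
    qed
    finally have R: "norm w \<le> D * \<eta>" .
    have "(3 * real M * \<eta>) ^ M / 2 * (D * \<eta>) powr (- (2 * real M + real DIM((real^'n) \<times> real) - 2)) \<le> \<bar>test_fun M \<xi> \<eta> z\<bar>"
      unfolding test_fun_def w_def[symmetric]
    proof (rule kelvin_power_ge[OF M T0 T _ R])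
      have "3 * real M * \<bar>w \<bullet> (axis undefined 1, 0)\<bar> \<le> 3 * real M * \<eta>"
        using x by (intro mult_left_mono) auto
      then show "3 * real M * \<bar>w \<bullet> (axis undefined 1, 0)\<bar> \<le> w \<bullet> (0, 1)" using T by linarith
      show "w \<noteq> 0" using T T0 by auto
    qed
    also have "- (2 * real M + real DIM((real^'n) \<times> real) - 2) = - a" by (simp add: a_def)
    also have "(3 * real M * \<eta>) ^ M / 2 * (D * \<eta>) powr - a = (3 * real M) ^ M / 2 * D powr - a * (\<eta> powr real M * \<eta> powr - a)"
      using D \<eta> by (simp add: powr_mult power_mult_distrib powr_realpow)
    also have "\<eta> powr real M * \<eta> powr - a = \<eta> powr - (real M + real CARD('n) - 1)"
      unfolding powr_add[symmetric] by (rule arg_cong2[where f="(powr)"]) (auto simp: a_def)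
    finally show "(3 * real M) ^ M / 2 * D powr - a * \<eta> powr - (real M + real CARD('n) - 1) \<le> \<bar>test_fun M \<xi> \<eta> z\<bar>" .
  qed
qed

lemma test_fun_norm_le:
  assumes s: "0 < s" and q: "0 < q" and \<alpha>: "0 < \<alpha>" and M: "0 < M"
    and L: "real CARD('n) / s + \<alpha> < real M + real CARD('n) - 1"
  obtains C where "0 \<le> C" "\<And>(\<xi> :: real^'n::finite) \<eta>. 0 < \<eta> \<Longrightarrow>
      B_norm s q \<alpha> (test_fun M \<xi> \<eta>) \<le> ennreal (C * \<eta> powr (real CARD('n) / s + \<alpha> - (real M + real CARD('n) - 1)))"
    "\<And>(\<xi> :: real^'n::finite) \<eta>. 0 < \<eta> \<Longrightarrow>
      F_norm s q \<alpha> (test_fun M \<xi> \<eta>) \<le> ennreal (C * \<eta> powr (real CARD('n) / s + \<alpha> - (real M + real CARD('n) - 1)))"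
proof -
  define n where "n = real CARD('n)"
  \<comment> \<open>Half of the surplus in the decay exponent. Convergence in x needs more than n /
    s and convergence in t more than \<alpha>; each variable gets this minimum plus
    \<open>d\<close>.\<close>
  define d where "d = (real M + n - 1 - n / s - \<alpha>) / 2"
  have d: "0 < d" using L by (simp add: d_def n_def)
  define L1 where "L1 = n / s + d"
  define L2 where "L2 = \<alpha> + d"
  have Ls: "0 \<le> L1" "0 \<le> L2" "L1 + L2 = real M + real CARD('n) - 1"
  proof -
    show "0 \<le> L1" "0 \<le> L2" using d s \<alpha> by (auto simp: L1_def L2_def n_def)
    have "L1 + L2 = n / s + \<alpha> + 2 * d" by (simp add: L1_def L2_def)
    moreover have "2 * d = real M + n - 1 - n / s - \<alpha>" unfolding d_def by (rule field_sum_of_halves[of _, folded mult_2])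
    ultimately show "L1 + L2 = real M + real CARD('n) - 1" unfolding n_def by linarith
  qed
  have b1: "real DIM(real^'n) < L1 * s" using d s by (simp add: L1_def n_def field_simps)
  have b2: "0 < \<alpha> * q" "\<alpha> * q < L2 * q" using d q \<alpha> by (auto simp: L2_def)
  obtain C1 where C1: "0 \<le> C1" "\<And>(\<xi> :: real^'n) \<eta>. 0 < \<eta> \<Longrightarrow>
    (\<integral>\<^sup>+x. ennreal (max (norm (x - \<xi>)) \<eta> powr - (L1 * s)) \<partial>lborel) \<le> ennreal (C1 * \<eta> powr (real DIM(real^'n) - L1 * s))"
    using nn_integral_max_norm_powr_le[OF b1] by blast
  obtain C2 where C2: "0 \<le> C2" "\<And>\<eta>. 0 < \<eta> \<Longrightarrow>
    (\<integral>\<^sup>+t\<in>{0<..}. ennreal ((t + \<eta>) powr - (L2 * q) * t powr (\<alpha> * q - 1)) \<partial>lborel) \<le> ennreal (C2 * \<eta> powr (\<alpha> * q - L2 * q))"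
    using nn_integral_beta_le[OF b2] by blast
  define C where "C = C1 powr (1 / s) * C2 powr (1 / q)"
  have *: "epow (\<integral>\<^sup>+x. ennreal ((max (norm (x - \<xi>)) \<eta> powr - L1) powr s) \<partial>lborel) (1 / s)
      * epow (\<integral>\<^sup>+t\<in>{0<..}. ennreal (((t + \<eta>) powr - L2) powr q * t powr (\<alpha> * q - 1)) \<partial>lborel) (1 / q)
      \<le> ennreal (C * \<eta> powr (real CARD('n) / s + \<alpha> - (real M + real CARD('n) - 1)))" (is "epow ?U _ * epow ?V _ \<le> _")
    if \<eta>: "0 < \<eta>" for \<xi> :: "real^'n" and \<eta>
  proof -
    have "epow ?U (1 / s) \<le> epow (ennreal (C1 * \<eta> powr (n - L1 * s))) (1 / s)"
      using C1(2)[OF \<eta>, of \<xi>] s by (intro epow_mono) (auto simp: powr_powr n_def)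
    moreover have "epow ?V (1 / q) \<le> epow (ennreal (C2 * \<eta> powr (\<alpha> * q - L2 * q))) (1 / q)"
      using C2(2)[OF \<eta>] q by (intro epow_mono) (auto simp: powr_powr)
    ultimately have "epow ?U (1 / s) * epow ?V (1 / q)
        \<le> epow (ennreal (C1 * \<eta> powr (n - L1 * s))) (1 / s) * epow (ennreal (C2 * \<eta> powr (\<alpha> * q - L2 * q))) (1 / q)"
      by (intro mult_mono) auto
    also have "\<dots> = ennreal (C1 powr (1 / s) * \<eta> powr ((n - L1 * s) * (1 / s))) * ennreal (C2 powr (1 / q) * \<eta> powr ((\<alpha> * q - L2 * q) * (1 / q)))"
      using C1(1) C2(1) by (simp add: epow_ennreal powr_mult powr_powr)
    also have "\<dots> = ennreal (C * (\<eta> powr ((n - L1 * s) * (1 / s)) * \<eta> powr ((\<alpha> * q - L2 * q) * (1 / q))))"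
      by (simp add: C_def mult_ac flip: ennreal_mult)
    also have "\<eta> powr ((n - L1 * s) * (1 / s)) * \<eta> powr ((\<alpha> * q - L2 * q) * (1 / q)) = \<eta> powr (n / s + \<alpha> - (L1 + L2))"
      unfolding powr_add[symmetric] using s q by (intro arg_cong2[where f="(powr)"]) (auto simp: field_simps)
    finally show ?thesis unfolding Ls(3) by (simp add: n_def)
  qed
  have U: "(\<lambda>x. max (norm (x - \<xi>)) \<eta> powr - L1) \<in> borel_measurable borel" for \<xi> :: "real^'n" and \<eta> by measurable
  have V: "(\<lambda>t. (t + \<eta>) powr - L2) \<in> borel_measurable borel" for \<eta> :: real by measurable
  show thesis
  proof (rule that)
    show "0 \<le> C" by (simp add: C_def)
    fix \<xi> :: "real^'n" and \<eta> :: real assume \<eta>: "0 < \<eta>"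
    have le: "\<bar>test_fun M \<xi> \<eta> (x, t)\<bar> \<le> max (norm (x - \<xi>)) \<eta> powr - L1 * (t + \<eta>) powr - L2" if "0 < t" for x t
      using M \<eta> that Ls by (rule test_fun_le)
    show "B_norm s q \<alpha> (test_fun M \<xi> \<eta>) \<le> ennreal (C * \<eta> powr (real CARD('n) / s + \<alpha> - (real M + real CARD('n) - 1)))"
      by (rule order_trans[OF norm_le_product(1)[OF s q U V _ _ le] *[OF \<eta>]]) auto
    show "F_norm s q \<alpha> (test_fun M \<xi> \<eta>) \<le> ennreal (C * \<eta> powr (real CARD('n) / s + \<alpha> - (real M + real CARD('n) - 1)))"
      by (rule order_trans[OF norm_le_product(2)[OF s q U V _ _ le] *[OF \<eta>]]) auto
  qed
qed

section \<open>Whitney decompositions\<close>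

lemma cube_eq_cbox: "cube c r = cbox (c - (r / 2) *\<^sub>R One) (c + (r / 2) *\<^sub>R One)"
  by (auto simp: cube_def mem_cbox_One_iff)

lemma sets_cube [measurable, simp]: "cube c r \<in> sets borel"
  by (simp add: cube_eq_cbox)

lemma mem_cube_Pair_iff: "(x, t) \<in> cube (\<xi>, \<eta>) r \<longleftrightarrow> x \<in> cube \<xi> r \<and> t \<in> cube \<eta> r"
  by (simp add: cube_def Basis_prod_def ball_Un)

lemma emeasure_cube: "0 \<le> r \<Longrightarrow> emeasure lborel (cube (c::'a::euclidean_space) r) = ennreal (r ^ DIM('a))"
proof -
  assume "0 \<le> r"
  then have "emeasure lborel (cube c r) = ennreal (\<Prod>b\<in>(Basis :: 'a set). r)"
    unfolding cube_eq_cbox by (subst emeasure_lborel_cbox) (auto simp: inner_diff_left inner_add_left)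
  then show ?thesis by simp
qed

lemma cball_subset_cube:
  fixes c :: "'a::euclidean_space"
  assumes "z \<in> cube c r" "r / 2 + d \<le> r' / 2"
  shows "cball z d \<subseteq> cube c r'"
proof
  fix y assume y: "y \<in> cball z d"
  show "y \<in> cube c r'"
    unfolding cube_def mem_Collect_eq
  proof
    fix b :: 'a assume b: "b \<in> Basis"
    have "\<bar>(y - z) \<bullet> b\<bar> \<le> d"
      using Basis_le_norm[OF b, of "y - z"] y by (simp add: dist_norm norm_minus_commute)
    moreover have "\<bar>(z - c) \<bullet> b\<bar> \<le> r / 2" using assms(1) b by (simp add: cube_def)
    moreover have "(y - c) \<bullet> b = (y - z) \<bullet> b + (z - c) \<bullet> b" by (simp add: inner_diff_left)
    ultimately show "\<bar>(y - c) \<bullet> b\<bar> \<le> r' / 2" using assms(2) by linarith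
  qed
qed

lemma open_upper_half: "open (upper_half :: ((real^'n::finite) \<times> real) set)"
  unfolding upper_half_def by (intro open_Collect_less continuous_intros)

lemma whitney_decompositionD:
  fixes \<zeta> :: "nat \<Rightarrow> (real^'n::finite) \<times> real"
  assumes W: "whitney_decomposition \<zeta> l"
  shows whitney_pos: "0 < l k" "0 < snd (\<zeta> k)" "l k \<le> 2 * snd (\<zeta> k)"
    and whitney_sub: "cube (\<zeta> k) (l k) \<subseteq> upper_half" "cube (\<zeta> k) (5/4 * l k) \<subseteq> upper_half"
    and whitney_overlap: "\<exists>N. \<forall>z. (\<Sum>k. indicator (cube (\<zeta> k) (5/4 * l k)) z :: ennreal) \<le> of_nat N"
    and whitney_height: "\<exists>c>0. \<exists>C>0. \<forall>k. \<forall>z\<in>cube (\<zeta> k) (5/4 * l k). c * snd (\<zeta> k) \<le> snd z \<and> snd z \<le> C * snd (\<zeta> k)"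
    and whitney_side: "\<exists>A>0. \<forall>k. snd (\<zeta> k) \<le> A * l k"
proof -
  have l: "0 < l k" for k using W by (simp add: whitney_decomposition_def)
  then show "0 < l k" .
  have sub: "cube (\<zeta> k) (l k) \<subseteq> upper_half" for k using W unfolding whitney_decomposition_def by blast
  then show "cube (\<zeta> k) (l k) \<subseteq> upper_half" .
  show "cube (\<zeta> k) (5/4 * l k) \<subseteq> upper_half" using W by (simp add: whitney_decomposition_def)
  \<comment> \<open>The centre of the bottom face. As it lies in the half space, the height of
    \<open>\<zeta> k\<close> exceeds half the side.\<close>
  have "\<zeta> k - (0, l k / 2) \<in> cube (\<zeta> k) (l k)"
    using l[of k] by (simp add: cube_def Basis_prod_def ball_Un)
  then have "\<zeta> k - (0, l k / 2) \<in> upper_half" using sub by blast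
  then have "l k / 2 < snd (\<zeta> k)" by (simp add: upper_half_def)
  then show "l k \<le> 2 * snd (\<zeta> k)" "0 < snd (\<zeta> k)" using l[of k] by auto
  show "\<exists>c>0. \<exists>C>0. \<forall>k. \<forall>z\<in>cube (\<zeta> k) (5/4 * l k). c * snd (\<zeta> k) \<le> snd z \<and> snd z \<le> C * snd (\<zeta> k)"
    using W by (simp add: whitney_decomposition_def)
  have "\<exists>N. \<forall>z. finite {k. z \<in> cube (\<zeta> k) (5/4 * l k)} \<and> card {k. z \<in> cube (\<zeta> k) (5/4 * l k)} \<le> N"
    using W by (simp add: whitney_decomposition_def)
  then obtain N where N: "\<And>z. finite {k. z \<in> cube (\<zeta> k) (5/4 * l k)}" "\<And>z. card {k. z \<in> cube (\<zeta> k) (5/4 * l k)} \<le> N"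
    by blast
  have "(\<Sum>k. indicator (cube (\<zeta> k) (5/4 * l k)) z :: ennreal) \<le> of_nat N" for z
  proof -
    have "(\<Sum>k. indicator (cube (\<zeta> k) (5/4 * l k)) z :: ennreal) = (\<Sum>k\<in>{k. z \<in> cube (\<zeta> k) (5/4 * l k)}. indicator (cube (\<zeta> k) (5/4 * l k)) z)"
      by (rule suminf_finite) (use N in auto)
    also have "\<dots> = of_nat (card {k. z \<in> cube (\<zeta> k) (5/4 * l k)})" by simp
    also have "\<dots> \<le> of_nat N" using N(2)[of z] by (simp only: of_nat_le_iff)
    finally show ?thesis .
  qed
  then show "\<exists>N. \<forall>z. (\<Sum>k. indicator (cube (\<zeta> k) (5/4 * l k)) z :: ennreal) \<le> of_nat N" by blast
  have "\<exists>c>0. \<exists>C>0. \<forall>k. c * setdist (cube (\<zeta> k) (l k)) (frontier upper_half) \<le> diameter (cube (\<zeta> k) (l k))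
      \<and> diameter (cube (\<zeta> k) (l k)) \<le> C * setdist (cube (\<zeta> k) (l k)) (frontier upper_half)"
    using W by (simp only: whitney_decomposition_def)
  then obtain c where c: "0 < c" "\<And>k. c * setdist (cube (\<zeta> k) (l k)) (frontier upper_half) \<le> diameter (cube (\<zeta> k) (l k))"
    by metis
  define D where "D = real DIM((real^'n) \<times> real)"
  \<comment> \<open>The distance from the cube to the boundary is at least
    \<open>snd (\<zeta> k) - l k / 2\<close>, its diameter is at most \<open>2 * D * l k\<close>,
    and the Whitney condition compares the two.\<close>
  have "snd (\<zeta> k) \<le> (1 / 2 + 2 * D / c) * l k" for k
  proof -
    have fr: "snd w \<le> 0" if "w \<in> frontier upper_half" for w :: "(real^'n) \<times> real"
    proof -
      have "w \<notin> upper_half" using that by (simp add: frontier_def interior_open[OF open_upper_half])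
      then show ?thesis by (simp add: upper_half_def)
    qed
    \<comment> \<open>Distances to the empty set are 0 by convention, so a lower bound for
      \<open>setdist\<close> requires a nonempty frontier.\<close>
    have nonempty: "frontier (upper_half :: ((real^'n) \<times> real) set) \<noteq> {}"
    proof
      assume "frontier (upper_half :: ((real^'n) \<times> real) set) = {}"
      then have "(upper_half :: ((real^'n) \<times> real) set) = {} \<or> (upper_half :: ((real^'n) \<times> real) set) = UNIV"
        by (simp add: frontier_eq_empty)
      moreover have "(0, 1) \<in> (upper_half :: ((real^'n) \<times> real) set)" "(0, -1) \<notin> (upper_half :: ((real^'n) \<times> real) set)"
        by (auto simp: upper_half_def)
      ultimately show False by auto
    qed
    have "\<zeta> k \<in> cube (\<zeta> k) (l k)" using l[of k] by (simp add: cube_def)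
    then have "snd (\<zeta> k) - l k / 2 \<le> setdist (cube (\<zeta> k) (l k)) (frontier upper_half)"
    proof (intro le_setdistI nonempty)
      fix z w :: "(real^'n) \<times> real" assume z: "z \<in> cube (\<zeta> k) (l k)" and w: "w \<in> frontier upper_half"
      have "\<bar>snd z - snd (\<zeta> k)\<bar> \<le> l k / 2"
        using z unfolding cube_def Basis_prod_def by (simp add: ball_Un inner_prod_def)
      moreover have "snd z - snd w \<le> dist z w"
        using dist_snd_le[of z w] by (simp add: dist_real_def)
      ultimately show "snd (\<zeta> k) - l k / 2 \<le> dist z w" using fr[OF w] by linarith
    qed auto
    moreover have "diameter (cube (\<zeta> k) (l k)) \<le> 2 * D * l k"
    proof (rule diameter_le)
      fix z w assume zw: "z \<in> cube (\<zeta> k) (l k)" "w \<in> cube (\<zeta> k) (l k)"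
      have "\<bar>(z - w) \<bullet> b\<bar> \<le> 2 * l k" if b: "b \<in> Basis" for b
      proof -
        have "\<bar>(z - \<zeta> k) \<bullet> b\<bar> \<le> l k / 2" "\<bar>(w - \<zeta> k) \<bullet> b\<bar> \<le> l k / 2"
          using zw b by (auto simp: cube_def)
        then show ?thesis using l[of k] unfolding inner_diff_left by linarith
      qed
      then have "norm (z - w) \<le> D * (2 * l k)"
        unfolding D_def by (rule norm_le_of_components)
      then show "norm (z - w) \<le> 2 * D * l k" by simp
    qed (use l[of k] in \<open>auto simp: D_def\<close>)
    ultimately have "c * (snd (\<zeta> k) - l k / 2) \<le> 2 * D * l k"
      using c(2)[of k] mult_left_mono[of "snd (\<zeta> k) - l k / 2" "setdist (cube (\<zeta> k) (l k)) (frontier upper_half)" c] c(1) by linarith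
    then show ?thesis using c(1) by (simp add: field_simps)
  qed
  moreover have "0 < 1 / 2 + 2 * D / c" using c(1) by (simp add: D_def add_pos_nonneg)
  ultimately show "\<exists>A>0. \<forall>k. snd (\<zeta> k) \<le> A * l k" by blast
qed

text \<open>The sign of \<open>e\<close> decides which of the two comparisons is used. Adding both
  constants gives one bound for the application, where \<open>e\<close> is
  \<open>\<alpha> * q - 1\<close> and may have either sign.\<close>

lemma powr_le_of_comparable:
  fixes c C e t \<eta> :: real
  assumes "0 < c" "0 < C" "0 < \<eta>" "c * \<eta> \<le> t" "t \<le> C * \<eta>"
  shows "\<eta> powr e \<le> (c powr - e + C powr - e) * t powr e"
proof -
  have t: "0 < t" using assms mult_pos_pos[of c \<eta>] by linarith
  have nn: "0 \<le> c powr - e * t powr e" "0 \<le> C powr - e * t powr e" by auto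
  show ?thesis
  proof (cases "0 \<le> e")
    case True
    have "\<eta> \<le> t / c" using assms by (simp add: field_simps)
    then have "\<eta> powr e \<le> (t / c) powr e" using assms True by (intro powr_mono2) auto
    also have "\<dots> = c powr - e * t powr e"
      using assms t by (simp add: powr_divide powr_minus field_simps)
    finally show ?thesis using nn unfolding distrib_right by linarith
  next
    case False
    have "t / C \<le> \<eta>" using assms by (simp add: field_simps)
    then have "\<eta> powr e \<le> (t / C) powr e" using assms t False by (intro powr_mono2') auto
    also have "\<dots> = C powr - e * t powr e"
      using assms t by (simp add: powr_divide powr_minus field_simps)
    finally show ?thesis using nn unfolding distrib_right by linarith
  qed
qed

section \<open>Iterated integrals and extension by zero\<close>

lemma nn_integral_lborel_prod:
  fixes F :: "'a::euclidean_space \<times> 'b::euclidean_space \<Rightarrow> ennreal"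
  assumes "F \<in> borel_measurable borel"
  shows "(\<integral>\<^sup>+z. F z \<partial>lborel) = (\<integral>\<^sup>+x. \<integral>\<^sup>+t. F (x, t) \<partial>lborel \<partial>lborel)"
    and "(\<integral>\<^sup>+z. F z \<partial>lborel) = (\<integral>\<^sup>+t. \<integral>\<^sup>+x. F (x, t) \<partial>lborel \<partial>lborel)"
proof -
  have F: "F \<in> borel_measurable (lborel \<Otimes>\<^sub>M lborel)" using assms by (simp add: lborel_prod)
  show "(\<integral>\<^sup>+z. F z \<partial>lborel) = (\<integral>\<^sup>+x. \<integral>\<^sup>+t. F (x, t) \<partial>lborel \<partial>lborel)"
    using lborel.nn_integral_fst[OF F] by (simp add: lborel_prod)
  show "(\<integral>\<^sup>+z. F z \<partial>lborel) = (\<integral>\<^sup>+t. \<integral>\<^sup>+x. F (x, t) \<partial>lborel \<partial>lborel)"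
    using lborel_pair.nn_integral_snd[OF F] by (simp add: lborel_prod)
qed

text \<open>The values off the half space are arbitrary, so \<open>f\<close> itself need not be Borel measurable.\<close>

definition zero_ext :: "((real^'n::finite) \<times> real \<Rightarrow> real) \<Rightarrow> (real^'n) \<times> real \<Rightarrow> real" where
  "zero_ext f z = (if z \<in> upper_half then f z else 0)"

lemma zero_ext_harmonic: "harmonic_on f upper_half \<Longrightarrow> harmonic_on (zero_ext f) upper_half"
proof -
  assume "harmonic_on f upper_half"
  then obtain g h where g: "\<And>z. z \<in> upper_half \<Longrightarrow> (f has_derivative (\<lambda>v. g z \<bullet> v)) (at z)"
    and h: "\<And>z. z \<in> upper_half \<Longrightarrow> (g has_derivative blinfun_apply (h z)) (at z)" "continuous_on upper_half h"
      "\<And>z. z \<in> upper_half \<Longrightarrow> (\<Sum>b\<in>Basis. blinfun_apply (h z) b \<bullet> b) = 0"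
    unfolding harmonic_on_def by blast
  have "(zero_ext f has_derivative (\<lambda>v. g z \<bullet> v)) (at z)" if "z \<in> upper_half" for z
    by (rule has_derivative_transform_within_open[OF g[OF that] open_upper_half that]) (simp add: zero_ext_def)
  then show ?thesis unfolding harmonic_on_def using h by blast
qed

lemma zero_ext_measurable:
  assumes "harmonic_on f upper_half"
  shows "zero_ext f \<in> borel_measurable borel"
proof -
  have "(\<lambda>z. if z \<in> upper_half then f z else 0) \<in> borel_measurable borel"
    by (intro borel_measurable_continuous_on_if harmonic_on_continuous[OF assms]) (auto intro: borel_open open_upper_half)
  then show ?thesis by (simp add: zero_ext_def[abs_def])
qed

lemma zero_ext_apply: "0 < t \<Longrightarrow> zero_ext f (x, t) = f (x, t)"
  by (simp add: zero_ext_def upper_half_def)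

lemma B_norm_zero_ext: "B_norm p q \<alpha> (zero_ext f) = B_norm p q \<alpha> f"
proof -
  have "M_mean p (zero_ext f) t = M_mean p f t" if "0 < t" for t
    using that by (simp add: M_mean_def zero_ext_apply)
  then show ?thesis
    unfolding B_norm_def
    by (intro arg_cong2[where f=epow] nn_integral_cong refl) (auto simp: indicator_def)
qed

lemma F_norm_zero_ext: "F_norm p q \<alpha> (zero_ext f) = F_norm p q \<alpha> f"
  unfolding F_norm_def
  by (intro arg_cong2[where f=epow] nn_integral_cong refl) (auto simp: indicator_def zero_ext_apply)

lemma measurable_section:
  fixes F :: "'a::euclidean_space \<times> 'b::euclidean_space \<Rightarrow> 'c::topological_space"
  assumes "F \<in> borel_measurable borel"
  shows "(\<lambda>t. F (x, t)) \<in> borel_measurable borel" "(\<lambda>x. F (x, t)) \<in> borel_measurable borel"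
  by (rule measurable_compose[OF _ assms], intro borel_measurable_continuous_onI continuous_intros)+

lemma measurable_section_integral:
  fixes F :: "'a::euclidean_space \<times> 'b::euclidean_space \<Rightarrow> ennreal"
  assumes "F \<in> borel_measurable borel"
  shows "(\<lambda>x. \<integral>\<^sup>+t. F (x, t) \<partial>lborel) \<in> borel_measurable borel"
    "(\<lambda>t. \<integral>\<^sup>+x. F (x, t) \<partial>lborel) \<in> borel_measurable borel"
proof -
  have F: "F \<in> borel_measurable (lborel \<Otimes>\<^sub>M lborel)" using assms by (simp add: lborel_prod)
  show "(\<lambda>x. \<integral>\<^sup>+t. F (x, t) \<partial>lborel) \<in> borel_measurable borel"
    using lborel.borel_measurable_nn_integral_fst[OF F] by simp
  have "(\<lambda>z. F (snd z, fst z)) \<in> borel_measurable borel"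
    by (rule measurable_compose[OF _ assms], intro borel_measurable_continuous_onI continuous_intros)
  then have "(\<lambda>z. F (snd z, fst z)) \<in> borel_measurable (lborel \<Otimes>\<^sub>M lborel)" by (simp add: lborel_prod)
  from lborel.borel_measurable_nn_integral_fst[OF this]
  show "(\<lambda>t. \<integral>\<^sup>+x. F (x, t) \<partial>lborel) \<in> borel_measurable borel" by simp
qed

section \<open>Energies of Whitney cubes\<close>

lemma measurable_snd_borel: "(snd :: 'a::euclidean_space \<times> 'b::euclidean_space \<Rightarrow> 'b) \<in> borel_measurable borel"
  by (intro borel_measurable_continuous_onI continuous_intros)

text \<open>The density common to both scales: when \<open>s = q\<close>, the energy of a Borel
  function over the half space is the q-th power of its B norm and of its F norm.\<close>

definition energy :: "real \<Rightarrow> real \<Rightarrow> ((real^'n::finite) \<times> real \<Rightarrow> real) \<Rightarrow> ((real^'n) \<times> real) set \<Rightarrow> ennreal" where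
  "energy q \<alpha> g Q = (\<integral>\<^sup>+z\<in>Q. ennreal (\<bar>g z\<bar> powr q * snd z powr (\<alpha> * q - 1)) \<partial>lborel)"

text \<open>The mean value estimate for the q-th power, on a ball of radius comparable to the
  height, is multiplied by a power of the height to bring in the weight of the energy, and then
  raised to the power s / q. The last factor on the right is the one that \<open>jensen_cube\<close>
  absorbs; multiplying by it turns the exponent on the left into n + \<alpha> s.\<close>

lemma powr_le_energy:
  fixes \<zeta> :: "nat \<Rightarrow> (real^'n::finite) \<times> real"
  assumes W: "whitney_decomposition \<zeta> l" and q: "0 < q" and s: "0 < s"
  obtains K where "0 \<le> K" "\<And>f k z. \<lbrakk>harmonic_on f upper_half; z \<in> cube (\<zeta> k) (l k)\<rbrakk> \<Longrightarrow>
    ennreal (\<bar>f z\<bar> powr s * snd (\<zeta> k) powr (real CARD('n) + \<alpha> * s))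
      \<le> ennreal K * (epow (energy q \<alpha> (zero_ext f) (cube (\<zeta> k) (5/4 * l k))) (s / q) * ennreal (snd (\<zeta> k) powr (real CARD('n) * (1 - s / q))))"
proof -
  define N where "N = DIM((real^'n) \<times> real)"
  define e where "e = \<alpha> * q - 1"
  define r where "r = s / q"
  obtain K0 where K0: "0 < K0" and av: "\<And>(f :: (real^'n) \<times> real \<Rightarrow> real) S z R. \<lbrakk>harmonic_on f S; open S; f \<in> borel_measurable borel; 0 < R; cball z R \<subseteq> S\<rbrakk>
      \<Longrightarrow> ennreal (\<bar>f z\<bar> powr q) \<le> ennreal (K0 / R ^ N) * (\<integral>\<^sup>+y\<in>cball z R. ennreal (\<bar>f y\<bar> powr q) \<partial>lborel)"
    unfolding N_def using harmonic_powr_le_average[OF q] by blast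
  obtain A where A: "0 < A" "\<And>k. snd (\<zeta> k) \<le> A * l k" using whitney_side[OF W] by blast
  obtain c C where cC: "0 < c" "0 < C" "\<And>k z. z \<in> cube (\<zeta> k) (5/4 * l k) \<Longrightarrow> c * snd (\<zeta> k) \<le> snd z \<and> snd z \<le> C * snd (\<zeta> k)"
    using whitney_height[OF W] by blast
  define K1 where "K1 = c powr - e + C powr - e"
  define K2 where "K2 = K0 * (8 * A) ^ N * K1"
  have K2: "0 \<le> K2" using K0 A by (simp add: K2_def K1_def)
  show thesis
  proof (rule that)
    show "0 \<le> K2 powr r" by simp
    fix f :: "(real^'n) \<times> real \<Rightarrow> real" and k z
    assume f: "harmonic_on f upper_half" and z: "z \<in> cube (\<zeta> k) (l k)"
    define g where "g = zero_ext f"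
    define \<eta> where "\<eta> = snd (\<zeta> k)"
    have gm[measurable]: "g \<in> borel_measurable borel" using zero_ext_measurable[OF f] by (simp add: g_def)
    have \<eta>: "0 < \<eta>" and l: "0 < l k" using whitney_pos[OF W] by (auto simp: \<eta>_def)
    let ?Q = "cube (\<zeta> k) (5/4 * l k)"
    \<comment> \<open>Half the side of the enlarged cube is 5/8 of \<open>l k\<close>, which leaves
      a margin of 1/8.\<close>
    have sub: "cball z (l k / 8) \<subseteq> ?Q" by (rule cball_subset_cube[OF z]) simp
    have "z \<in> upper_half" using z whitney_sub(1)[OF W] by blast
    then have fz: "f z = g z" by (simp add: g_def zero_ext_def)
    have "ennreal (\<bar>g z\<bar> powr q) \<le> ennreal (K0 / (l k / 8) ^ N) * (\<integral>\<^sup>+y\<in>cball z (l k / 8). ennreal (\<bar>g y\<bar> powr q) \<partial>lborel)"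
      using sub whitney_sub(2)[OF W, of k] l
      by (intro av[where S=upper_half]) (auto simp: g_def zero_ext_harmonic[OF f] zero_ext_measurable[OF f] open_upper_half)
    also have "\<dots> \<le> ennreal (K0 * (8 * A) ^ N / \<eta> ^ N) * (\<integral>\<^sup>+y\<in>?Q. ennreal (\<bar>g y\<bar> powr q) \<partial>lborel)"
    proof (intro mult_mono ennreal_leI nn_integral_mono)
      have "\<eta> / (8 * A) \<le> l k / 8" using A(2)[of k] A(1) by (simp add: \<eta>_def field_simps)
      then have "(\<eta> / (8 * A)) ^ N \<le> (l k / 8) ^ N" using \<eta> A by (intro power_mono) auto
      moreover have "0 < (\<eta> / (8 * A)) ^ N" using \<eta> A by simp
      ultimately have "K0 / (l k / 8) ^ N \<le> K0 / (\<eta> / (8 * A)) ^ N" using K0 by (intro divide_left_mono mult_pos_pos) auto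
      then show "K0 / (l k / 8) ^ N \<le> K0 * (8 * A) ^ N / \<eta> ^ N" by (simp add: power_divide)
    qed (use sub in \<open>auto simp: indicator_def\<close>)
    finally have "ennreal (\<eta> powr (e + real N)) * ennreal (\<bar>g z\<bar> powr q) \<le> ennreal (\<eta> powr (e + real N)) * (ennreal (K0 * (8 * A) ^ N / \<eta> ^ N) * (\<integral>\<^sup>+y\<in>?Q. ennreal (\<bar>g y\<bar> powr q) \<partial>lborel))"
      by (intro mult_left_mono) auto
    also have "\<dots> = ennreal (K0 * (8 * A) ^ N) * (ennreal (\<eta> powr e) * (\<integral>\<^sup>+y\<in>?Q. ennreal (\<bar>g y\<bar> powr q) \<partial>lborel))"
    proof -
      have "\<eta> powr (e + real N) * (K0 * (8 * A) ^ N / \<eta> ^ N) = K0 * (8 * A) ^ N * \<eta> powr e"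
        using \<eta> by (simp add: powr_add powr_realpow)
      moreover have "ennreal (\<eta> powr (e + real N)) * ennreal (K0 * (8 * A) ^ N / \<eta> ^ N) = ennreal (\<eta> powr (e + real N) * (K0 * (8 * A) ^ N / \<eta> ^ N))"
        using K0 A \<eta> by (intro ennreal_mult[symmetric]) auto
      moreover have "ennreal (K0 * (8 * A) ^ N) * ennreal (\<eta> powr e) = ennreal (K0 * (8 * A) ^ N * \<eta> powr e)"
        using K0 A by (intro ennreal_mult[symmetric]) auto
      ultimately show ?thesis by (simp only: mult.assoc[symmetric])
    qed
    also have "ennreal (\<eta> powr e) * (\<integral>\<^sup>+y\<in>?Q. ennreal (\<bar>g y\<bar> powr q) \<partial>lborel) = (\<integral>\<^sup>+y. ennreal (\<eta> powr e) * (ennreal (\<bar>g y\<bar> powr q) * indicator ?Q y) \<partial>lborel)"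
      by (rule nn_integral_cmult[symmetric]) measurable
    also have "\<dots> \<le> (\<integral>\<^sup>+y. ennreal K1 * (ennreal (\<bar>g y\<bar> powr q * snd y powr e) * indicator ?Q y) \<partial>lborel)"
    proof (rule nn_integral_mono)
      fix y
      show "ennreal (\<eta> powr e) * (ennreal (\<bar>g y\<bar> powr q) * indicator ?Q y) \<le> ennreal K1 * (ennreal (\<bar>g y\<bar> powr q * snd y powr e) * indicator ?Q y)"
      proof (cases "y \<in> ?Q")
        case True
        have "\<eta> powr e \<le> K1 * snd y powr e"
          unfolding K1_def using cC(3)[OF True] by (intro powr_le_of_comparable cC \<eta>) (auto simp: \<eta>_def)
        then have "\<eta> powr e * \<bar>g y\<bar> powr q \<le> K1 * snd y powr e * \<bar>g y\<bar> powr q" by (rule mult_right_mono) simp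
        then have "ennreal (\<eta> powr e * \<bar>g y\<bar> powr q) \<le> ennreal (K1 * (\<bar>g y\<bar> powr q * snd y powr e))"
          by (intro ennreal_leI) (simp add: mult_ac)
        then show ?thesis using True by (simp add: ennreal_mult K1_def)
      qed simp
    qed
    also have "\<dots> = ennreal K1 * energy q \<alpha> g ?Q"
    proof -
      note measurable_snd_borel[measurable]
      have "(\<lambda>y. ennreal (\<bar>g y\<bar> powr q * snd y powr e) * indicator ?Q y) \<in> borel_measurable borel" by simp
      then show ?thesis unfolding energy_def e_def by (intro nn_integral_cmult) simp
    qed
    finally have "ennreal (\<eta> powr (e + real N)) * ennreal (\<bar>g z\<bar> powr q) \<le> ennreal (K0 * (8 * A) ^ N) * (ennreal K1 * energy q \<alpha> g ?Q)"
      by (simp add: mult_left_mono)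
    also have "\<dots> = ennreal K2 * energy q \<alpha> g ?Q"
      using K0 A by (simp add: K2_def K1_def ennreal_mult mult.assoc)
    finally have "epow (ennreal (\<eta> powr (e + real N)) * ennreal (\<bar>g z\<bar> powr q)) r \<le> epow (ennreal K2 * energy q \<alpha> g ?Q) r"
      using q s by (intro epow_mono) (auto simp: r_def)
    then have *: "ennreal (\<eta> powr ((e + real N) * r)) * ennreal (\<bar>g z\<bar> powr s) \<le> ennreal (K2 powr r) * epow (energy q \<alpha> g ?Q) r"
      using q K2 by (simp add: epow_mult epow_ennreal powr_powr r_def)
    define u where "u = real CARD('n) * (1 - r)"
    \<comment> \<open>With N = n + 1 the left side is (\<alpha> q + n) s / q + n (1 - s /
      q).\<close>
    have "(e + real N) * r + u = real CARD('n) + \<alpha> * s"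
      using q by (simp add: e_def N_def u_def r_def field_simps)
    then have "\<eta> powr (real CARD('n) + \<alpha> * s) = \<eta> powr ((e + real N) * r) * \<eta> powr u"
      unfolding powr_add[symmetric] by simp
    then have "ennreal (\<bar>f z\<bar> powr s * \<eta> powr (real CARD('n) + \<alpha> * s))
        = ennreal (\<eta> powr ((e + real N) * r)) * ennreal (\<bar>g z\<bar> powr s) * ennreal (\<eta> powr u)"
      by (simp add: fz ennreal_mult mult_ac)
    also have "\<dots> \<le> ennreal (K2 powr r) * epow (energy q \<alpha> g ?Q) r * ennreal (\<eta> powr u)"
      by (rule mult_right_mono[OF *]) simp
    finally show "ennreal (\<bar>f z\<bar> powr s * snd (\<zeta> k) powr (real CARD('n) + \<alpha> * s))
      \<le> ennreal (K2 powr r) * (epow (energy q \<alpha> (zero_ext f) ?Q) (s / q) * ennreal (snd (\<zeta> k) powr (real CARD('n) * (1 - s / q))))"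
      by (simp only: mult.assoc \<eta>_def g_def u_def r_def)
  qed
qed

text \<open>The enlarged cube has volume at most (5/2 \<eta>)^n, so Jensen costs a constant times
  \<eta>^(n (r - 1)), and the power of \<eta> on the left cancels this.\<close>

lemma jensen_cube:
  fixes h :: "real^'n::finite \<Rightarrow> ennreal"
  assumes h: "h \<in> borel_measurable borel" and 0: "\<And>x. x \<notin> cube \<xi> (5/4 * l) \<Longrightarrow> h x = 0"
    and r: "1 \<le> r" and l: "0 < l" "l \<le> 2 * \<eta>"
  shows "epow (\<integral>\<^sup>+x. h x \<partial>lborel) r * ennreal (\<eta> powr (real CARD('n) * (1 - r)))
    \<le> ennreal (2 powr r * (5/2) powr (real CARD('n) * (r - 1))) * (\<integral>\<^sup>+x. epow (h x) r \<partial>lborel)"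
proof -
  let ?Q = "cube \<xi> (5/4 * l)" and ?n = "real CARD('n)"
  have \<eta>: "0 < \<eta>" using l by simp
  have e: "h x * indicator ?Q x = h x" "epow (h x) r * indicator ?Q x = epow (h x) r" for x
    using 0 by (auto simp: indicator_def)
  have "emeasure lborel ?Q \<le> ennreal ((5/2 * \<eta>) ^ CARD('n))"
    using l by (auto simp: emeasure_cube intro!: ennreal_leI power_mono)
  then have "epow (\<integral>\<^sup>+x\<in>?Q. h x \<partial>lborel) r \<le> ennreal (2 powr r) * ennreal (((5/2 * \<eta>) ^ CARD('n)) powr (r - 1)) * (\<integral>\<^sup>+x\<in>?Q. epow (h x) r \<partial>lborel)"
    by (intro jensen_set r) (use h in auto)
  then have "epow (\<integral>\<^sup>+x. h x \<partial>lborel) r \<le> ennreal (2 powr r) * ennreal (((5/2 * \<eta>) ^ CARD('n)) powr (r - 1)) * (\<integral>\<^sup>+x. epow (h x) r \<partial>lborel)"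
    unfolding e .
  then have "epow (\<integral>\<^sup>+x. h x \<partial>lborel) r * ennreal (\<eta> powr (?n * (1 - r)))
      \<le> ennreal (2 powr r) * ennreal (((5/2 * \<eta>) ^ CARD('n)) powr (r - 1)) * (\<integral>\<^sup>+x. epow (h x) r \<partial>lborel) * ennreal (\<eta> powr (?n * (1 - r)))"
    by (rule mult_right_mono) simp
  also have "\<dots> = ennreal (2 powr r * (5/2) powr (?n * (r - 1))) * (\<integral>\<^sup>+x. epow (h x) r \<partial>lborel)"
  proof -
    have "((5/2 * \<eta>) ^ CARD('n)) powr (r - 1) = (5/2 * \<eta>) powr (?n * (r - 1))"
      using \<eta> by (simp add: powr_powr flip: powr_realpow)
    also have "\<dots> = (5/2) powr (?n * (r - 1)) * \<eta> powr (?n * (r - 1))"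
      using \<eta> by (intro powr_mult)
    finally have "((5/2 * \<eta>) ^ CARD('n)) powr (r - 1) * \<eta> powr (?n * (1 - r))
        = (5/2) powr (?n * (r - 1)) * (\<eta> powr (?n * (r - 1)) * \<eta> powr (?n * (1 - r)))" by simp
    also have "\<eta> powr (?n * (r - 1)) * \<eta> powr (?n * (1 - r)) = 1"
      using \<eta> unfolding powr_add[symmetric] by (simp add: algebra_simps)
    finally have x: "((5/2 * \<eta>) ^ CARD('n)) powr (r - 1) * \<eta> powr (?n * (1 - r)) = (5/2) powr (?n * (r - 1))" by simp
    have "ennreal (2 powr r) * ennreal (((5/2 * \<eta>) ^ CARD('n)) powr (r - 1)) * I * ennreal (\<eta> powr (?n * (1 - r)))
        = ennreal (2 powr r * (((5/2 * \<eta>) ^ CARD('n)) powr (r - 1) * \<eta> powr (?n * (1 - r)))) * I" for I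
      by (simp add: ennreal_mult mult_ac)
    then show ?thesis unfolding x .
  qed
  finally show ?thesis .
qed

lemma overlap_sum_le:
  fixes F :: "(real^'n::finite) \<times> real \<Rightarrow> ennreal"
  assumes W: "whitney_decomposition \<zeta> l"
    and N: "\<And>z. (\<Sum>k. indicator (cube (\<zeta> k) (5/4 * l k)) z :: ennreal) \<le> of_nat N"
  shows "(\<Sum>k. F (x, t) * indicator (cube (\<zeta> k) (5/4 * l k)) (x, t)) \<le> of_nat N * (F (x, t) * indicator {0<..} t)"
proof (cases "0 < t")
  case True
  have "(\<Sum>k. F (x, t) * indicator (cube (\<zeta> k) (5/4 * l k)) (x, t)) = F (x, t) * (\<Sum>k. indicator (cube (\<zeta> k) (5/4 * l k)) (x, t))"
    by simp
  also have "\<dots> \<le> F (x, t) * of_nat N" by (intro mult_left_mono N) simp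
  finally show ?thesis using True by (simp add: mult.commute)
next
  case False
  then have "(x, t) \<notin> cube (\<zeta> k) (5/4 * l k)" for k
    using whitney_sub(2)[OF W, of k] by (auto simp: upper_half_def)
  then show ?thesis by simp
qed

text \<open>The slice energy \<open>E k x\<close> is supported in the projection of the k-th cube,
  and Jensen moves the power r inside the integral over x. There the sum of r-th powers is at most
  the r-th power of the sum, and bounded overlap compares that sum with the inner integral of the F
  norm.\<close>

lemma sum_energy_le_F_norm:
  fixes \<zeta> :: "nat \<Rightarrow> (real^'n::finite) \<times> real"
  assumes W: "whitney_decomposition \<zeta> l" and q: "0 < q" and s: "q \<le> s"
  shows "\<exists>K\<ge>0. \<forall>g. g \<in> borel_measurable borel \<longrightarrow>
    (\<Sum>k. epow (energy q \<alpha> g (cube (\<zeta> k) (5/4 * l k))) (s / q) * ennreal (snd (\<zeta> k) powr (real CARD('n) * (1 - s / q))))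
      \<le> ennreal K * epow (F_norm s q \<alpha> g) s"
proof -
  define r where "r = s / q"
  have r: "1 \<le> r" using q s by (simp add: r_def)
  define n where "n = real CARD('n)"
  define K where "K = 2 powr r * (5/2) powr (n * (r - 1))"
  have K: "0 \<le> K" by (simp add: K_def)
  obtain N where N: "\<And>z. (\<Sum>k. indicator (cube (\<zeta> k) (5/4 * l k)) z :: ennreal) \<le> of_nat N"
    using whitney_overlap[OF W] by blast
  show ?thesis
  proof (intro exI conjI allI impI)
    show "0 \<le> K * real N powr r" using K by simp
    fix g :: "(real^'n) \<times> real \<Rightarrow> real" assume [measurable]: "g \<in> borel_measurable borel"
    note measurable_snd_borel[measurable]
    let ?Q = "\<lambda>k. cube (\<zeta> k) (5/4 * l k)"
    define \<phi> where "\<phi> z = ennreal (\<bar>g z\<bar> powr q * snd z powr (\<alpha> * q - 1))" for z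
    have \<phi>[measurable]: "\<phi> \<in> borel_measurable borel" unfolding \<phi>_def by measurable
    have \<phi>k: "(\<lambda>z. \<phi> z * indicator (?Q k) z) \<in> borel_measurable borel" for k by simp
    define E where "E k x = (\<integral>\<^sup>+t. \<phi> (x, t) * indicator (?Q k) (x, t) \<partial>lborel)" for k x
    have Em[measurable]: "E k \<in> borel_measurable borel" for k
      unfolding E_def using measurable_section_integral(1)[OF \<phi>k] .
    have en: "energy q \<alpha> g (?Q k) = (\<integral>\<^sup>+x. E k x \<partial>lborel)" for k
      unfolding energy_def E_def \<phi>_def[symmetric] by (rule nn_integral_lborel_prod(1)[OF \<phi>k])
    have E0: "E k x = 0" if "x \<notin> cube (fst (\<zeta> k)) (5/4 * l k)" for k x
    proof -
      have "(x, t) \<notin> ?Q k" for t using that mem_cube_Pair_iff[of x t "fst (\<zeta> k)" "snd (\<zeta> k)"] by simp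
      then show ?thesis by (simp add: E_def)
    qed
    have "(\<Sum>k. epow (energy q \<alpha> g (?Q k)) r * ennreal (snd (\<zeta> k) powr (n * (1 - r))))
        \<le> (\<Sum>k. ennreal K * (\<integral>\<^sup>+x. epow (E k x) r \<partial>lborel))"
      unfolding en K_def n_def
      by (intro suminf_le jensen_cube[OF Em E0 r]) (auto simp: whitney_pos[OF W])
    also have "\<dots> = ennreal K * (\<integral>\<^sup>+x. (\<Sum>k. epow (E k x) r) \<partial>lborel)"
      by (subst nn_integral_suminf) auto
    also have "\<dots> \<le> ennreal K * (\<integral>\<^sup>+x. epow (of_nat N) r * epow (\<integral>\<^sup>+t\<in>{0<..}. \<phi> (x, t) \<partial>lborel) r \<partial>lborel)"
    proof (intro mult_left_mono nn_integral_mono)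
      fix x
      have [measurable]: "(\<lambda>t. \<phi> (x, t)) \<in> borel_measurable borel" by (rule measurable_section(1)[OF \<phi>])
      have "(\<Sum>k. epow (E k x) r) \<le> epow (\<Sum>k. E k x) r" by (rule suminf_epow_le[OF r])
      also have "(\<Sum>k. E k x) = (\<integral>\<^sup>+t. (\<Sum>k. \<phi> (x, t) * indicator (?Q k) (x, t)) \<partial>lborel)"
        unfolding E_def by (rule nn_integral_suminf[symmetric]) (use measurable_section(1)[OF \<phi>k] in simp)
      also have "\<dots> \<le> (\<integral>\<^sup>+t. of_nat N * (\<phi> (x, t) * indicator {0<..} t) \<partial>lborel)"
        by (intro nn_integral_mono overlap_sum_le[OF W N])
      also have "\<dots> = of_nat N * (\<integral>\<^sup>+t\<in>{0<..}. \<phi> (x, t) \<partial>lborel)"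
        by (rule nn_integral_cmult) measurable
      finally show "(\<Sum>k. epow (E k x) r) \<le> epow (of_nat N) r * epow (\<integral>\<^sup>+t\<in>{0<..}. \<phi> (x, t) \<partial>lborel) r"
        using r by (simp add: epow_mult epow_mono)
    qed auto
    also have "\<dots> = ennreal (K * real N powr r) * epow (F_norm s q \<alpha> g) s"
    proof -
      have [measurable]: "(\<lambda>x. \<integral>\<^sup>+t\<in>{0<..}. \<phi> (x, t) \<partial>lborel) \<in> borel_measurable borel"
      proof -
        have "(\<lambda>z. \<phi> z * indicator {0<..} (snd z)) \<in> borel_measurable borel" by measurable
        from measurable_section_integral(1)[OF this] show ?thesis by simp
      qed
      have "epow (F_norm s q \<alpha> g) s = (\<integral>\<^sup>+x. epow (\<integral>\<^sup>+t\<in>{0<..}. \<phi> (x, t) \<partial>lborel) r \<partial>lborel)"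
        using q s by (simp add: F_norm_def epow_epow \<phi>_def r_def)
      moreover have "epow (of_nat N) r = ennreal (real N powr r)"
        using epow_ennreal[of "real N" r] by (simp add: ennreal_of_nat_eq_real_of_nat)
      ultimately show ?thesis
        using K by (simp add: nn_integral_cmult ennreal_mult mult.assoc)
    qed
    finally show "(\<Sum>k. epow (energy q \<alpha> g (?Q k)) (s / q) * ennreal (snd (\<zeta> k) powr (real CARD('n) * (1 - s / q))))
      \<le> ennreal (K * real N powr r) * epow (F_norm s q \<alpha> g) s"
      by (simp only: r_def n_def)
  qed
qed

text \<open>Here x is integrated first. Jensen in x for fixed t replaces the exponent q by s and
  leads to the majorant \<open>h k t\<close>. Minkowski moves the l^r sum over k inside the integral
  over t, where bounded overlap compares the sum of the slices \<open>H s k t\<close> with the full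
  integral over x.\<close>

lemma sum_energy_le_B_norm:
  fixes \<zeta> :: "nat \<Rightarrow> (real^'n::finite) \<times> real"
  assumes W: "whitney_decomposition \<zeta> l" and q: "0 < q" and s: "q \<le> s"
  shows "\<exists>K\<ge>0. \<forall>g. g \<in> borel_measurable borel \<longrightarrow>
    (\<Sum>k. epow (energy q \<alpha> g (cube (\<zeta> k) (5/4 * l k))) (s / q) * ennreal (snd (\<zeta> k) powr (real CARD('n) * (1 - s / q))))
      \<le> ennreal K * epow (B_norm s q \<alpha> g) s"
proof -
  define r where "r = s / q"
  have r: "1 \<le> r" using q s by (simp add: r_def)
  define n where "n = real CARD('n)"
  define K where "K = 2 powr r * (5/2) powr (n * (r - 1))"
  have K: "0 \<le> K" by (simp add: K_def)
  obtain N where N: "\<And>z. (\<Sum>k. indicator (cube (\<zeta> k) (5/4 * l k)) z :: ennreal) \<le> of_nat N"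
    using whitney_overlap[OF W] by blast
  show ?thesis
  proof (intro exI conjI allI impI)
    show "0 \<le> 2 powr r * (K * real N)" using K by simp
    fix g :: "(real^'n) \<times> real \<Rightarrow> real" assume [measurable]: "g \<in> borel_measurable borel"
    note measurable_snd_borel[measurable]
    let ?Q = "\<lambda>k. cube (\<zeta> k) (5/4 * l k)"
    define \<phi> where "\<phi> z = ennreal (\<bar>g z\<bar> powr q * snd z powr (\<alpha> * q - 1))" for z
    have \<phi>[measurable]: "\<phi> \<in> borel_measurable borel" unfolding \<phi>_def by measurable
    have \<phi>k: "(\<lambda>z. \<phi> z * indicator (?Q k) z) \<in> borel_measurable borel" for k by simp
    define G where "G p z = ennreal (\<bar>g z\<bar> powr p)" for p z
    have G[measurable]: "G p \<in> borel_measurable borel" for p unfolding G_def by measurable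
    have Gk: "(\<lambda>z. G p z * indicator (?Q k) z) \<in> borel_measurable borel" for k p by simp
    define w where "w t = ennreal (t powr (\<alpha> * q - 1))" for t
    have w[measurable]: "w \<in> borel_measurable borel" unfolding w_def by measurable
    define H where "H p k t = (\<integral>\<^sup>+x. G p (x, t) * indicator (?Q k) (x, t) \<partial>lborel)" for p k t
    have H[measurable]: "H p k \<in> borel_measurable borel" for p k
      unfolding H_def using measurable_section_integral(2)[OF Gk] .
    define h where "h k t = epow (ennreal K * H s k t) (1 / r) * w t" for k t
    have h[measurable]: "h k \<in> borel_measurable borel" for k unfolding h_def by measurable
    define J where "J = (\<integral>\<^sup>+t\<in>{0<..}. epow (\<integral>\<^sup>+x. G s (x, t) \<partial>lborel) (1 / r) * w t \<partial>lborel)"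
    have en: "energy q \<alpha> g (?Q k) = (\<integral>\<^sup>+t. H q k t * w t \<partial>lborel)" for k
    proof -
      have "energy q \<alpha> g (?Q k) = (\<integral>\<^sup>+t. \<integral>\<^sup>+x. \<phi> (x, t) * indicator (?Q k) (x, t) \<partial>lborel \<partial>lborel)"
        unfolding energy_def \<phi>_def[symmetric] by (rule nn_integral_lborel_prod(2)[OF \<phi>k])
      also have "(\<lambda>t. \<integral>\<^sup>+x. \<phi> (x, t) * indicator (?Q k) (x, t) \<partial>lborel) = (\<lambda>t. H q k t * w t)"
      proof
        fix t
        have "(\<integral>\<^sup>+x. \<phi> (x, t) * indicator (?Q k) (x, t) \<partial>lborel) = (\<integral>\<^sup>+x. G q (x, t) * indicator (?Q k) (x, t) * w t \<partial>lborel)"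
          by (simp add: \<phi>_def G_def w_def ennreal_mult mult_ac)
        also have "\<dots> = H q k t * w t"
          unfolding H_def by (rule nn_integral_multc) (use measurable_section(2)[OF Gk] in simp)
        finally show "(\<integral>\<^sup>+x. \<phi> (x, t) * indicator (?Q k) (x, t) \<partial>lborel) = H q k t * w t" .
      qed
      finally show ?thesis .
    qed
    have step: "epow (energy q \<alpha> g (?Q k)) r * ennreal (snd (\<zeta> k) powr (n * (1 - r))) \<le> epow (\<integral>\<^sup>+t. h k t \<partial>lborel) r" for k
    proof -
      define c where "c = ennreal (snd (\<zeta> k) powr (n * (1 - r)))"
      \<comment> \<open>The power of the height enters as an r-th root, because Jensen is used for
        each t under the integral, before the power r is taken.\<close>
      have Hh: "epow c (1 / r) * (H q k t * w t) \<le> h k t" for t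
      proof -
        have "epow (H q k t) r * c \<le> ennreal K * (\<integral>\<^sup>+x. epow (G q (x, t) * indicator (?Q k) (x, t)) r \<partial>lborel)"
          unfolding H_def c_def K_def n_def
        proof (rule jensen_cube[OF _ _ r])
          show "(\<lambda>x. G q (x, t) * indicator (?Q k) (x, t)) \<in> borel_measurable borel"
            by (rule measurable_section(2)[OF Gk])
          show "G q (x, t) * indicator (?Q k) (x, t) = 0" if "x \<notin> cube (fst (\<zeta> k)) (5/4 * l k)" for x
            using that mem_cube_Pair_iff[of x t "fst (\<zeta> k)" "snd (\<zeta> k)"] by simp
        qed (auto simp: whitney_pos[OF W])
        also have "(\<lambda>x. epow (G q (x, t) * indicator (?Q k) (x, t)) r) = (\<lambda>x. G s (x, t) * indicator (?Q k) (x, t))"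
          using q by (auto simp: fun_eq_iff indicator_def G_def epow_ennreal powr_powr r_def)
        also have "(\<integral>\<^sup>+x. G s (x, t) * indicator (?Q k) (x, t) \<partial>lborel) = H s k t" by (simp add: H_def)
        finally have "epow (epow (H q k t) r * c) (1 / r) \<le> epow (ennreal K * H s k t) (1 / r)"
          using r by (intro epow_mono) auto
        then have "H q k t * epow c (1 / r) \<le> epow (ennreal K * H s k t) (1 / r)"
          using r by (simp add: epow_mult[of "epow _ r"] epow_epow)
        then have "H q k t * epow c (1 / r) * w t \<le> h k t"
          unfolding h_def by (rule mult_right_mono) simp
        then show ?thesis by (simp add: mult_ac)
      qed
      have "epow (energy q \<alpha> g (?Q k)) r * c = epow (epow c (1 / r) * energy q \<alpha> g (?Q k)) r"
        using r by (simp add: epow_mult epow_epow mult.commute)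
      also have "epow c (1 / r) * energy q \<alpha> g (?Q k) = (\<integral>\<^sup>+t. epow c (1 / r) * (H q k t * w t) \<partial>lborel)"
        unfolding en by (rule nn_integral_cmult[symmetric]) measurable
      also have "epow \<dots> r \<le> epow (\<integral>\<^sup>+t. h k t \<partial>lborel) r"
        using r Hh by (intro epow_mono nn_integral_mono) auto
      finally show ?thesis by (simp add: c_def)
    qed
    have "(\<Sum>k. epow (energy q \<alpha> g (?Q k)) r * ennreal (snd (\<zeta> k) powr (n * (1 - r)))) \<le> (\<Sum>k. epow (\<integral>\<^sup>+t. h k t \<partial>lborel) r)"
      by (intro suminf_le step) auto
    also have "\<dots> \<le> ennreal (2 powr r) * epow (\<integral>\<^sup>+t. epow (\<Sum>k. epow (h k t) r) (1 / r) \<partial>lborel) r"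
      by (intro minkowski_suminf r) simp
    also have "\<dots> \<le> ennreal (2 powr r) * epow (\<integral>\<^sup>+t. epow (ennreal (K * real N)) (1 / r) * (epow (\<integral>\<^sup>+x. G s (x, t) \<partial>lborel) (1 / r) * w t * indicator {0<..} t) \<partial>lborel) r"
    proof (intro mult_left_mono epow_mono nn_integral_mono)
      fix t :: real
      have Gt[measurable]: "(\<lambda>x. G s (x, t)) \<in> borel_measurable borel" by (rule measurable_section(2)[OF G])
      have "(\<Sum>k. epow (h k t) r) = (\<Sum>k. ennreal K * epow (w t) r * H s k t)"
      proof -
        have "epow (h k t) r = ennreal K * epow (w t) r * H s k t" for k
          using r by (simp add: h_def epow_mult epow_epow mult_ac)
        then show ?thesis by simp
      qed
      also have "\<dots> = ennreal K * epow (w t) r * (\<Sum>k. H s k t)" by simp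
      also have "(\<Sum>k. H s k t) = (\<integral>\<^sup>+x. (\<Sum>k. G s (x, t) * indicator (?Q k) (x, t)) \<partial>lborel)"
        unfolding H_def by (rule nn_integral_suminf[symmetric]) (use measurable_section(2)[OF Gk] in simp)
      also have "ennreal K * epow (w t) r * \<dots> \<le> ennreal K * epow (w t) r * (\<integral>\<^sup>+x. of_nat N * (G s (x, t) * indicator {0<..} t) \<partial>lborel)"
        by (intro mult_left_mono nn_integral_mono overlap_sum_le[OF W N]) auto
      also have "(\<integral>\<^sup>+x. of_nat N * (G s (x, t) * indicator {0<..} t) \<partial>lborel) = of_nat N * ((\<integral>\<^sup>+x. G s (x, t) \<partial>lborel) * indicator {0<..} t)"
        by (simp add: nn_integral_cmult nn_integral_multc)
      finally have "epow (\<Sum>k. epow (h k t) r) (1 / r) \<le> epow (ennreal K * epow (w t) r * (of_nat N * ((\<integral>\<^sup>+x. G s (x, t) \<partial>lborel) * indicator {0<..} t))) (1 / r)"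
        using r by (intro epow_mono) auto
      also have "ennreal K * epow (w t) r * (of_nat N * ((\<integral>\<^sup>+x. G s (x, t) \<partial>lborel) * indicator {0<..} t))
          = ennreal (K * real N) * ((\<integral>\<^sup>+x. G s (x, t) \<partial>lborel) * epow (w t) r * indicator {0<..} t)"
        using K by (simp add: ennreal_mult ennreal_of_nat_eq_real_of_nat mult_ac)
      also have "epow \<dots> (1 / r) = epow (ennreal (K * real N)) (1 / r) * (epow (\<integral>\<^sup>+x. G s (x, t) \<partial>lborel) (1 / r) * w t * indicator {0<..} t)"
        using r by (cases "0 < t") (simp_all add: epow_mult epow_epow)
      finally show "epow (\<Sum>k. epow (h k t) r) (1 / r) \<le> epow (ennreal (K * real N)) (1 / r) * (epow (\<integral>\<^sup>+x. G s (x, t) \<partial>lborel) (1 / r) * w t * indicator {0<..} t)" .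
    qed (use r in auto)
    also have "\<dots> = ennreal (2 powr r) * epow (epow (ennreal (K * real N)) (1 / r) * J) r"
    proof -
      have [measurable]: "(\<lambda>t. \<integral>\<^sup>+x. G s (x, t) \<partial>lborel) \<in> borel_measurable borel"
        by (rule measurable_section_integral(2)[OF G])
      show ?thesis unfolding J_def by (subst nn_integral_cmult) auto
    qed
    also have "\<dots> = ennreal (2 powr r * (K * real N)) * epow J r"
      using r K by (simp add: epow_mult epow_epow ennreal_mult mult.assoc)
    \<comment> \<open>\<open>J\<close> is the q-th power of the B norm, since
      \<open>1 / r = q / s\<close>, and \<open>q * r = s\<close>.\<close>
    also have "epow J r = epow (B_norm s q \<alpha> g) s"
    proof -
      have "J = (\<integral>\<^sup>+t\<in>{0<..}. epow (M_mean s g t) q * ennreal (t powr (\<alpha> * q - 1)) \<partial>lborel)"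
        using q s by (simp add: J_def M_mean_def epow_epow G_def w_def r_def)
      then show ?thesis using q by (simp add: B_norm_def epow_epow r_def)
    qed
    finally show "(\<Sum>k. epow (energy q \<alpha> g (?Q k)) (s / q) * ennreal (snd (\<zeta> k) powr (real CARD('n) * (1 - s / q))))
      \<le> ennreal (2 powr r * (K * real N)) * epow (B_norm s q \<alpha> g) s"
      by (simp only: r_def n_def)
  qed
qed

section \<open>The embedding theorem\<close>

lemma prod_mono_ennreal:
  fixes f g :: "'i \<Rightarrow> ennreal"
  assumes "\<And>i. i \<in> I \<Longrightarrow> f i \<le> g i"
  shows "prod f I \<le> prod g I"
  using assms by (induction I rule: infinite_finite_induct) (auto intro!: mult_mono)

text \<open>\<open>X\<close> and \<open>Nm\<close> stand for either scale of spaces, and the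
  majorant \<open>y k\<close> replaces the supremum over the k-th cube. The negative powers of the
  height contributed by the factors cancel against the bound for the measure of the cube.\<close>

lemma embedding_of_measure_bound:
  fixes \<zeta> :: "nat \<Rightarrow> (real^'n::finite) \<times> real" and \<mu> :: "((real^'n) \<times> real) measure"
    and p q s :: real and m :: nat and E :: "nat \<Rightarrow> real"
    and X :: "nat \<Rightarrow> ((real^'n) \<times> real \<Rightarrow> real) set" and Nm :: "nat \<Rightarrow> ((real^'n) \<times> real \<Rightarrow> real) \<Rightarrow> ennreal"
  assumes W: "whitney_decomposition \<zeta> l"
    and borel: "sets \<mu> = sets (restrict_space borel upper_half)"
    and pq: "0 < p" "0 < q" and s: "0 < s" "s \<le> q" and m: "1 \<le> m"
    and upper: "\<And>i. i \<in> {1..m} \<Longrightarrow> \<exists>K\<ge>0. \<forall>f\<in>X i. \<exists>y. (\<forall>k. \<forall>z\<in>cube (\<zeta> k) (l k).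
      ennreal (\<bar>f z\<bar> powr s * snd (\<zeta> k) powr E i) \<le> y k) \<and> (\<Sum>k. y k) \<le> ennreal K * epow (Nm i f) s"
    and bound: "\<exists>C>0. \<forall>k. emeasure \<mu> (cube (\<zeta> k) (l k)) \<le> ennreal (C * snd (\<zeta> k) powr (\<Sum>i=1..m. p * E i / s))"
  shows "\<exists>C>0. \<forall>f. (\<forall>i\<in>{1..m}. f i \<in> X i) \<longrightarrow>
    A_norm (\<lambda>k. cube (\<zeta> k) (l k)) p q m \<mu> f \<le> ennreal C * (\<Prod>i=1..m. Nm i (f i))"
proof -
  obtain C0 where C0: "0 < C0" "\<And>k. emeasure \<mu> (cube (\<zeta> k) (l k)) \<le> ennreal (C0 * snd (\<zeta> k) powr (\<Sum>i=1..m. p * E i / s))"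
    using bound by blast
  have "\<forall>i\<in>{1..m}. \<exists>K\<ge>0. \<forall>f\<in>X i. \<exists>y. (\<forall>k. \<forall>z\<in>cube (\<zeta> k) (l k).
      ennreal (\<bar>f z\<bar> powr s * snd (\<zeta> k) powr E i) \<le> y k) \<and> (\<Sum>k. y k) \<le> ennreal K * epow (Nm i f) s"
    using upper by blast
  from bchoice[OF this] obtain K where K: "\<And>i. i \<in> {1..m} \<Longrightarrow> 0 \<le> K i"
    and upper': "\<And>i f. \<lbrakk>i \<in> {1..m}; f \<in> X i\<rbrakk> \<Longrightarrow> \<exists>y. (\<forall>k. \<forall>z\<in>cube (\<zeta> k) (l k).
      ennreal (\<bar>f z\<bar> powr s * snd (\<zeta> k) powr E i) \<le> y k) \<and> (\<Sum>k. y k) \<le> ennreal (K i) * epow (Nm i f) s"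
    by blast
  define C where "C = C0 powr (1 / p) * (\<Prod>i=1..m. K i powr (1 / s))"
  have C: "0 \<le> C" by (simp add: C_def prod_nonneg)
  show ?thesis
  proof (intro exI conjI allI impI)
    \<comment> \<open>Some \<open>K i\<close>, and with it \<open>C\<close>, may be 0, whereas the
      constant has to be positive.\<close>
    show "0 < C + 1" using C by simp
    fix f assume f: "\<forall>i\<in>{1..m}. f i \<in> X i"
    have "\<forall>i\<in>{1..m}. \<exists>y. (\<forall>k. \<forall>z\<in>cube (\<zeta> k) (l k).
      ennreal (\<bar>f i z\<bar> powr s * snd (\<zeta> k) powr E i) \<le> y k) \<and> (\<Sum>k. y k) \<le> ennreal (K i) * epow (Nm i (f i)) s"
      using upper' f by blast
    from bchoice[OF this] obtain y where
      y: "\<And>i k z. \<lbrakk>i \<in> {1..m}; z \<in> cube (\<zeta> k) (l k)\<rbrakk> \<Longrightarrow> ennreal (\<bar>f i z\<bar> powr s * snd (\<zeta> k) powr E i) \<le> y i k"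
      and ysum: "\<And>i. i \<in> {1..m} \<Longrightarrow> (\<Sum>k. y i k) \<le> ennreal (K i) * epow (Nm i (f i)) s"
      by blast
    have cube_int: "epow (\<integral>\<^sup>+z\<in>cube (\<zeta> k) (l k). ennreal (\<Prod>i=1..m. \<bar>f i z\<bar> powr p) \<partial>\<mu>) (q / p)
        \<le> ennreal (C0 powr (q / p)) * (\<Prod>i=1..m. epow (y i k) (q / s))" for k
    proof -
      define \<eta> where "\<eta> = snd (\<zeta> k)"
      have \<eta>: "0 < \<eta>" using whitney_pos[OF W] by (simp add: \<eta>_def)
      define S where "S = (\<Sum>i=1..m. p * E i / s)"
      let ?Q = "cube (\<zeta> k) (l k)"
      have "cube (\<zeta> k) (l k) \<in> sets \<mu>"
        unfolding borel using whitney_sub(1)[OF W, of k]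
        by (subst sets_restrict_space_iff) (auto intro: borel_open open_upper_half)
      have pt: "ennreal (\<Prod>i=1..m. \<bar>f i z\<bar> powr p) \<le> (\<Prod>i=1..m. epow (y i k) (p / s)) * ennreal (\<eta> powr - S)"
        if z: "z \<in> ?Q" for z
      proof -
        have one: "ennreal (\<bar>f i z\<bar> powr p) \<le> epow (y i k) (p / s) * ennreal (\<eta> powr - (p * E i / s))" if i: "i \<in> {1..m}" for i
        proof -
          have "epow (ennreal (\<bar>f i z\<bar> powr s * \<eta> powr E i)) (p / s) \<le> epow (y i k) (p / s)"
            using y[OF i z] s pq by (intro epow_mono) (auto simp: \<eta>_def)
          then have "ennreal (\<bar>f i z\<bar> powr p * \<eta> powr (p * E i / s)) \<le> epow (y i k) (p / s)"
            using s by (simp add: epow_ennreal powr_mult powr_powr mult_ac)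
          then have "ennreal (\<bar>f i z\<bar> powr p * \<eta> powr (p * E i / s)) * ennreal (\<eta> powr - (p * E i / s)) \<le> epow (y i k) (p / s) * ennreal (\<eta> powr - (p * E i / s))"
            by (rule mult_right_mono) simp
          moreover have "ennreal (\<bar>f i z\<bar> powr p * \<eta> powr (p * E i / s)) * ennreal (\<eta> powr - (p * E i / s)) = ennreal (\<bar>f i z\<bar> powr p)"
            using \<eta> by (simp add: mult.assoc powr_minus flip: ennreal_mult)
          ultimately show ?thesis by simp
        qed
        have "ennreal (\<Prod>i=1..m. \<bar>f i z\<bar> powr p) = (\<Prod>i=1..m. ennreal (\<bar>f i z\<bar> powr p))"
          by (simp add: prod_ennreal)
        also have "\<dots> \<le> (\<Prod>i=1..m. epow (y i k) (p / s) * ennreal (\<eta> powr - (p * E i / s)))"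
          by (intro prod_mono_ennreal one)
        also have "\<dots> = (\<Prod>i=1..m. epow (y i k) (p / s)) * ennreal (\<Prod>i=1..m. \<eta> powr - (p * E i / s))"
          by (simp add: prod.distrib prod_ennreal)
        also have "(\<Prod>i=1..m. \<eta> powr - (p * E i / s)) = \<eta> powr - S"
          using \<eta> by (simp add: S_def powr_sum sum_negf[symmetric])
        finally show ?thesis .
      qed
      have "(\<integral>\<^sup>+z\<in>?Q. ennreal (\<Prod>i=1..m. \<bar>f i z\<bar> powr p) \<partial>\<mu>)
          \<le> (\<integral>\<^sup>+z. (\<Prod>i=1..m. epow (y i k) (p / s)) * ennreal (\<eta> powr - S) * indicator ?Q z \<partial>\<mu>)"
        using pt by (intro nn_integral_mono) (auto simp: indicator_def)
      also have "\<dots> = (\<Prod>i=1..m. epow (y i k) (p / s)) * ennreal (\<eta> powr - S) * emeasure \<mu> ?Q"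
        using \<open>?Q \<in> sets \<mu>\<close> by (rule nn_integral_cmult_indicator)
      also have "\<dots> \<le> (\<Prod>i=1..m. epow (y i k) (p / s)) * ennreal (\<eta> powr - S) * ennreal (C0 * \<eta> powr S)"
        using C0(2)[of k] by (intro mult_left_mono) (auto simp: \<eta>_def S_def)
      also have "\<dots> = (\<Prod>i=1..m. epow (y i k) (p / s)) * ennreal C0"
      proof -
        have "ennreal (\<eta> powr - S) * ennreal (C0 * \<eta> powr S) = ennreal C0"
          using \<eta> C0(1) by (simp add: powr_minus flip: ennreal_mult)
        then show ?thesis by (simp add: mult.assoc)
      qed
      finally have "epow (\<integral>\<^sup>+z\<in>?Q. ennreal (\<Prod>i=1..m. \<bar>f i z\<bar> powr p) \<partial>\<mu>) (q / p) \<le> epow ((\<Prod>i=1..m. epow (y i k) (p / s)) * ennreal C0) (q / p)"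
        using pq by (intro epow_mono) auto
      also have "\<dots> = ennreal (C0 powr (q / p)) * (\<Prod>i=1..m. epow (y i k) (q / s))"
        using pq C0(1) by (simp add: epow_mult epow_prod epow_epow epow_ennreal mult.commute)
      finally show ?thesis .
    qed
    have "(\<Sum>k. epow (\<integral>\<^sup>+z\<in>cube (\<zeta> k) (l k). ennreal (\<Prod>i=1..m. \<bar>f i z\<bar> powr p) \<partial>\<mu>) (q / p))
        \<le> (\<Sum>k. ennreal (C0 powr (q / p)) * (\<Prod>i=1..m. epow (y i k) (q / s)))"
      by (intro suminf_le cube_int) auto
    also have "\<dots> = ennreal (C0 powr (q / p)) * (\<Sum>k. \<Prod>i=1..m. epow (y i k) (q / s))" by simp
    also have "\<dots> \<le> ennreal (C0 powr (q / p)) * (\<Prod>i=1..m. epow (ennreal (K i) * epow (Nm i (f i)) s) (q / s))"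
    proof (rule mult_left_mono)
      have "(\<Sum>k. \<Prod>i=1..m. epow (y i k) (q / s)) \<le> (\<Prod>i=1..m. \<Sum>k. epow (y i k) (q / s))"
        using m by (intro suminf_prod_le) auto
      also have "\<dots> \<le> (\<Prod>i=1..m. epow (ennreal (K i) * epow (Nm i (f i)) s) (q / s))"
      proof (rule prod_mono_ennreal)
        fix i assume i: "i \<in> {1..m}"
        \<comment> \<open>This is where \<open>s <= q\<close> enters: l^1 embeds into l^(q /
          s).\<close>
        have "(\<Sum>k. epow (y i k) (q / s)) \<le> epow (\<Sum>k. y i k) (q / s)"
          using s by (intro suminf_epow_le) simp
        also have "\<dots> \<le> epow (ennreal (K i) * epow (Nm i (f i)) s) (q / s)"
          using s pq by (intro epow_mono ysum i) auto
        finally show "(\<Sum>k. epow (y i k) (q / s)) \<le> epow (ennreal (K i) * epow (Nm i (f i)) s) (q / s)" .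
      qed
      finally show "(\<Sum>k. \<Prod>i=1..m. epow (y i k) (q / s)) \<le> (\<Prod>i=1..m. epow (ennreal (K i) * epow (Nm i (f i)) s) (q / s))" .
    qed simp
    finally have "A_norm (\<lambda>k. cube (\<zeta> k) (l k)) p q m \<mu> f
        \<le> epow (ennreal (C0 powr (q / p)) * (\<Prod>i=1..m. epow (ennreal (K i) * epow (Nm i (f i)) s) (q / s))) (1 / q)"
      unfolding A_norm_def using pq by (intro epow_mono) auto
    also have "\<dots> = ennreal (C0 powr (1 / p)) * (\<Prod>i=1..m. epow (ennreal (K i)) (1 / s) * Nm i (f i))"
      using pq s by (simp add: epow_mult epow_prod epow_epow epow_ennreal powr_powr)
    also have "(\<Prod>i=1..m. epow (ennreal (K i)) (1 / s) * Nm i (f i)) = (\<Prod>i=1..m. ennreal (K i powr (1 / s))) * (\<Prod>i=1..m. Nm i (f i))"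
      unfolding prod.distrib[symmetric] using K by (intro prod.cong) (auto simp: epow_ennreal)
    also have "ennreal (C0 powr (1 / p)) * \<dots> = ennreal C * (\<Prod>i=1..m. Nm i (f i))"
      by (simp add: C_def prod_ennreal ennreal_mult prod_nonneg mult.assoc)
    also have "\<dots> \<le> ennreal (C + 1) * (\<Prod>i=1..m. Nm i (f i))"
      by (intro mult_right_mono ennreal_leI) auto
    finally show "A_norm (\<lambda>k. cube (\<zeta> k) (l k)) p q m \<mu> f \<le> ennreal (C + 1) * (\<Prod>i=1..m. Nm i (f i))" .
  qed
qed

text \<open>One test function, placed at the given cube, fills all m slots, and the sum over cubes
  is reduced to the term of that cube. There the function is at least a constant times \<eta>^(- L),
  while its norm in slot i is at most a constant times \<eta>^(E i / s - L); the decay exponent L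
  cancels.\<close>

lemma measure_bound_of_embedding:
  fixes \<zeta> :: "nat \<Rightarrow> (real^'n::finite) \<times> real" and \<mu> :: "((real^'n) \<times> real) measure"
    and p q s :: real and m M :: nat and E :: "nat \<Rightarrow> real"
    and X :: "nat \<Rightarrow> ((real^'n) \<times> real \<Rightarrow> real) set" and Nm :: "nat \<Rightarrow> ((real^'n) \<times> real \<Rightarrow> real) \<Rightarrow> ennreal"
  assumes W: "whitney_decomposition \<zeta> l"
    and borel: "sets \<mu> = sets (restrict_space borel upper_half)"
    and pq: "0 < p" "0 < q" and s: "0 < s" and M: "0 < M"
    and test_X: "\<And>i \<xi> \<eta>. \<lbrakk>i \<in> {1..m}; 0 < \<eta>\<rbrakk> \<Longrightarrow> test_fun M \<xi> \<eta> \<in> X i"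
    and test: "\<And>i. i \<in> {1..m} \<Longrightarrow> \<exists>C\<ge>0. \<forall>\<xi>. \<forall>\<eta>>0.
      Nm i (test_fun M \<xi> \<eta>) \<le> ennreal (C * \<eta> powr (E i / s - (real M + real CARD('n) - 1)))"
    and emb: "\<exists>C>0. \<forall>f. (\<forall>i\<in>{1..m}. f i \<in> X i) \<longrightarrow>
      A_norm (\<lambda>k. cube (\<zeta> k) (l k)) p q m \<mu> f \<le> ennreal C * (\<Prod>i=1..m. Nm i (f i))"
  shows "\<exists>C>0. \<forall>k. emeasure \<mu> (cube (\<zeta> k) (l k)) \<le> ennreal (C * snd (\<zeta> k) powr (\<Sum>i=1..m. p * E i / s))"
proof -
  define L where "L = real M + real CARD('n) - 1"
  obtain C where C: "0 < C" "\<And>f. (\<forall>i\<in>{1..m}. f i \<in> X i) \<Longrightarrow>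
      A_norm (\<lambda>k. cube (\<zeta> k) (l k)) p q m \<mu> f \<le> ennreal C * (\<Prod>i=1..m. Nm i (f i))"
    using emb by blast
  have "\<forall>i\<in>{1..m}. \<exists>C\<ge>0. \<forall>\<xi>. \<forall>\<eta>>0. Nm i (test_fun M \<xi> \<eta>) \<le> ennreal (C * \<eta> powr (E i / s - L))"
    unfolding L_def using test by blast
  from bchoice[OF this] obtain D where D: "\<And>i. i \<in> {1..m} \<Longrightarrow> 0 \<le> D i"
    "\<And>i \<xi> \<eta>. \<lbrakk>i \<in> {1..m}; 0 < \<eta>\<rbrakk> \<Longrightarrow> Nm i (test_fun M \<xi> \<eta>) \<le> ennreal (D i * \<eta> powr (E i / s - L))"
    by blast
  obtain c where c: "0 < c" "\<And>(\<xi> :: real^'n) \<eta> l z. \<lbrakk>0 < \<eta>; l \<le> 2 * \<eta>; z \<in> cube (\<xi>, \<eta>) l\<rbrakk>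
    \<Longrightarrow> c * \<eta> powr - L \<le> \<bar>test_fun M \<xi> \<eta> z\<bar>"
    using test_fun_ge[OF M] unfolding L_def by blast
  define P where "P = C * (\<Prod>i=1..m. D i)"
  have Dn: "0 \<le> (\<Prod>i=1..m. D i)" by (intro prod_nonneg ballI D(1))
  then have P: "0 \<le> P" using C(1) by (simp add: P_def)
  define S where "S = (\<Sum>i=1..m. p * E i / s)"
  \<comment> \<open>The constant of the norm bound to the power p, divided by what the lower bound
    \<open>c\<close> contributes from the m factors.\<close>
  define B where "B = P powr p / (c powr p) ^ m"
  have bound: "emeasure \<mu> (cube (\<zeta> k) (l k)) \<le> ennreal (B * snd (\<zeta> k) powr S)" for k
  proof -
    define \<xi> \<eta> where "\<xi> = fst (\<zeta> k)" and "\<eta> = snd (\<zeta> k)"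
    have \<zeta>: "\<zeta> k = (\<xi>, \<eta>)" by (simp add: \<xi>_def \<eta>_def)
    have \<eta>: "0 < \<eta>" "l k \<le> 2 * \<eta>" using whitney_pos[OF W] by (auto simp: \<eta>_def)
    let ?Q = "cube (\<zeta> k) (l k)"
    define f where "f i = test_fun M \<xi> \<eta>" for i :: nat
    define a where "a = ((c * \<eta> powr - L) powr p) ^ m"
    have a: "0 < a" using c \<eta> by (simp add: a_def)
    have Q: "?Q \<in> sets \<mu>"
      unfolding borel using whitney_sub(1)[OF W, of k]
      by (subst sets_restrict_space_iff) (auto intro: borel_open open_upper_half)
    let ?I = "\<lambda>k. \<integral>\<^sup>+z\<in>cube (\<zeta> k) (l k). ennreal (\<Prod>i=1..m. \<bar>f i z\<bar> powr p) \<partial>\<mu>"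
    have "ennreal a * emeasure \<mu> ?Q = (\<integral>\<^sup>+z. ennreal a * indicator ?Q z \<partial>\<mu>)"
      using Q by (rule nn_integral_cmult_indicator[symmetric])
    also have "\<dots> \<le> ?I k"
    proof (rule nn_integral_mono)
      fix z
      have "a \<le> (\<Prod>i=1..m. \<bar>f i z\<bar> powr p)" if "z \<in> ?Q"
      proof -
        have "c * \<eta> powr - L \<le> \<bar>test_fun M \<xi> \<eta> z\<bar>" using that \<eta> c(2) unfolding \<zeta> by blast
        then have "(c * \<eta> powr - L) powr p \<le> \<bar>test_fun M \<xi> \<eta> z\<bar> powr p"
          using c \<eta> pq by (intro powr_mono2) auto
        then have "a \<le> (\<bar>test_fun M \<xi> \<eta> z\<bar> powr p) ^ m" unfolding a_def by (intro power_mono) auto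
        then show ?thesis by (simp add: f_def)
      qed
      then show "ennreal a * indicator ?Q z \<le> ennreal (\<Prod>i=1..m. \<bar>f i z\<bar> powr p) * indicator ?Q z"
        by (auto simp: indicator_def intro!: ennreal_leI)
    qed
    also have "?I k = epow (epow (epow (?I k) (q / p)) (1 / q)) p"
      using pq by (simp add: epow_epow)
    also have "\<dots> \<le> epow (A_norm (\<lambda>k. cube (\<zeta> k) (l k)) p q m \<mu> f) p"
      unfolding A_norm_def using pq by (intro epow_mono le_suminf_ennreal[of "\<lambda>k. epow (?I k) (q / p)"]) auto
    also have "\<dots> \<le> epow (ennreal (P * \<eta> powr (\<Sum>i=1..m. E i / s - L))) p"
    proof (rule epow_mono)
      have "A_norm (\<lambda>k. cube (\<zeta> k) (l k)) p q m \<mu> f \<le> ennreal C * (\<Prod>i=1..m. Nm i (f i))"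
        by (rule C(2)) (use test_X \<eta> in \<open>auto simp: f_def\<close>)
      also have "\<dots> \<le> ennreal C * (\<Prod>i=1..m. ennreal (D i * \<eta> powr (E i / s - L)))"
        unfolding f_def by (intro mult_left_mono prod_mono_ennreal D(2) \<eta>) auto
      also have "(\<Prod>i=1..m. ennreal (D i * \<eta> powr (E i / s - L))) = ennreal (\<Prod>i=1..m. D i * \<eta> powr (E i / s - L))"
        using D(1) by (intro prod_ennreal) auto
      also have "(\<Prod>i=1..m. D i * \<eta> powr (E i / s - L)) = (\<Prod>i=1..m. D i) * \<eta> powr (\<Sum>i=1..m. E i / s - L)"
        using \<eta> by (simp add: prod.distrib powr_sum)
      also have "ennreal C * ennreal ((\<Prod>i=1..m. D i) * \<eta> powr (\<Sum>i=1..m. E i / s - L)) = ennreal (P * \<eta> powr (\<Sum>i=1..m. E i / s - L))"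
        unfolding P_def mult.assoc by (intro ennreal_mult[symmetric] mult_nonneg_nonneg Dn) (use C(1) in auto)
      finally show "A_norm (\<lambda>k. cube (\<zeta> k) (l k)) p q m \<mu> f \<le> ennreal (P * \<eta> powr (\<Sum>i=1..m. E i / s - L))" .
    qed (use pq in simp)
    also have "\<dots> = ennreal (P powr p * \<eta> powr (S - real m * L * p))"
    proof -
      have "(\<Sum>i=1..m. E i / s - L) * p = S - real m * L * p"
      proof -
        have "(\<Sum>i=1..m. E i / s - L) * p = (\<Sum>i=1..m. p * E i / s - L * p)"
          unfolding sum_distrib_right by (intro sum.cong) (auto simp: algebra_simps)
        then show ?thesis by (simp add: S_def sum_subtractf)
      qed
      then show ?thesis using P by (simp add: epow_ennreal powr_mult powr_powr)
    qed
    finally have le: "ennreal a * emeasure \<mu> ?Q \<le> ennreal (P powr p * \<eta> powr (S - real m * L * p))" .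
    have "emeasure \<mu> ?Q = ennreal (1 / a) * (ennreal a * emeasure \<mu> ?Q)"
      using a by (simp add: mult.assoc[symmetric] flip: ennreal_mult)
    also have "\<dots> \<le> ennreal (1 / a) * ennreal (P powr p * \<eta> powr (S - real m * L * p))"
      by (intro mult_left_mono le) simp
    also have "\<dots> = ennreal (1 / a * (P powr p * \<eta> powr (S - real m * L * p)))"
      using a by (intro ennreal_mult[symmetric]) auto
    also have "1 / a * (P powr p * \<eta> powr (S - real m * L * p)) = B * \<eta> powr S"
    proof -
      have "(\<eta> powr (- L * p)) ^ m = \<eta> powr (- L * p * real m)"
        using \<eta> by (simp add: powr_powr flip: powr_realpow)
      then have "a = (c powr p) ^ m * \<eta> powr (- L * p * real m)"
        using c \<eta> by (simp add: a_def powr_mult powr_powr power_mult_distrib)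
      moreover have "\<eta> powr (S - real m * L * p) = \<eta> powr S * \<eta> powr (- L * p * real m)"
        unfolding powr_add[symmetric] by (rule arg_cong2[where f="(powr)"]) (auto simp: algebra_simps)
      ultimately show ?thesis using \<eta> c by (simp add: B_def)
    qed
    finally show ?thesis by (simp add: \<eta>_def)
  qed
  show ?thesis
  proof (intro exI conjI allI)
    have B: "0 \<le> B" by (simp add: B_def)
    then show "0 < B + 1" by simp
    fix k
    have "ennreal (B * snd (\<zeta> k) powr S) \<le> ennreal ((B + 1) * snd (\<zeta> k) powr S)"
      by (intro ennreal_leI mult_right_mono) auto
    then show "emeasure \<mu> (cube (\<zeta> k) (l k)) \<le> ennreal ((B + 1) * snd (\<zeta> k) powr (\<Sum>i=1..m. p * E i / s))"
      using bound[of k] unfolding S_def by (rule order_trans[rotated])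
  qed
qed

text \<open>Joins the pointwise bound by cube energies to their summation, for a norm
  \<open>N\<close> of either scale. Extension by zero supplies the Borel measurability that
  \<open>sums\<close> asks for, and \<open>ext\<close> ensures that the norm does not notice
  it.\<close>

lemma function_space_upper_bound:
  fixes \<zeta> :: "nat \<Rightarrow> (real^'n::finite) \<times> real"
  assumes W: "whitney_decomposition \<zeta> l" and t: "0 < t" "t \<le> s"
    and sums: "\<exists>K\<ge>0. \<forall>g. g \<in> borel_measurable borel \<longrightarrow>
      (\<Sum>k. epow (energy t \<alpha> g (cube (\<zeta> k) (5/4 * l k))) (s / t) * ennreal (snd (\<zeta> k) powr (real CARD('n) * (1 - s / t))))
      \<le> ennreal K * epow (N g) s"
    and ext: "\<And>f. N (zero_ext f) = N f" and E: "E = real CARD('n) + \<alpha> * s"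
    and X: "\<And>f. f \<in> X \<Longrightarrow> harmonic_on f upper_half"
  shows "\<exists>K\<ge>0. \<forall>f\<in>X. \<exists>y. (\<forall>k. \<forall>z\<in>cube (\<zeta> k) (l k).
      ennreal (\<bar>f z\<bar> powr s * snd (\<zeta> k) powr E) \<le> y k) \<and> (\<Sum>k. y k) \<le> ennreal K * epow (N f) s"
proof -
  define Y where "Y f k = epow (energy t \<alpha> (zero_ext f) (cube (\<zeta> k) (5/4 * l k))) (s / t) * ennreal (snd (\<zeta> k) powr (real CARD('n) * (1 - s / t)))" for f k
  have s: "0 < s" using t by simp
  obtain K1 where K1: "0 \<le> K1" "\<And>f k z. \<lbrakk>harmonic_on f upper_half; z \<in> cube (\<zeta> k) (l k)\<rbrakk> \<Longrightarrow>
    ennreal (\<bar>f z\<bar> powr s * snd (\<zeta> k) powr E) \<le> ennreal K1 * Y f k"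
    unfolding Y_def E using powr_le_energy[OF W t(1) s] by blast
  obtain K2 where K2: "0 \<le> K2" and K2': "\<And>g. g \<in> borel_measurable borel \<Longrightarrow>
      (\<Sum>k. epow (energy t \<alpha> g (cube (\<zeta> k) (5/4 * l k))) (s / t) * ennreal (snd (\<zeta> k) powr (real CARD('n) * (1 - s / t))))
      \<le> ennreal K2 * epow (N g) s"
    using sums by blast
  have K2_le: "(\<Sum>k. Y f k) \<le> ennreal K2 * epow (N f) s" if "harmonic_on f upper_half" for f
    using K2'[OF zero_ext_measurable[OF that]] unfolding Y_def ext .
  show ?thesis
  proof (intro exI conjI ballI allI)
    show "0 \<le> K1 * K2" using K1 K2 by simp
    fix f assume f: "f \<in> X"
    show "ennreal (\<bar>f z\<bar> powr s * snd (\<zeta> k) powr E) \<le> ennreal K1 * Y f k" if "z \<in> cube (\<zeta> k) (l k)" for k z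
      using K1(2) X[OF f] that by blast
    have "(\<Sum>k. ennreal K1 * Y f k) = ennreal K1 * (\<Sum>k. Y f k)" by simp
    also have "\<dots> \<le> ennreal K1 * (ennreal K2 * epow (N f) s)"
      by (intro mult_left_mono K2_le X f) simp
    finally show "(\<Sum>k. ennreal K1 * Y f k) \<le> ennreal (K1 * K2) * epow (N f) s"
      using K1(1) K2 by (simp add: ennreal_mult mult.assoc)
  qed
qed

text \<open>A single M has to serve all i, because \<open>measure_bound_of_embedding\<close> puts
  the same function into every slot; \<open>2 <= M\<close> is what
  \<open>harmonic_on_kelvin_power\<close> asks for.\<close>

lemma common_test_exponent:
  fixes e :: "nat \<Rightarrow> real"
  obtains M :: nat where "2 \<le> M" "\<And>i. i \<in> {1..m} \<Longrightarrow> e i < real M"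
proof -
  obtain M :: nat where M: "2 + (\<Sum>i=1..m. \<bar>e i\<bar>) < real M" using reals_Archimedean2 by blast
  have "e i < real M" if "i \<in> {1..m}" for i
    using M member_le_sum[OF that, of "\<lambda>i. \<bar>e i\<bar>"] by simp
  moreover have "0 \<le> (\<Sum>i=1..m. \<bar>e i\<bar>)" by (rule sum_nonneg) simp
  with M have "2 < real M" by linarith
  then have "2 \<le> M" by simp
  ultimately show thesis using that by blast
qed

theorem theorem3:
  fixes \<zeta> :: "nat \<Rightarrow> (real^'n::finite) \<times> real" and l :: "nat \<Rightarrow> real"
    and \<Delta> :: "nat \<Rightarrow> ((real^'n) \<times> real) set"
    and \<mu> :: "((real^'n) \<times> real) measure"
    and p q s :: real and m :: nat and \<beta> t :: "nat \<Rightarrow> real"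
  assumes whitney: "whitney_decomposition \<zeta> l"
    and Delta: "\<Delta> = (\<lambda>k. cube (\<zeta> k) (l k))"
    and borel: "sets \<mu> = sets (restrict_space borel upper_half)"
    and pq: "0 < p" "0 < q"
    and s: "0 < s" "s \<le> q"
    and m: "1 \<le> m"
    and beta: "\<forall>i\<in>{1..m}. \<beta> i > -1"
    and t: "\<forall>i\<in>{1..m}. 0 < t i \<and> t i \<le> s"
  shows
    "((\<exists>C>0. \<forall>f. (\<forall>i\<in>{1..m}. f i \<in> B_space s (t i) ((\<beta> i + 1) / s)) \<longrightarrow>
          A_norm \<Delta> p q m \<mu> f \<le> ennreal C * (\<Prod>i=1..m. B_norm s (t i) ((\<beta> i + 1) / s) (f i)))
      \<longleftrightarrow>
      (\<exists>C>0. \<forall>f. (\<forall>i\<in>{1..m}. f i \<in> F_space s (t i) ((\<beta> i + 1) / s)) \<longrightarrow>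
          A_norm \<Delta> p q m \<mu> f \<le> ennreal C * (\<Prod>i=1..m. F_norm s (t i) ((\<beta> i + 1) / s) (f i))))
     \<and>
     ((\<exists>C>0. \<forall>f. (\<forall>i\<in>{1..m}. f i \<in> F_space s (t i) ((\<beta> i + 1) / s)) \<longrightarrow>
          A_norm \<Delta> p q m \<mu> f \<le> ennreal C * (\<Prod>i=1..m. F_norm s (t i) ((\<beta> i + 1) / s) (f i)))
      \<longleftrightarrow>
      (\<exists>C>0. \<forall>k. emeasure \<mu> (\<Delta> k)
          \<le> ennreal (C * snd (\<zeta> k) powr (\<Sum>i=1..m. p * (real CARD('n) + 1 + \<beta> i) / s))))"
    (is "(?B = ?F) \<and> (?F = ?mu)")
proof -
  \<comment> \<open>\<open>E i\<close> is the exponent of the height that factor i contributes to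
    the measure condition. In the form n + \<alpha> s it is the exponent from
    \<open>powr_le_energy\<close>; divided by s it is the scaling exponent of the norms of the test
    functions.\<close>
  define E where "E i = real CARD('n) + 1 + \<beta> i" for i
  define \<alpha> where "\<alpha> i = (\<beta> i + 1) / s" for i
  have E: "E i = real CARD('n) + \<alpha> i * s" "E i / s = real CARD('n) / s + \<alpha> i" for i
    using s by (simp_all add: E_def \<alpha>_def field_simps)
  have \<alpha>: "0 < \<alpha> i" if "i \<in> {1..m}" for i
  proof -
    have "0 < \<beta> i + 1" using beta that by force
    then show ?thesis using s by (simp add: \<alpha>_def)
  qed
  have ti: "0 < t i" "t i \<le> s" if "i \<in> {1..m}" for i using t that by auto
  obtain M where M2: "2 \<le> M" and M: "\<And>i. i \<in> {1..m} \<Longrightarrow> E i / s < real M"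
    using common_test_exponent[of m "\<lambda>i. E i / s"] by blast
  have M0: "0 < M" using M2 by simp
  \<comment> \<open>The decay exponent M + n - 1 of the test functions is at least M, since n >= 1,
    and thus large enough for finite norms.\<close>
  have L: "real CARD('n) / s + \<alpha> i < real M + real CARD('n) - 1" if "i \<in> {1..m}" for i
  proof -
    have "1 \<le> real CARD('n)" by (simp add: Suc_le_eq)
    then show ?thesis using M[OF that] unfolding E(2) by linarith
  qed
  have test: "\<exists>C\<ge>0. \<forall>\<xi> :: real^'n. \<forall>\<eta>>0.
      B_norm s (t i) (\<alpha> i) (test_fun M \<xi> \<eta>) \<le> ennreal (C * \<eta> powr (E i / s - (real M + real CARD('n) - 1)))
      \<and> F_norm s (t i) (\<alpha> i) (test_fun M \<xi> \<eta>) \<le> ennreal (C * \<eta> powr (E i / s - (real M + real CARD('n) - 1)))"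
    if "i \<in> {1..m}" for i
    using test_fun_norm_le[OF s(1) ti(1)[OF that] \<alpha>[OF that] M0 L[OF that]] unfolding E(2) by metis
  have testB: "test_fun M \<xi> \<eta> \<in> B_space s (t i) (\<alpha> i)" and testF: "test_fun M \<xi> \<eta> \<in> F_space s (t i) (\<alpha> i)"
    if i: "i \<in> {1..m}" and \<eta>: "0 < \<eta>" for i \<eta> and \<xi> :: "real^'n"
  proof -
    obtain C where "B_norm s (t i) (\<alpha> i) (test_fun M \<xi> \<eta>) \<le> ennreal C" "F_norm s (t i) (\<alpha> i) (test_fun M \<xi> \<eta>) \<le> ennreal C"
      using test[OF i] \<eta> by blast
    then have "B_norm s (t i) (\<alpha> i) (test_fun M \<xi> \<eta>) < \<infinity>" "F_norm s (t i) (\<alpha> i) (test_fun M \<xi> \<eta>) < \<infinity>"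
      unfolding infinity_ennreal_def by (auto intro: le_less_trans[OF _ ennreal_less_top])
    then show "test_fun M \<xi> \<eta> \<in> B_space s (t i) (\<alpha> i)" "test_fun M \<xi> \<eta> \<in> F_space s (t i) (\<alpha> i)"
      using test_fun_harmonic[OF M2 \<eta>, of \<xi>] by (auto simp: B_space_def F_space_def)
  qed
  have "?B = ?mu"
    unfolding Delta E_def[symmetric] \<alpha>_def[symmetric]
  proof
    assume *: "\<exists>C>0. \<forall>f. (\<forall>i\<in>{1..m}. f i \<in> B_space s (t i) (\<alpha> i)) \<longrightarrow>
          A_norm (\<lambda>k. cube (\<zeta> k) (l k)) p q m \<mu> f \<le> ennreal C * (\<Prod>i=1..m. B_norm s (t i) (\<alpha> i) (f i))"
    show "\<exists>C>0. \<forall>k. emeasure \<mu> (cube (\<zeta> k) (l k)) \<le> ennreal (C * snd (\<zeta> k) powr (\<Sum>i=1..m. p * E i / s))"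
    proof (rule measure_bound_of_embedding[where X = "\<lambda>i. B_space s (t i) (\<alpha> i)" and Nm = "\<lambda>i. B_norm s (t i) (\<alpha> i)",
          OF whitney borel pq s(1) M0 _ _ *])
      fix i assume i: "i \<in> {1..m}"
      show "test_fun M \<xi> \<eta> \<in> B_space s (t i) (\<alpha> i)" if "0 < \<eta>" for \<xi> :: "real^'n" and \<eta>
        using i that by (rule testB)
      show "\<exists>C\<ge>0. \<forall>\<xi> :: real^'n. \<forall>\<eta>>0. B_norm s (t i) (\<alpha> i) (test_fun M \<xi> \<eta>) \<le> ennreal (C * \<eta> powr (E i / s - (real M + real CARD('n) - 1)))"
        using test[OF i] by blast
    qed
  next
    assume *: "\<exists>C>0. \<forall>k. emeasure \<mu> (cube (\<zeta> k) (l k)) \<le> ennreal (C * snd (\<zeta> k) powr (\<Sum>i=1..m. p * E i / s))"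
    show "\<exists>C>0. \<forall>f. (\<forall>i\<in>{1..m}. f i \<in> B_space s (t i) (\<alpha> i)) \<longrightarrow>
          A_norm (\<lambda>k. cube (\<zeta> k) (l k)) p q m \<mu> f \<le> ennreal C * (\<Prod>i=1..m. B_norm s (t i) (\<alpha> i) (f i))"
    proof (rule embedding_of_measure_bound[where X = "\<lambda>i. B_space s (t i) (\<alpha> i)" and Nm = "\<lambda>i. B_norm s (t i) (\<alpha> i)",
          OF whitney borel pq s m _ *])
      fix i assume i: "i \<in> {1..m}"
      show "\<exists>K\<ge>0. \<forall>f\<in>B_space s (t i) (\<alpha> i). \<exists>y. (\<forall>k. \<forall>z\<in>cube (\<zeta> k) (l k).
          ennreal (\<bar>f z\<bar> powr s * snd (\<zeta> k) powr E i) \<le> y k) \<and> (\<Sum>k. y k) \<le> ennreal K * epow (B_norm s (t i) (\<alpha> i) f) s"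
        by (rule function_space_upper_bound[where N = "B_norm s (t i) (\<alpha> i)",
          OF whitney ti[OF i] sum_energy_le_B_norm[OF whitney ti[OF i]] B_norm_zero_ext E(1)]) (simp add: B_space_def)
    qed
  qed
  moreover have "?F = ?mu"
    unfolding Delta E_def[symmetric] \<alpha>_def[symmetric]
  proof
    assume *: "\<exists>C>0. \<forall>f. (\<forall>i\<in>{1..m}. f i \<in> F_space s (t i) (\<alpha> i)) \<longrightarrow>
          A_norm (\<lambda>k. cube (\<zeta> k) (l k)) p q m \<mu> f \<le> ennreal C * (\<Prod>i=1..m. F_norm s (t i) (\<alpha> i) (f i))"
    show "\<exists>C>0. \<forall>k. emeasure \<mu> (cube (\<zeta> k) (l k)) \<le> ennreal (C * snd (\<zeta> k) powr (\<Sum>i=1..m. p * E i / s))"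
    proof (rule measure_bound_of_embedding[where X = "\<lambda>i. F_space s (t i) (\<alpha> i)" and Nm = "\<lambda>i. F_norm s (t i) (\<alpha> i)",
          OF whitney borel pq s(1) M0 _ _ *])
      fix i assume i: "i \<in> {1..m}"
      show "test_fun M \<xi> \<eta> \<in> F_space s (t i) (\<alpha> i)" if "0 < \<eta>" for \<xi> :: "real^'n" and \<eta>
        using i that by (rule testF)
      show "\<exists>C\<ge>0. \<forall>\<xi> :: real^'n. \<forall>\<eta>>0. F_norm s (t i) (\<alpha> i) (test_fun M \<xi> \<eta>) \<le> ennreal (C * \<eta> powr (E i / s - (real M + real CARD('n) - 1)))"
        using test[OF i] by blast
    qed
  next
    assume *: "\<exists>C>0. \<forall>k. emeasure \<mu> (cube (\<zeta> k) (l k)) \<le> ennreal (C * snd (\<zeta> k) powr (\<Sum>i=1..m. p * E i / s))"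
    show "\<exists>C>0. \<forall>f. (\<forall>i\<in>{1..m}. f i \<in> F_space s (t i) (\<alpha> i)) \<longrightarrow>
          A_norm (\<lambda>k. cube (\<zeta> k) (l k)) p q m \<mu> f \<le> ennreal C * (\<Prod>i=1..m. F_norm s (t i) (\<alpha> i) (f i))"
    proof (rule embedding_of_measure_bound[where X = "\<lambda>i. F_space s (t i) (\<alpha> i)" and Nm = "\<lambda>i. F_norm s (t i) (\<alpha> i)",
          OF whitney borel pq s m _ *])
      fix i assume i: "i \<in> {1..m}"
      show "\<exists>K\<ge>0. \<forall>f\<in>F_space s (t i) (\<alpha> i). \<exists>y. (\<forall>k. \<forall>z\<in>cube (\<zeta> k) (l k).
          ennreal (\<bar>f z\<bar> powr s * snd (\<zeta> k) powr E i) \<le> y k) \<and> (\<Sum>k. y k) \<le> ennreal K * epow (F_norm s (t i) (\<alpha> i) f) s"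
        by (rule function_space_upper_bound[where N = "F_norm s (t i) (\<alpha> i)",
          OF whitney ti[OF i] sum_energy_le_F_norm[OF whitney ti[OF i]] F_norm_zero_ext E(1)]) (simp add: F_space_def)
    qed
  qed
  ultimately show ?thesis by simp
qed

end
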